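(* There exist constants $C>0$, $\epsilon_0>0$, $\delta_0>0$ such that the following holds for all $\epsilon\in(0,\epsilon_0)$, $\delta\in(0,\delta_0)$. Let $a,b\in\mathbb{R}$, $H(x,y)=ax+by$ on $\mathbb{R}^2$, and let $u$ be a solution for $H$ (in the sense of the context). With $$N_v=\Big\{(x,y):\ |x|<1+\tfrac{\epsilon}{2}-\sqrt{1-y^2},\ |y|<\tfrac{\sqrt3}{2}\Big\},$$ $$N_h=\Big\{(x,y):\ \big|y-1-\tfrac{\delta}{2}\big|<1+\tfrac{\delta}{2}-\sqrt{1-(x-1-\tfrac{\epsilon}{2})^2},\ \big|x-1-\tfrac{\epsilon}{2}\big|<\tfrac{\sqrt3}{2}\Big\},$$ $$S(x,y)=-2\sqrt{\delta}\,\frac{(x-1-\frac{\epsilon}{2})(y-1-\frac{\delta}{2})}{\big((x-1-\frac{\epsilon}{2})^2+\delta\big)^2},$$ we have $$\nabla u(x,y)=2b\Big(\frac{1}{\delta+(x-1-\frac{\epsilon}{2})^2}(0,1)+\frac{1}{\sqrt\delta}S(x,y)(1,0)\Big)+R_1(x,y)\quad\text{for all }(x,y)\in N_h,$$ and there is a constant $\mu_0$ with $\frac1C<\mu_0<C$ such that $$\nabla u(x,y)=a\,\mu_0\frac{\sqrt\epsilon}{\epsilon+y^2}(1,0)+R_2(x,y)\quad\text{for all }(x,y)\in N_v,$$ where $\|R_1\|_{L^\infty(N_h)}+\|R_2\|_{L^\infty(N_v)}\le C(|a|+|b|)$.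
   Context: Let $\epsilon,\delta>0$. For each integer $n$, $D_{Rn}$ is the open unit disk centered at $(1+\frac{\epsilon}{2},\,n(2+\delta))$ and $D_{Ln}$ is the open unit disk centered at $(-1-\frac{\epsilon}{2},\,n(2+\delta))$; let $\mathcal D=\bigcup_{n\in\mathbb Z}(D_{Ln}\cup D_{Rn})$. Let $\Omega=\mathbb{R}\times(-1-\frac{\delta}{2},1+\frac{\delta}{2})$. On disk boundaries, $\nu$ denotes the unit normal pointing into the disk. Given a harmonic $H$ on $\mathbb{R}^2$ with $\nabla H(x,y)=\nabla H(x,y+2+\delta)$, a solution for $H$ is a function $u$ harmonic in $\mathbb{R}^2\setminus\overline{\mathcal D}$ such that: $u$ is constant on $\partial D_{L0}$ and constant on $\partial D_{R0}$; $\int_{\partial D_{L0}}\partial_\nu u\,ds=\int_{\partial D_{R0}}\partial_\nu u\,ds=0$; $\int_{\Omega\setminus\overline{D_{L0}\cup D_{R0}}}|\nabla(u-H)|^2\,dx\,dy<\infty$; and $\nabla u(x,y)=\nabla u(x,y+2+\delta)$ for all $(x,y)\in\mathbb{R}^2\setminus\overline{\mathcal D}$. *)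

theory Defs
  imports "HOL-Analysis.Analysis"
begin

text \<open>Points of the plane are pairs (x,y) :: real \<times> real; the product metric/inner
product on real \<times> real is the Euclidean one.\<close>

definition pd1 :: "(real \<times> real \<Rightarrow> real) \<Rightarrow> real \<times> real \<Rightarrow> real" where
  "pd1 f p = frechet_derivative f (at p) (1, 0)"

definition pd2 :: "(real \<times> real \<Rightarrow> real) \<Rightarrow> real \<times> real \<Rightarrow> real" where
  "pd2 f p = frechet_derivative f (at p) (0, 1)"

definition grad :: "(real \<times> real \<Rightarrow> real) \<Rightarrow> real \<times> real \<Rightarrow> real \<times> real" where
  "grad f p = (pd1 f p, pd2 f p)"

definition harmonic_on :: "(real \<times> real) set \<Rightarrow> (real \<times> real \<Rightarrow> real) \<Rightarrow> bool" where
  "harmonic_on S f \<longleftrightarrow> open S \<and>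
     (\<forall>p\<in>S. f differentiable (at p)) \<and>
     (\<forall>p\<in>S. pd1 f differentiable (at p) \<and> pd2 f differentiable (at p)) \<and>
     continuous_on S (pd1 (pd1 f)) \<and> continuous_on S (pd2 (pd1 f)) \<and>
     continuous_on S (pd1 (pd2 f)) \<and> continuous_on S (pd2 (pd2 f)) \<and>
     (\<forall>p\<in>S. pd1 (pd1 f) p + pd2 (pd2 f) p = 0)"

definition cR :: "real \<Rightarrow> real \<Rightarrow> int \<Rightarrow> real \<times> real" where
  "cR \<epsilon> \<delta> n = (1 + \<epsilon>/2, real_of_int n * (2 + \<delta>))"

definition cL :: "real \<Rightarrow> real \<Rightarrow> int \<Rightarrow> real \<times> real" where
  "cL \<epsilon> \<delta> n = (-1 - \<epsilon>/2, real_of_int n * (2 + \<delta>))"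

definition disks :: "real \<Rightarrow> real \<Rightarrow> (real \<times> real) set" where
  "disks \<epsilon> \<delta> = (\<Union>n. ball (cL \<epsilon> \<delta> n) 1 \<union> ball (cR \<epsilon> \<delta> n) 1)"

definition Omega :: "real \<Rightarrow> (real \<times> real) set" where
  "Omega \<delta> = UNIV \<times> {-1 - \<delta>/2 <..< 1 + \<delta>/2}"

definition ext_dom :: "real \<Rightarrow> real \<Rightarrow> (real \<times> real) set" where
  "ext_dom \<epsilon> \<delta> = UNIV - closure (disks \<epsilon> \<delta>)"

definition const_on_bdry :: "(real \<times> real) set \<Rightarrow> real \<times> real \<Rightarrow> (real \<times> real \<Rightarrow> real) \<Rightarrow> bool" where
  "const_on_bdry E c u \<longleftrightarrow> (\<exists>k. \<forall>q\<in>sphere c 1. (u \<longlongrightarrow> k) (at q within E))"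

text \<open>Zero flux: the normal derivative (nu pointing into the disk, i.e. nu = -(cos t, sin t)
at c + (cos t, sin t)) is the boundary limit of the gradient, and its integral w.r.t.
arc length over the unit circle vanishes.\<close>
definition zero_flux :: "(real \<times> real) set \<Rightarrow> real \<times> real \<Rightarrow> (real \<times> real \<Rightarrow> real) \<Rightarrow> bool" where
  "zero_flux E c u \<longleftrightarrow> (\<exists>G. (\<forall>q\<in>sphere c 1. (grad u \<longlongrightarrow> G q) (at q within E)) \<and>
      ((\<lambda>t. G (c + (cos t, sin t)) \<bullet> (- (cos t, sin t))) has_integral 0) {0 .. 2 * pi})"

definition is_solution :: "real \<Rightarrow> real \<Rightarrow> (real \<times> real \<Rightarrow> real) \<Rightarrow> (real \<times> real \<Rightarrow> real) \<Rightarrow> bool" where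
  "is_solution \<epsilon> \<delta> H u \<longleftrightarrow>
     harmonic_on (ext_dom \<epsilon> \<delta>) u \<and>
     const_on_bdry (ext_dom \<epsilon> \<delta>) (cL \<epsilon> \<delta> 0) u \<and>
     const_on_bdry (ext_dom \<epsilon> \<delta>) (cR \<epsilon> \<delta> 0) u \<and>
     zero_flux (ext_dom \<epsilon> \<delta>) (cL \<epsilon> \<delta> 0) u \<and>
     zero_flux (ext_dom \<epsilon> \<delta>) (cR \<epsilon> \<delta> 0) u \<and>
     (\<lambda>p. (pd1 u p - pd1 H p)\<^sup>2 + (pd2 u p - pd2 H p)\<^sup>2) integrable_on
        (Omega \<delta> - closure (ball (cL \<epsilon> \<delta> 0) 1 \<union> ball (cR \<epsilon> \<delta> 0) 1)) \<and>
     (\<forall>x y. (x, y) \<in> ext_dom \<epsilon> \<delta> \<longrightarrow> grad u (x, y) = grad u (x, y + 2 + \<delta>))"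

definition Nv :: "real \<Rightarrow> (real \<times> real) set" where
  "Nv \<epsilon> = {(x, y). \<bar>x\<bar> < 1 + \<epsilon>/2 - sqrt (1 - y\<^sup>2) \<and> \<bar>y\<bar> < sqrt 3 / 2}"

definition Nh :: "real \<Rightarrow> real \<Rightarrow> (real \<times> real) set" where
  "Nh \<epsilon> \<delta> = {(x, y). \<bar>y - 1 - \<delta>/2\<bar> < 1 + \<delta>/2 - sqrt (1 - (x - 1 - \<epsilon>/2)\<^sup>2)
                    \<and> \<bar>x - 1 - \<epsilon>/2\<bar> < sqrt 3 / 2}"

definition Sfun :: "real \<Rightarrow> real \<Rightarrow> real \<times> real \<Rightarrow> real" where
  "Sfun \<epsilon> \<delta> p = (let x = fst p; y = snd p in
     - 2 * sqrt \<delta> * ((x - 1 - \<epsilon>/2) * (y - 1 - \<delta>/2)) / ((x - 1 - \<epsilon>/2)\<^sup>2 + \<delta>)\<^sup>2)"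

end

theory Submission
  imports Defs "HOL-Complex_Analysis.Complex_Analysis"
begin

text \<open>
  In complex notation \<open>f = u\<^sub>x - \<i> u\<^sub>y\<close> is holomorphic, and everything rests on the maximum principle. Finite energy and
  periodicity make \<open>u - H\<close> periodic and bounded at \<open>\<plusminus>\<infinity>\<close>, hence \<open>\<bar>u - H\<bar> = O(\<bar>a\<bar> + \<bar>b\<bar>)\<close> once the difference \<open>2k\<close> of the
  two boundary constants is controlled. By reflection only the part of \<open>u\<close> odd in \<open>x\<close> sees \<open>k\<close>; comparing it from above
  and below with the periodic potential of poles at distance \<open>p \<sim> \<surd>\<epsilon>\<close> from the axis, and using that the flux through the
  axis is \<open>a (2 + \<delta>)\<close> per period, gives \<open>k \<sim> a \<surd>\<epsilon>\<close>. The upper comparison needs that almost nothing leaks through the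
  horizontal gaps, where \<open>s\<^sup>2 - t\<^sup>2 + \<delta>\<close> is a barrier.

  Around the disk \<open>D\<^sub>R\<^sub>0\<close> subtract from \<open>u\<close> the three explicit bipolar potentials that carry its jumps to the neighbouring
  disks. The remainder is at most \<open>C (\<bar>a\<bar> + \<bar>b\<bar>) ln \<bar>z - c\<bar>\<close>, so it is at most a multiple of the distance to the disk, and
  the interior gradient estimate on a ball of radius proportional to that distance bounds its gradient uniformly, even in
  the gaps: a point of a gap is always treated from its nearest disk. What remains is to expand the bipolar potentials.
\<close>

section \<open>Harmonic functions and the maximum principle\<close>

text \<open>All constants must survive \<open>\<epsilon>\<close> and \<open>\<delta>\<close> tending
  to 0 independently of each other. The two halves of the claim differ for one reason: the jump of
  \<open>u\<close> across a horizontal gap is forced by periodicity to be \<open>b * T\<close>, so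
  its coefficient is explicit, whereas the jump across a vertical gap is fixed only by the zero-flux
  condition, a global one, and is found up to a bounded factor, which becomes \<open>\<mu>0\<close>.
  The comparison potential \<open>psi\<close> has flux of order 1 through the axis and boundary
  values of order \<open>p\<close>; matching it with a solution of flux \<open>a * T\<close> gives
  the order of \<open>k\<close>. Bounding \<open>\<bar>a\<bar>\<close> by \<open>k\<close> is the
  delicate direction: the crude estimate of the odd part allows an excess of order \<open>a\<close>
  in the middle of a horizontal gap, far more than \<open>k\<close>, and only the barrier in the gap
  lowers this excess to order \<open>a * \<delta>\<close>.\<close>

text \<open>\<open>hgrad S V f\<close> says that \<open>V\<close> is harmonic on \<open>S\<close>, witnessed by the holomorphic \<open>f = V\<^sub>x - \<i> V\<^sub>y\<close>.\<close>

definition hgrad :: "complex set \<Rightarrow> (complex \<Rightarrow> real) \<Rightarrow> (complex \<Rightarrow> complex) \<Rightarrow> bool" where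
  "hgrad S V f \<longleftrightarrow> open S \<and> f holomorphic_on S \<and>
     (\<forall>z\<in>S. (V has_derivative (\<lambda>h. Re (f z * h))) (at z))"

lemma hgradD:
  assumes "hgrad S V f"
  shows "open S" "f holomorphic_on S" "\<And>z. z \<in> S \<Longrightarrow> (V has_derivative (\<lambda>h. Re (f z * h))) (at z)"
  using assms by (auto simp: hgrad_def)

lemma hgrad_subset: "hgrad S V f \<Longrightarrow> open S' \<Longrightarrow> S' \<subseteq> S \<Longrightarrow> hgrad S' V f"
  unfolding hgrad_def by (auto intro: holomorphic_on_subset)

lemma hgrad_isCont: "hgrad S V f \<Longrightarrow> z \<in> S \<Longrightarrow> isCont V z"
  by (meson has_derivative_continuous hgradD(3))

lemma hgrad_const: "open S \<Longrightarrow> hgrad S (\<lambda>z. r) (\<lambda>z. 0)"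
  by (auto simp: hgrad_def)

lemma hgrad_add:
  assumes "hgrad S V f" "hgrad S W g"
  shows "hgrad S (\<lambda>z. V z + W z) (\<lambda>z. f z + g z)"
  using assms unfolding hgrad_def
  by (auto intro!: derivative_eq_intros holomorphic_intros simp: algebra_simps)

lemma hgrad_diff:
  assumes "hgrad S V f" "hgrad S W g"
  shows "hgrad S (\<lambda>z. V z - W z) (\<lambda>z. f z - g z)"
  using assms unfolding hgrad_def
  by (auto intro!: derivative_eq_intros holomorphic_intros simp: algebra_simps)

lemma hgrad_scale:
  assumes "hgrad S V f"
  shows "hgrad S (\<lambda>z. r * V z) (\<lambda>z. of_real r * f z)"
  using assms unfolding hgrad_def
  by (auto intro!: derivative_eq_intros holomorphic_intros simp: algebra_simps)

lemma hgrad_Re_primitive: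
  assumes "open S" "f holomorphic_on S" "\<And>z. z \<in> S \<Longrightarrow> (h has_field_derivative f z) (at z)"
  shows "hgrad S (\<lambda>z. Re (h z)) f"
  unfolding hgrad_def
proof (intro conjI ballI assms(1,2))
  fix z assume "z \<in> S"
  then have "(h has_derivative (\<lambda>x. f z * x)) (at z)"
    using assms(3) has_field_derivative_def by blast
  then show "((\<lambda>z. Re (h z)) has_derivative (\<lambda>x. Re (f z * x))) (at z)"
    by (rule has_derivative_Re)
qed

lemma hgrad_Re: "open S \<Longrightarrow> hgrad S Re (\<lambda>z. 1)"
  using hgrad_Re_primitive[of S "\<lambda>z. 1" "\<lambda>z. z"] by (auto intro: derivative_intros)

lemma hgrad_Im: "open S \<Longrightarrow> hgrad S Im (\<lambda>z. - \<i>)"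
  by (auto simp: hgrad_def intro!: derivative_eq_intros)

lemma hgrad_ln_cmod:
  assumes "open S" "\<And>z. z \<in> S \<Longrightarrow> (g has_field_derivative g' z) (at z)"
    and nz: "\<And>z. z \<in> S \<Longrightarrow> g z \<noteq> 0"
  shows "hgrad S (\<lambda>z. ln (cmod (g z))) (\<lambda>z. g' z / g z)"
  unfolding hgrad_def
proof (intro conjI ballI assms(1))
  have hol: "g holomorphic_on S"
    using assms(2) by (meson holomorphic_on_def field_differentiable_def has_field_derivative_at_within)
  have "(\<lambda>z. deriv g z / g z) holomorphic_on S"
    using hol nz assms(1) by (intro holomorphic_intros) auto
  moreover have "deriv g z = g' z" if "z \<in> S" for z
    using assms(2) that by (simp add: DERIV_imp_deriv)
  ultimately show "(\<lambda>z. g' z / g z) holomorphic_on S"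
    by (metis (no_types, lifting) holomorphic_cong)
  fix z assume z: "z \<in> S"
  then have d: "(g has_derivative (\<lambda>x. g' z * x)) (at z)"
    using assms(2) has_field_derivative_def by blast
  have n: "cmod (g z) > 0" using nz z by simp
  have "((\<lambda>z. cmod (g z)) has_derivative (\<lambda>x. inner (sgn (g z)) (g' z * x))) (at z)"
    using has_derivative_compose[OF d has_derivative_norm] nz z by (auto simp: inner_commute)
  then have "((\<lambda>z. ln (cmod (g z))) has_derivative (\<lambda>x. inner (sgn (g z)) (g' z * x) * inverse (cmod (g z)))) (at z)"
    using n by (auto intro!: derivative_eq_intros simp: divide_inverse)
  moreover have "inner (sgn w) (v * x) * inverse (cmod w) = Re (v / w * x)" if "w \<noteq> 0" for w v x :: complex
  proof -
    have "v / w * x = (v * x) * cnj w / of_real ((cmod w)\<^sup>2)"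
      using that by (metis complex_div_cnj mult.commute times_divide_eq_right mult.left_commute)
    then have "Re (v / w * x) = Re ((v * x) * cnj w) / (cmod w)\<^sup>2"
      by (metis Re_divide_of_real)
    moreover have "inner (sgn w) (v * x) = Re ((v * x) * cnj w) / cmod w"
      by (simp add: inner_complex_def sgn_eq Re_divide_of_real Im_divide_of_real algebra_simps add_divide_distrib diff_divide_distrib)
    ultimately show ?thesis
      by (simp add: power2_eq_square divide_inverse mult.assoc)
  qed
  ultimately show "((\<lambda>z. ln (cmod (g z))) has_derivative (\<lambda>x. Re (g' z / g z * x))) (at z)"
    using nz z by simp
qed

lemma hgrad_line_deriv:
  assumes "hgrad S V f" "z + of_real t * e \<in> S"
  shows "((\<lambda>t. V (z + of_real t * e)) has_real_derivative Re (f (z + of_real t * e) * e)) (at t)"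
proof -
  have 1: "((\<lambda>t::real. z + of_real t * e) has_derivative (\<lambda>h. of_real h * e)) (at t)"
    by (auto intro!: derivative_eq_intros)
  have "((\<lambda>t. V (z + of_real t * e)) has_derivative (\<lambda>h. Re (f (z + of_real t * e) * (of_real h * e)))) (at t)"
    using has_derivative_compose[OF 1 hgradD(3)[OF assms]] .
  then show ?thesis
    unfolding has_field_derivative_def
    by (rule has_derivative_eq_rhs) (auto simp: algebra_simps)
qed

lemma tendsto_eventually_less:
  fixes V :: "'a::topological_space \<Rightarrow> real"
  assumes "(V \<longlongrightarrow> l) (at q within S)" "l \<le> M" "0 < \<eta>"
  shows "eventually (\<lambda>z. V z < M + \<eta>) (at q within S)"
  using order_tendstoD(2)[OF assms(1), of "M + \<eta>"] assms by linarith

lemma isCont_eventually_less: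
  fixes V :: "'a::t2_space \<Rightarrow> real"
  assumes "isCont V q" "V q \<le> M" "0 < \<eta>"
  shows "eventually (\<lambda>z. V z < M + \<eta>) (at q within S)"
  by (rule tendsto_eventually_less[OF _ assms(2,3)])
    (use assms(1) continuous_at_imp_continuous_at_within continuous_within in blast)

text \<open>\<open>K\<close> is a compact fundamental domain: for bounded \<open>S\<close> any compact superset, for periodic \<open>S\<close> one period.\<close>

lemma weak_max_principle:
  assumes hg: "hgrad S V f" and K: "compact K"
    and red: "\<And>z. z \<in> S \<Longrightarrow> \<exists>z'\<in>S \<inter> K. V z' = V z \<and> Re z' = Re z"
    and bd: "\<And>q \<eta>. q \<in> K \<Longrightarrow> q \<notin> S \<Longrightarrow> 0 < \<eta> \<Longrightarrow> eventually (\<lambda>z. V z < M + \<eta>) (at q within S)"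
    and z0: "z0 \<in> S"
  shows "V z0 \<le> M"
proof (rule ccontr)
  assume "\<not> V z0 \<le> M"
  \<comment> \<open>Thirds of the excess: one for the boundary estimate, one for the perturbation
    below, so that \<open>W\<close> stays under \<open>M + 3 * \<tau>\<close> near the
    boundary.\<close>
  define \<tau> where "\<tau> = (V z0 - M) / 3"
  have \<tau>: "\<tau> > 0" "V z0 = M + 3 * \<tau>" using \<open>\<not> V z0 \<le> M\<close> by (auto simp: \<tau>_def field_simps)
  obtain B where B: "B > 0" "\<And>z. z \<in> K \<Longrightarrow> cmod z \<le> B"
    using compact_imp_bounded[OF K] bounded_pos by metis
  define \<eta> where "\<eta> = \<tau> / (2 * B\<^sup>2)"
  have \<eta>: "\<eta> > 0" using \<tau> B by (simp add: \<eta>_def)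
  \<comment> \<open>The perturbation makes \<open>W\<close> strictly subharmonic. It depends on
    \<open>Re z\<close> alone because the reduction into \<open>K\<close> preserves only
    \<open>V\<close> and \<open>Re z\<close>.\<close>
  define W where "W z = V z + \<eta> * (Re z)\<^sup>2" for z
  have Re2: "\<eta> * (Re z)\<^sup>2 < \<tau>" if "z \<in> K" for z
  proof -
    have "(Re z)\<^sup>2 \<le> B\<^sup>2"
      using B(2)[OF that] abs_Re_le_cmod[of z] by (metis abs_ge_zero order_trans power2_abs power_mono)
    then have "\<eta> * (Re z)\<^sup>2 \<le> \<eta> * B\<^sup>2" using \<eta> by (intro mult_left_mono) auto
    also have "\<dots> = \<tau> / 2" using B by (simp add: \<eta>_def field_simps)
    finally show ?thesis using \<tau> by linarith
  qed
  have contW: "isCont W z" if "z \<in> S" for z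
    unfolding W_def using hgrad_isCont[OF hg that] by (intro continuous_intros) auto
  define A where "A = {z \<in> S \<inter> K. W z \<ge> M + 3 * \<tau>}"
  obtain z1 where z1: "z1 \<in> S \<inter> K" "V z1 = V z0" "Re z1 = Re z0" using red[OF z0] by blast
  have "z1 \<in> A"
    using z1 \<tau> \<eta> by (auto simp: A_def W_def)
  have "closed A"
    unfolding closed_sequential_limits
  proof (intro allI impI, elim conjE)
    fix x l assume x: "\<forall>n. x n \<in> A" and lim: "x \<longlonglongrightarrow> l"
    have lK: "l \<in> K"
      using x lim compact_imp_closed[OF K] unfolding closed_sequential_limits A_def by blast
    have lS: "l \<in> S"
    proof (rule ccontr)
      assume "l \<notin> S"
      from bd[OF lK this \<tau>(1)] have "eventually (\<lambda>z. V z < M + \<tau>) (at l within S)" .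
      moreover have "filterlim x (at l within S) sequentially"
        unfolding filterlim_at using lim x \<open>l \<notin> S\<close> by (auto simp: A_def intro!: always_eventually)
      ultimately have "eventually (\<lambda>n. V (x n) < M + \<tau>) sequentially"
        by (rule eventually_compose_filterlim)
      then obtain n where "V (x n) < M + \<tau>" by (auto simp: eventually_sequentially)
      moreover have "W (x n) \<ge> M + 3 * \<tau>" "x n \<in> K" using x by (auto simp: A_def)
      ultimately show False using Re2[of "x n"] \<tau> by (simp add: W_def)
    qed
    have "(\<lambda>n. W (x n)) \<longlonglongrightarrow> W l"
      using contW[OF lS] lim by (simp add: isCont_tendsto_compose)
    then have "W l \<ge> M + 3 * \<tau>"
      using x by (intro LIMSEQ_le_const) (auto simp: A_def)
    then show "l \<in> A" using lK lS by (simp add: A_def)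
  qed
  moreover have "A \<subseteq> K" by (auto simp: A_def)
  ultimately have "compact A" using K by (metis compact_Int_closed inf.absorb_iff2)
  moreover have "continuous_on A W"
    using contW by (intro continuous_at_imp_continuous_on) (auto simp: A_def)
  ultimately obtain p where p: "p \<in> A" "\<And>z. z \<in> A \<Longrightarrow> W z \<le> W p"
    using continuous_attains_sup[of A W] \<open>z1 \<in> A\<close> by blast
  have pS: "p \<in> S" and pm: "W p \<ge> M + 3 * \<tau>" using p by (auto simp: A_def)
  have max: "W z \<le> W p" if zS: "z \<in> S" for z
  proof -
    obtain z' where z': "z' \<in> S \<inter> K" "V z' = V z" "Re z' = Re z" using red[OF zS] by blast
    then have "W z = W z'" by (simp add: W_def)
    then show ?thesis using p(2)[of z'] z' pm by (cases "z' \<in> A") (auto simp: A_def)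
  qed
  have fd: "(f has_field_derivative deriv f p) (at p)"
    using hgradD(1,2)[OF hg] pS holomorphic_derivI by blast
  \<comment> \<open>The second derivative of \<open>V\<close> along \<open>e\<close> is the real
    part of \<open>deriv f p * e\<^sup>2\<close>: nonnegative along 1, where the perturbation adds
    \<open>2 * \<eta>\<close>, or else positive along \<i>. Either way \<open>W\<close> has a
    positive second derivative along \<open>e\<close> at its maximum.\<close>
  define e :: complex where "e = (if Re (deriv f p) \<ge> 0 then 1 else \<i>)"
  define \<gamma> where "\<gamma> t = p + of_real t * e" for t :: real
  obtain r where r: "r > 0" "ball p r \<subseteq> S"
    using hgradD(1)[OF hg] pS open_contains_ball by blast
  have norme: "cmod e = 1" by (simp add: e_def)
  have \<gamma>S: "\<gamma> t \<in> S" if "\<bar>t\<bar> < r" for t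
  proof -
    have "dist p (\<gamma> t) = \<bar>t\<bar>" by (simp add: \<gamma>_def dist_norm norm_mult norme)
    then show ?thesis using r that by auto
  qed
  define D where "D t = Re (f (\<gamma> t) * e) + \<eta> * (2 * Re (\<gamma> t) * Re e)" for t
  have WD: "((\<lambda>t. W (\<gamma> t)) has_real_derivative D t) (at t)" if "\<bar>t\<bar> < r" for t
  proof -
    have "((\<lambda>t. V (p + of_real t * e)) has_real_derivative Re (f (p + of_real t * e) * e)) (at t)"
      using hgrad_line_deriv[OF hg] \<gamma>S[OF that] by (auto simp: \<gamma>_def)
    then show ?thesis
      unfolding W_def D_def \<gamma>_def by (auto intro!: derivative_eq_intros)
  qed
  have DD: "(D has_real_derivative (Re (deriv f p * e * e) + \<eta> * (2 * Re e * Re e))) (at 0)"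
  proof -
    have 1: "((\<lambda>t::real. p + of_real t * e) has_derivative (\<lambda>h. of_real h * e)) (at 0)"
      by (auto intro!: derivative_eq_intros)
    have 2: "(f has_derivative (\<lambda>h. deriv f p * h)) (at (p + of_real (0::real) * e))"
      using fd by (simp add: has_field_derivative_def)
    have "((\<lambda>t. f (p + of_real t * e)) has_derivative (\<lambda>h. deriv f p * (of_real h * e))) (at 0)"
      using has_derivative_compose[OF 1 2] .
    then have "((\<lambda>t. f (p + of_real t * e) * e) has_derivative (\<lambda>h. deriv f p * (of_real h * e) * e)) (at 0)"
      by (intro derivative_intros)
    then have "((\<lambda>t. Re (f (p + of_real t * e) * e)) has_derivative (\<lambda>h. Re (deriv f p * (of_real h * e) * e))) (at 0)"
      by (rule has_derivative_Re)
    moreover have "(\<lambda>h. Re (deriv f p * (of_real h * e) * e)) = (\<lambda>h. Re (deriv f p * e * e) * h)"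
      by (rule ext) (simp add: e_def)
    ultimately have "((\<lambda>t. Re (f (p + of_real t * e) * e)) has_real_derivative Re (deriv f p * e * e)) (at 0)"
      by (simp add: has_field_derivative_def)
    moreover have "((\<lambda>t. \<eta> * (2 * Re (p + of_real t * e) * Re e)) has_real_derivative \<eta> * (2 * Re e * Re e)) (at 0)"
      by (auto intro!: derivative_eq_intros)
    ultimately show ?thesis unfolding D_def \<gamma>_def by (rule DERIV_add)
  qed
  have D0: "D 0 = 0"
    using WD[of 0] r max[OF \<gamma>S] by (intro DERIV_local_max[of "\<lambda>t. W (\<gamma> t)" _ 0 r]) (auto simp: \<gamma>_def)
  have pos: "Re (deriv f p * e * e) + \<eta> * (2 * Re e * Re e) > 0"
    using \<eta> by (auto simp: e_def)
  obtain d where d: "d > 0" "\<And>h. 0 < h \<Longrightarrow> h < d \<Longrightarrow> D 0 < D (0 + h)"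
    using DERIV_pos_inc_right[OF DD pos] by auto
  define m where "m = min d r / 2"
  have m: "0 < m" "m < d" "m < r" using d r by (auto simp: m_def)
  obtain x where x: "0 < x" "x < m" "W (\<gamma> m) - W (\<gamma> 0) = (m - 0) * D x"
    using MVT2[of 0 m "\<lambda>t. W (\<gamma> t)" D] m WD by auto
  have "D x > 0" using d(2)[of x] x m D0 by auto
  then have "W (\<gamma> m) > W (\<gamma> 0)" using x m by (smt (verit) mult_pos_pos)
  then show False using max[OF \<gamma>S[of m]] m by (simp add: \<gamma>_def)
qed

text \<open>Cauchy's estimate applied to \<open>exp (h / K)\<close>, where \<open>V = Re h\<close>.\<close>

lemma hgrad_gradient_estimate:
  assumes hg: "hgrad (ball z r) V f" and r: "r > 0" and K: "K > 0"
    and bd: "\<And>w. w \<in> ball z r \<Longrightarrow> \<bar>V w\<bar> \<le> K"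
  shows "cmod (f z) \<le> exp 2 * K / r"
proof -
  obtain h where h: "\<And>x. x \<in> ball z r \<Longrightarrow> (h has_field_derivative f x) (at x within ball z r)"
    using holomorphic_convex_primitive'[of "ball z r" f] hgradD[OF hg] by auto
  have h': "(h has_field_derivative f x) (at x)" if "x \<in> ball z r" for x
    using h[OF that] that by (metis at_within_open open_ball)
  have "hgrad (ball z r) (\<lambda>w. V w - Re (h w)) (\<lambda>w. f w - f w)"
    by (intro hgrad_diff hg hgrad_Re_primitive h' hgradD[OF hg])
  then have "\<exists>k. \<forall>x\<in>ball z r. V x - Re (h x) = k"
    by (intro has_derivative_zero_constant) (auto simp: hgrad_def has_derivative_at_withinI)
  then obtain k where k: "\<And>x. x \<in> ball z r \<Longrightarrow> V x = Re (h x) + k" by (metis diff_eq_eq add.commute)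
  \<comment> \<open>The modulus of \<open>g\<close> depends on \<open>V\<close> alone, so the
    conjugate of \<open>V\<close> needs no bound; \<open>f / K\<close> is the logarithmic derivative
    of \<open>g\<close>. The upper and the lower bound of the modulus each cost a factor
    \<open>exp 1\<close>.\<close>
  define g where "g w = exp ((h w + of_real k) / of_real K)" for w
  have g': "(g has_field_derivative g w * (f w / of_real K)) (at w)" if "w \<in> ball z r" for w
    unfolding g_def using K by (auto intro!: derivative_eq_intros h' that)
  have ng: "cmod (g w) \<le> exp 1" "cmod (g w) \<ge> exp (-1)" if "w \<in> ball z r" for w
  proof -
    have "cmod (g w) = exp (V w / K)"
      using K k[OF that] by (simp add: g_def Re_divide_of_real)
    moreover have "\<bar>V w / K\<bar> \<le> 1" using bd[OF that] K by (simp add: abs_divide)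
    ultimately show "cmod (g w) \<le> exp 1" "cmod (g w) \<ge> exp (-1)" by (simp_all add: abs_le_iff del: abs_divide)
  qed
  have est: "cmod (f z) * \<rho> \<le> exp 2 * K" if \<rho>: "0 < \<rho>" "\<rho> < r" for \<rho>
  proof -
    have sub: "cball z \<rho> \<subseteq> ball z r" using \<rho> by auto
    have hol: "g holomorphic_on ball z r"
      using g' by (meson holomorphic_on_def field_differentiable_def has_field_derivative_at_within)
    have "norm ((deriv ^^ 1) g z) \<le> fact 1 * exp 1 / \<rho> ^ 1"
    proof (rule Cauchy_inequality)
      show "g holomorphic_on ball z \<rho>" using hol \<rho> by (meson ball_subset_cball holomorphic_on_subset sub)
      show "continuous_on (cball z \<rho>) g" using hol sub holomorphic_on_imp_continuous_on holomorphic_on_subset by blast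
      show "norm (g x) \<le> exp 1" if "norm (z - x) = \<rho>" for x
        using ng(1)[of x] that \<rho> by (simp add: dist_norm)
    qed (use \<rho> in auto)
    moreover have "deriv g z = g z * (f z / of_real K)" using g'[of z] r by (simp add: DERIV_imp_deriv)
    ultimately have "cmod (g z) * (cmod (f z) / K) \<le> exp 1 / \<rho>"
      using K by (simp add: norm_mult norm_divide)
    moreover have "exp (-1) * (cmod (f z) / K) \<le> cmod (g z) * (cmod (f z) / K)"
      using ng(2)[of z] r K by (intro mult_right_mono) auto
    ultimately have "exp (-1) * (cmod (f z) / K) \<le> exp 1 / \<rho>" by linarith
    then have "exp 1 * (exp (-1) * (cmod (f z) / K)) \<le> exp 1 * (exp 1 / \<rho>)"
      by (intro mult_left_mono) auto
    then have "cmod (f z) / K \<le> exp 2 / \<rho>"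
      by (simp add: mult.assoc[symmetric] exp_add[symmetric])
    then show ?thesis using K \<rho> by (simp add: field_simps)
  qed
  \<comment> \<open>The bounds hold on the open ball only, so the radius \<open>r\<close> itself is
    reached as a limit.\<close>
  have "((\<lambda>\<rho>. cmod (f z) * \<rho>) \<longlongrightarrow> cmod (f z) * r) (at_left r)"
    by (intro tendsto_intros)
  moreover have "eventually (\<lambda>\<rho>. cmod (f z) * \<rho> \<le> exp 2 * K) (at_left r)"
    using eventually_at_left_real[OF r] by eventually_elim (auto intro: est)
  ultimately have "cmod (f z) * r \<le> exp 2 * K"
    by (intro tendsto_upperbound[where F = "at_left r"]) auto
  then show ?thesis using r by (simp add: field_simps)
qed

section \<open>Periodic functions on a half-plane and their decay\<close>

lemma primitive_shift_const:
  fixes h f :: "complex \<Rightarrow> complex"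
  assumes "\<And>z. X0 < Re z \<Longrightarrow> (h has_field_derivative f z) (at z)"
    and "\<And>z. X0 < Re z \<Longrightarrow> f (z + \<i> * of_real T) = f z"
    and "X0 < Re z" "X0 < Re w"
  shows "h (z + \<i> * of_real T) - h z = h (w + \<i> * of_real T) - h w"
proof -
  have cv: "convex {z. X0 < Re z}" by (rule convex_halfspace_Re_gt)
  have op: "open {z. X0 < Re z}" by (rule open_halfspace_Re_gt)
  have "((\<lambda>z. h (z + \<i> * of_real T) - h z) has_field_derivative 0) (at z)" if "X0 < Re z" for z
  proof -
    have "((\<lambda>z. h (z + \<i> * of_real T)) has_field_derivative f (z + \<i> * of_real T)) (at z)"
      using assms(1)[of "z + \<i> * of_real T"] that by (simp add: DERIV_shift)
    then show ?thesis
      using assms(1)[OF that] assms(2)[OF that] by (auto intro!: derivative_eq_intros)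
  qed
  then have "\<exists>c. \<forall>z\<in>{z. X0 < Re z}. h (z + \<i> * of_real T) - h z = c"
    by (intro has_field_derivative_zero_constant cv) (auto intro: has_field_derivative_at_within)
  then show ?thesis using assms(3,4) by auto
qed

lemma shift_into_period:
  fixes T y :: real
  assumes "T > 0"
  shows "\<exists>n::int. \<bar>y - of_int n * T\<bar> \<le> T/2"
proof -
  have "\<bar>y / T - of_int (round (y / T))\<bar> * T \<le> 1/2 * T"
    using of_int_round_abs_le[of "y / T"] assms by (intro mult_right_mono) (auto simp: abs_minus_commute)
  moreover have "y - of_int (round (y / T)) * T = (y / T - of_int (round (y / T))) * T"
    using assms by (simp add: left_diff_distrib)
  ultimately have "\<bar>y - of_int (round (y / T)) * T\<bar> \<le> T/2"
    using assms by (simp add: abs_mult)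
  then show ?thesis by blast
qed

text \<open>\<open>P\<close> stands for the domain on which periodicity is known; it must be
  invariant in both directions because \<open>n\<close> may be negative.\<close>

lemma periodic_int_shift:
  fixes w z :: complex
  assumes P: "\<And>z. P z \<Longrightarrow> P (z + w)" "\<And>z. P z \<Longrightarrow> P (z - w)"
    and h: "\<And>z. P z \<Longrightarrow> h (z + w) = h z" and z: "P z"
  shows "P (z + of_int n * w)" "h (z + of_int n * w) = h z"
proof -
  have "P (z + of_int n * w) \<and> h (z + of_int n * w) = h z"
  proof (induction n rule: int_induct[of _ 0])
    case base
    show ?case using z by simp
  next
    case (step1 i)
    have e: "z + of_int (i + 1) * w = z + of_int i * w + w" by (simp add: algebra_simps)
    show ?case unfolding e using step1(2) P(1) h by simp
  next
    case (step2 i)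
    have e: "z + of_int i * w = z + of_int (i - 1) * w + w" by (simp add: algebra_simps)
    have "z + of_int (i - 1) * w = z + of_int i * w - w" by (simp add: algebra_simps)
    then have "P (z + of_int (i - 1) * w)" using P(2) step2(2) by metis
    with h[OF this] step2(2) show ?case unfolding e by simp
  qed
  then show "P (z + of_int n * w)" "h (z + of_int n * w) = h z" by auto
qed

lemma Complex_line_integral:
  fixes h f :: "complex \<Rightarrow> complex"
  assumes "\<And>y. y \<in> {y1..y2} \<Longrightarrow> (h has_field_derivative f (Complex x y)) (at (Complex x y))" "y1 \<le> y2"
  shows "((\<lambda>y. \<i> * f (Complex x y)) has_integral (h (Complex x y2) - h (Complex x y1))) {y1..y2}"
proof (rule fundamental_theorem_of_calculus[OF assms(2)])
  fix y assume y: "y \<in> {y1..y2}"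
  have "((\<lambda>y. Complex x y) has_vector_derivative \<i>) (at y within {y1..y2})"
    unfolding has_vector_derivative_def Complex_eq
    by (auto intro!: derivative_eq_intros simp: algebra_simps scaleR_conv_of_real)
  then show "((\<lambda>y. h (Complex x y)) has_vector_derivative \<i> * f (Complex x y)) (at y within {y1..y2})"
    using field_vector_diff_chain_within[of "Complex x" \<i> y "{y1..y2}" h "f (Complex x y)"] assms(1)[OF y]
    by (auto simp: o_def intro: has_field_derivative_at_within)
qed

text \<open>The periodic primitive \<open>h\<close> has constant mean over vertical lines; on the lines where
  \<open>f\<close> is small it is uniformly close to that mean, and the maximum principle fills the gaps.\<close>

lemma periodic_decay:
  fixes f :: "complex \<Rightarrow> complex"
  assumes hol: "f holomorphic_on {z. X0 < Re z}" and T: "T > 0"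
    and per: "\<And>z. X0 < Re z \<Longrightarrow> f (z + \<i> * of_real T) = f z"
    and small: "\<And>\<eta> X. 0 < \<eta> \<Longrightarrow> \<exists>x>X. integral {-T/2..T/2} (\<lambda>y. cmod (f (Complex x y))) < \<eta>"
  obtains h B X1 where "\<And>z. X0 < Re z \<Longrightarrow> (h has_field_derivative f z) (at z)"
    "\<And>z. X0 < Re z \<Longrightarrow> h (z + \<i> * of_real T) = h z"
    "\<And>z. X1 < Re z \<Longrightarrow> \<bar>Re (h z)\<bar> \<le> B" "X0 < X1"
    "\<And>x. X0 < x \<Longrightarrow> ((\<lambda>y. f (Complex x y)) has_integral 0) {-T/2..T/2}"
proof -
  define H where "H = {z. X0 < Re z}"
  have cv: "convex H" unfolding H_def by (rule convex_halfspace_Re_gt)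
  have op: "open H" unfolding H_def by (rule open_halfspace_Re_gt)
  obtain h where h0: "\<And>z. z \<in> H \<Longrightarrow> (h has_field_derivative f z) (at z within H)"
    using holomorphic_convex_primitive'[OF cv op hol[folded H_def]] by blast
  have h: "(h has_field_derivative f z) (at z)" if "X0 < Re z" for z
    using h0[of z] that at_within_open[of z H] op by (simp add: H_def)
  have holh: "h holomorphic_on H"
    using h0 holomorphic_on_def field_differentiable_def by blast
  obtain g where g0: "\<And>z. z \<in> H \<Longrightarrow> (g has_field_derivative h z) (at z within H)"
    using holomorphic_convex_primitive'[OF cv op holh] by blast
  have g: "(g has_field_derivative h z) (at z)" if "X0 < Re z" for z
    using g0[of z] that at_within_open[of z H] op by (simp add: H_def)
  have contf: "continuous_on {y1..y2} (\<lambda>y. f (Complex x y))" if "X0 < x" for x y1 y2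
  proof -
    have "continuous_on H f" using hol holomorphic_on_imp_continuous_on by (simp add: H_def)
    then show ?thesis unfolding Complex_eq
      by (rule continuous_on_compose2) (use that in \<open>auto intro!: continuous_intros simp: H_def\<close>)
  qed
  have intf: "((\<lambda>y. \<i> * f (Complex x y)) has_integral (h (Complex x y2) - h (Complex x y1))) {y1..y2}"
    if "X0 < x" "y1 \<le> y2" for x y1 y2
    by (intro Complex_line_integral h) (use that in auto)
  have inth: "((\<lambda>y. \<i> * h (Complex x y)) has_integral (g (Complex x y2) - g (Complex x y1))) {y1..y2}"
    if "X0 < x" "y1 \<le> y2" for x y1 y2
    by (intro Complex_line_integral g) (use that in auto)
  have shift: "Complex x (T/2) = Complex x (-T/2) + \<i> * of_real T" for x
    by (simp add: complex_eq_iff)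
  define \<Delta> where "\<Delta> = h (Complex (X0 + 1) (-T/2) + \<i> * of_real T) - h (Complex (X0 + 1) (-T/2))"
  have \<Delta>: "h (z + \<i> * of_real T) - h z = \<Delta>" if "X0 < Re z" for z
    unfolding \<Delta>_def using primitive_shift_const[of X0 h f T z "Complex (X0 + 1) (-T/2)"] h per that by auto
  have osc: "cmod (h (Complex x y2) - h (Complex x y1)) \<le> integral {-T/2..T/2} (\<lambda>y. cmod (f (Complex x y)))"
    if "X0 < x" "-T/2 \<le> y1" "y1 \<le> y2" "y2 \<le> T/2" for x y1 y2
  proof -
    have "cmod (h (Complex x y2) - h (Complex x y1)) = cmod (integral {y1..y2} (\<lambda>y. \<i> * f (Complex x y)))"
      by (subst integral_unique[OF intf]) (use that in auto)
    also have "\<dots> \<le> integral {y1..y2} (\<lambda>y. cmod (f (Complex x y)))"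
      using intf[of x y1 y2] that contf[of x y1 y2]
      by (intro integral_norm_bound_integral) (auto simp: norm_mult intro!: integrable_continuous_real continuous_intros)
    also have "\<dots> \<le> integral {-T/2..T/2} (\<lambda>y. cmod (f (Complex x y)))"
      using that contf[of x] by (intro integral_subset_le) (auto intro!: integrable_continuous_real continuous_intros)
    finally show ?thesis .
  qed
  \<comment> \<open>The additive period \<open>\<Delta>\<close> of the primitive is, up to the
    factor \<i>, the integral of \<open>f\<close> over one period of any vertical line, hence as
    small as the integrals in \<open>small\<close>.\<close>
  have "cmod \<Delta> \<le> \<eta>" if \<eta>: "\<eta> > 0" for \<eta>
  proof -
    obtain x where x: "x > X0" "integral {-T/2..T/2} (\<lambda>y. cmod (f (Complex x y))) < \<eta>"
      using small \<eta> by blast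
    have "\<Delta> = h (Complex x (T/2)) - h (Complex x (-T/2))" using \<Delta>[of "Complex x (-T/2)"] x shift by simp
    then show ?thesis using osc[of x "-T/2" "T/2"] x T by simp
  qed
  then have \<Delta>0: "\<Delta> = 0" by (metis norm_le_zero_iff field_le_epsilon add_0)
  have hper: "h (z + \<i> * of_real T) = h z" if "X0 < Re z" for z using \<Delta>[OF that] \<Delta>0 by simp
  have int0: "((\<lambda>y. f (Complex x y)) has_integral 0) {-T/2..T/2}" if "X0 < x" for x
  proof -
    have "h (Complex x (T/2)) - h (Complex x (-T/2)) = 0"
      using \<Delta>[of "Complex x (-T/2)"] that \<Delta>0 shift by simp
    then have "((\<lambda>y. \<i> * f (Complex x y)) has_integral 0) {-T/2..T/2}"
      using intf[of x "-T/2" "T/2"] T that by simp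
    from has_integral_mult_right[OF this, of "-\<i>"] show ?thesis by (simp add: mult.assoc[symmetric])
  qed
  \<comment> \<open>The mean of \<open>h\<close> over a vertical line is the increment of its
    primitive \<open>g\<close> over one period, divided by \<open>\<i> * T\<close>; the increment is
    the same on all lines because \<open>h\<close> is periodic.\<close>
  define J where "J = (g (Complex (X0 + 1) (-T/2) + \<i> * of_real T) - g (Complex (X0 + 1) (-T/2))) / (\<i> * of_real T)"
  have Jint: "((\<lambda>y. \<i> * (h (Complex x y) - J)) has_integral 0) {-T/2..T/2}" if "X0 < x" for x
  proof -
    have "g (Complex x (T/2)) - g (Complex x (-T/2)) = \<i> * of_real T * J"
      unfolding J_def using primitive_shift_const[of X0 g h T "Complex x (-T/2)" "Complex (X0 + 1) (-T/2)"] g hper that shift T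
      by auto
    then have 1: "((\<lambda>y. \<i> * h (Complex x y)) has_integral \<i> * of_real T * J) {-T/2..T/2}"
      using inth[of x "-T/2" "T/2"] T that by simp
    have 2: "((\<lambda>y. \<i> * J) has_integral (T *\<^sub>R (\<i> * J))) {-T/2..T/2}"
      using has_integral_const_real[of "\<i> * J" "-T/2" "T/2"] T by simp
    from has_integral_diff[OF 1 2] show ?thesis by (simp add: algebra_simps scaleR_conv_of_real)
  qed
  have near: "\<bar>Re (h (Complex x y)) - Re J\<bar> \<le> 1"
    if x: "X0 < x" "integral {-T/2..T/2} (\<lambda>y. cmod (f (Complex x y))) < 1" and y: "y \<in> {-T/2..T/2}" for x y
  proof -
    have "((\<lambda>y'. \<i> * (h (Complex x y) - J)) has_integral (T *\<^sub>R (\<i> * (h (Complex x y) - J)))) {-T/2..T/2}"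
      using has_integral_const_real[of "\<i> * (h (Complex x y) - J)" "-T/2" "T/2"] T by simp
    from has_integral_diff[OF this Jint[OF x(1)]]
    have I: "((\<lambda>y'. \<i> * (h (Complex x y) - h (Complex x y'))) has_integral (T *\<^sub>R (\<i> * (h (Complex x y) - J)))) {-T/2..T/2}"
      by (simp add: algebra_simps)
    have "cmod (h (Complex x y) - h (Complex x y')) \<le> 1" if "y' \<in> {-T/2..T/2}" for y'
      using osc[OF x(1), of y y'] osc[OF x(1), of y' y] y that x(2)
      by (cases "y \<le> y'") (auto simp: norm_minus_commute)
    then have "cmod (T *\<^sub>R (\<i> * (h (Complex x y) - J))) \<le> 1 * T"
      using has_integral_bound_real[OF _ finite.emptyI I, of 1] T by (auto simp: norm_mult)
    then have "cmod (h (Complex x y) - J) \<le> 1" using T by (simp add: norm_mult)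
    then show ?thesis by (metis abs_Re_le_cmod minus_complex.simps(1) order_trans)
  qed
  have hgr: "hgrad H (\<lambda>z. Re (h z)) f"
    by (rule hgrad_Re_primitive[OF op hol[folded H_def]]) (simp add: h H_def)
  have hpern: "h (z + of_int n * (\<i> * of_real T)) = h z" if "X0 < Re z" for z and n :: int
    by (rule periodic_int_shift(2)[where P = "\<lambda>z. X0 < Re z"]) (use hper that in auto)
  have red: "\<exists>n::int. \<bar>Im z - of_int n * T\<bar> \<le> T/2" for z
    by (rule shift_into_period[OF T])
  obtain X1 where X1: "X1 > X0" "integral {-T/2..T/2} (\<lambda>y. cmod (f (Complex X1 y))) < 1"
    using small[of 1 X0] by auto
  have bnd: "\<bar>Re (h z)\<bar> \<le> \<bar>Re J\<bar> + 1" if z: "X1 < Re z" for z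
  proof -
    \<comment> \<open>A second good line beyond \<open>z\<close>; the bound obtained between the two
      lines does not depend on its position.\<close>
    obtain X2 where X2: "X2 > Re z" "integral {-T/2..T/2} (\<lambda>y. cmod (f (Complex X2 y))) < 1"
      using small[of 1 "Re z"] by auto
    define S where "S = {w. X1 < Re w \<and> Re w < X2}"
    have oS: "open S" unfolding S_def
      by (intro open_Collect_conj open_halfspace_Re_gt open_halfspace_Re_lt)
    define K where "K = cbox (Complex X1 (-T/2)) (Complex X2 (T/2))"
    have "\<sigma> * Re (h z) \<le> \<bar>Re J\<bar> + 1" if \<sigma>: "\<sigma> = 1 \<or> \<sigma> = - 1" for \<sigma> :: real
    proof (rule weak_max_principle[where S = S and K = K and V = "\<lambda>z. \<sigma> * Re (h z)"])
      show "hgrad S (\<lambda>z. \<sigma> * Re (h z)) (\<lambda>z. of_real \<sigma> * f z)"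
        by (intro hgrad_scale hgrad_subset[OF hgr oS]) (use X1 in \<open>auto simp: S_def H_def\<close>)
      show "compact K" by (simp add: K_def)
      show "z \<in> S" using z X2 by (simp add: S_def)
      show "\<exists>z'\<in>S \<inter> K. \<sigma> * Re (h z') = \<sigma> * Re (h w) \<and> Re z' = Re w" if "w \<in> S" for w
      proof -
        obtain n :: int where n: "\<bar>Im w - of_int n * T\<bar> \<le> T/2" using red by blast
        have n': "- (T/2) \<le> Im w - of_int n * T" "Im w - of_int n * T \<le> T/2" using n by linarith+
        define w' where "w' = w + of_int (-n) * (\<i> * of_real T)"
        have "h w' = h w" using hpern[of w "-n"] that X1 by (auto simp: S_def w'_def)
        moreover have "w' \<in> S \<inter> K" "Re w' = Re w"
          using n' that by (auto simp: w'_def S_def K_def in_cbox_complex_iff)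
        ultimately show ?thesis by (intro bexI[of _ w']) auto
      qed
      fix q \<eta> assume q: "q \<in> K" "q \<notin> S" and \<eta>: "\<eta> > (0::real)"
      have "Re q = X1 \<or> Re q = X2" "Im q \<in> {-T/2..T/2}"
        using q by (auto simp: K_def S_def in_cbox_complex_iff)
      then have "\<bar>Re (h q) - Re J\<bar> \<le> 1" and q0: "X0 < Re q"
        using near[of "Re q" "Im q"] X1 X2 z by auto
      then have "\<sigma> * Re (h q) \<le> \<bar>Re J\<bar> + 1" using \<sigma> by auto
      moreover have "isCont (\<lambda>z. \<sigma> * Re (h z)) q"
        using hgrad_isCont[OF hgr, of q] q0 by (intro continuous_intros) (auto simp: H_def)
      ultimately show "eventually (\<lambda>z. \<sigma> * Re (h z) < \<bar>Re J\<bar> + 1 + \<eta>) (at q within S)"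
        using \<eta> by (intro isCont_eventually_less)
    qed
    from this[of 1] this[of "-1"] show ?thesis by auto
  qed
  show thesis
    by (rule that[of h X1 "\<bar>Re J\<bar> + 1"]) (use h hper bnd X1 int0 in auto)
qed

section \<open>The two columns of disks\<close>

text \<open>The closure of an infinite union can exceed the union of the closures. Here the centres
  form a closed discrete set, so the distance to it is attained: a point farther than 1 from every
  centre has \<open>infdist\<close> greater than 1, and \<open>infdist \<le> 1\<close> is a closed
  condition that holds on all disks.\<close>

lemma ext_dom_iff:
  assumes "\<delta> > 0"
  shows "p \<in> ext_dom \<epsilon> \<delta> \<longleftrightarrow> (\<forall>n. dist (cL \<epsilon> \<delta> n) p > 1 \<and> dist (cR \<epsilon> \<delta> n) p > 1)"
proof
  assume p: "p \<in> ext_dom \<epsilon> \<delta>"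
  show "\<forall>n. dist (cL \<epsilon> \<delta> n) p > 1 \<and> dist (cR \<epsilon> \<delta> n) p > 1"
  proof (rule ccontr)
    assume "\<not> ?thesis"
    then obtain n where "p \<in> cball (cL \<epsilon> \<delta> n) 1 \<or> p \<in> cball (cR \<epsilon> \<delta> n) 1"
      by (auto simp: not_less)
    moreover have "cball (cL \<epsilon> \<delta> n) 1 \<subseteq> closure (disks \<epsilon> \<delta>)" "cball (cR \<epsilon> \<delta> n) 1 \<subseteq> closure (disks \<epsilon> \<delta>)"
      using closure_mono[of "ball (cL \<epsilon> \<delta> n) 1" "disks \<epsilon> \<delta>"] closure_mono[of "ball (cR \<epsilon> \<delta> n) 1" "disks \<epsilon> \<delta>"]
      by (auto simp: disks_def)
    ultimately show False using p by (auto simp: ext_dom_def)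
  qed
next
  assume far: "\<forall>n. dist (cL \<epsilon> \<delta> n) p > 1 \<and> dist (cR \<epsilon> \<delta> n) p > 1"
  have cl: "closed (range (\<lambda>n::int. (x::real, real_of_int n * (2 + \<delta>))))" for x
  proof (rule discrete_imp_closed[of 1])
    have "m = n" if "\<bar>real_of_int n * (2 + \<delta>) - real_of_int m * (2 + \<delta>)\<bar> < 1" for m n
    proof (rule ccontr)
      assume "m \<noteq> n"
      then have "1 \<le> \<bar>real_of_int (n - m)\<bar>" by linarith
      then have "1 * 1 \<le> \<bar>real_of_int (n - m)\<bar> * (2 + \<delta>)" using assms by (intro mult_mono) auto
      also have "\<dots> = \<bar>real_of_int (n - m) * (2 + \<delta>)\<bar>" using assms by (simp add: abs_mult)
      finally show False using that by (simp add: algebra_simps)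
    qed
    then show "\<forall>p\<in>range (\<lambda>n::int. (x::real, real_of_int n * (2 + \<delta>))). \<forall>q\<in>range (\<lambda>n. (x, real_of_int n * (2 + \<delta>))). dist q p < 1 \<longrightarrow> q = p"
      by (auto simp: dist_Pair_Pair dist_real_def)
  qed simp
  define Z where "Z = range (cL \<epsilon> \<delta>) \<union> range (cR \<epsilon> \<delta>)"
  have "closed Z" unfolding Z_def cL_def cR_def using cl by (intro closed_Un) auto
  then obtain y where "y \<in> Z" "infdist p Z = dist p y"
    using infdist_attains_inf[of Z p] by (metis Z_def Un_empty empty_not_UNIV image_is_empty)
  then have "infdist p Z > 1" using far by (auto simp: Z_def dist_commute)
  moreover have "closure (disks \<epsilon> \<delta>) \<subseteq> {p. infdist p Z \<le> 1}"
  proof (rule closure_minimal)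
    show "disks \<epsilon> \<delta> \<subseteq> {p. infdist p Z \<le> 1}"
    proof
      fix x assume "x \<in> disks \<epsilon> \<delta>"
      then obtain y where "y \<in> Z" "dist x y \<le> 1" unfolding disks_def Z_def mem_ball UN_iff Un_iff
        by (metis dist_commute less_imp_le rangeI)
      then show "x \<in> {p. infdist p Z \<le> 1}" using infdist_le[of y Z x] by auto
    qed
    show "closed {p. infdist p Z \<le> 1}" by (intro closed_Collect_le continuous_intros)
  qed
  ultimately show "p \<in> ext_dom \<epsilon> \<delta>" by (auto simp: ext_dom_def)
qed

locale cols =
  fixes \<epsilon> \<delta> :: real
  assumes eps: "0 < \<epsilon>" "\<epsilon> < 1/100" and del: "0 < \<delta>" "\<delta> < 1/100"
begin

definition c :: real where "c = 1 + \<epsilon>/2"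
definition T :: real where "T = 2 + \<delta>"
definition E :: "complex set" where "E = {z. (Re z, Im z) \<in> ext_dom \<epsilon> \<delta>}"
abbreviation iT :: complex where "iT \<equiv> \<i> * of_real T"

lemma c_bounds: "1 < c" "c < 201/200" and T_bounds: "2 < T" "T < 201/100"
  using eps del by (auto simp: c_def T_def)

lemma E_iff: "z \<in> E \<longleftrightarrow> (\<forall>n::int. 1 < cmod (z - Complex c (of_int n * T)) \<and> 1 < cmod (z - Complex (-c) (of_int n * T)))"
proof -
  have "dist (cL \<epsilon> \<delta> n) (Re z, Im z) = cmod (z - Complex (-c) (of_int n * T))"
    "dist (cR \<epsilon> \<delta> n) (Re z, Im z) = cmod (z - Complex c (of_int n * T))" for n
    by (auto simp: cL_def cR_def dist_Pair_Pair cmod_def dist_real_def c_def T_def power2_commute)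
  then show ?thesis using ext_dom_iff[OF del(1)] by (auto simp: E_def)
qed

lemma open_E: "open E"
proof -
  have "open (ext_dom \<epsilon> \<delta>)" by (simp add: ext_dom_def open_Diff)
  moreover have "continuous_on UNIV (\<lambda>z. (Re z, Im z))" by (intro continuous_intros)
  ultimately have "open ((\<lambda>z. (Re z, Im z)) -` ext_dom \<epsilon> \<delta>)"
    using open_vimage by blast
  then show ?thesis by (simp add: E_def vimage_def)
qed

lemma E_shift_iff: "z + iT \<in> E \<longleftrightarrow> z \<in> E"
proof -
  have e: "z + iT - Complex x (of_int n * T) = z - Complex x (of_int (n - 1) * T)" for x n
    by (simp add: complex_eq_iff algebra_simps)
  have "(\<forall>n. P (n - 1)) \<longleftrightarrow> (\<forall>n. P n)" for P :: "int \<Rightarrow> bool"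
    by (metis add_diff_cancel_right')
  from this[of "\<lambda>n. 1 < cmod (z - Complex c (of_int n * T)) \<and> 1 < cmod (z - Complex (-c) (of_int n * T))"]
  show ?thesis unfolding E_iff e by blast
qed

lemma E_shift: "z \<in> E \<Longrightarrow> z + iT \<in> E" "z \<in> E \<Longrightarrow> z - iT \<in> E"
  using E_shift_iff[of z] E_shift_iff[of "z - iT"] by auto

lemma E_shift_int: "z \<in> E \<Longrightarrow> z + of_int n * iT \<in> E"
  by (rule periodic_int_shift(1)[where P = "\<lambda>z. z \<in> E" and h = "\<lambda>_. 0"]) (auto simp: E_shift)

lemma E_reflect: "z \<in> E \<Longrightarrow> - cnj z \<in> E"
proof -
  have "cmod (- cnj z - Complex x y) = cmod (z - Complex (-x) y)" for x y
    by (simp add: cmod_def power2_eq_square algebra_simps)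
  then show "z \<in> E \<Longrightarrow> - cnj z \<in> E" unfolding E_iff by simp
qed

lemma center_far:
  assumes "\<bar>Im z\<bar> \<le> T/2" "n \<noteq> 0"
  shows "T/2 \<le> cmod (z - Complex x (of_int n * T))"
proof -
  have "\<bar>of_int n\<bar> \<ge> (1::real)" using assms(2) by linarith
  then have "T \<le> \<bar>of_int n\<bar> * T" using T_bounds by simp
  also have "\<dots> = \<bar>of_int n * T\<bar>" using T_bounds by (simp add: abs_mult)
  finally have "T/2 \<le> \<bar>Im z - of_int n * T\<bar>" using assms(1) by linarith
  also have "\<dots> \<le> cmod (z - Complex x (of_int n * T))"
    using abs_Im_le_cmod[of "z - Complex x (of_int n * T)"] by simp
  finally show ?thesis .
qed

lemma E_near_iff:
  assumes "\<bar>Im z\<bar> \<le> T/2"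
  shows "z \<in> E \<longleftrightarrow> 1 < cmod (z - of_real c) \<and> 1 < cmod (z + of_real c)"
proof
  have e: "Complex x 0 = of_real x" for x by (simp add: complex_of_real_def)
  show "z \<in> E \<Longrightarrow> 1 < cmod (z - of_real c) \<and> 1 < cmod (z + of_real c)"
    unfolding E_iff using e[of c] e[of "-c"] by (auto dest: spec[of _ 0])
  assume r: "1 < cmod (z - of_real c) \<and> 1 < cmod (z + of_real c)"
  show "z \<in> E" unfolding E_iff
  proof
    fix n :: int
    show "1 < cmod (z - Complex c (of_int n * T)) \<and> 1 < cmod (z - Complex (-c) (of_int n * T))"
      using center_far[OF assms, of n c] center_far[OF assms, of n "-c"] T_bounds r e[of c] e[of "-c"]
      by (cases "n = 0") auto
  qed
qed

lemma E_iff_Re: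
  assumes "\<bar>Re z\<bar> > c + 1"
  shows "z \<in> E"
  unfolding E_iff
proof
  fix n :: int
  show "1 < cmod (z - Complex c (of_int n * T)) \<and> 1 < cmod (z - Complex (-c) (of_int n * T))"
    using assms c_bounds abs_Re_le_cmod[of "z - Complex c (of_int n * T)"]
      abs_Re_le_cmod[of "z - Complex (-c) (of_int n * T)"] by auto
qed

lemma E_near_axis:
  assumes "\<bar>Re z\<bar> < c - 1"
  shows "z \<in> E"
  unfolding E_iff
proof
  fix n :: int
  show "1 < cmod (z - Complex c (of_int n * T)) \<and> 1 < cmod (z - Complex (-c) (of_int n * T))"
    using assms abs_Re_le_cmod[of "z - Complex c (of_int n * T)"]
      abs_Re_le_cmod[of "z - Complex (-c) (of_int n * T)"] by auto
qed

lemma E_imag_axis: "Re z = 0 \<Longrightarrow> z \<in> E"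
  using c_bounds by (intro E_near_axis) simp

text \<open>Off \<open>E\<close>, a point is interior to a disk (and then the filter is trivial) or on its boundary circle.\<close>

lemma eventually_boundary_all:
  assumes "S \<subseteq> E" "q \<notin> E"
    and "\<And>n. cmod (q - Complex c (of_int n * T)) = 1 \<Longrightarrow> eventually P (at q within S)"
    and "\<And>n. cmod (q - Complex (-c) (of_int n * T)) = 1 \<Longrightarrow> eventually P (at q within S)"
  shows "eventually P (at q within S)"
proof -
  have triv: "eventually P (at q within S)" if "cmod (q - Complex x (of_int n * T)) < 1" "x = c \<or> x = - c" for x n
  proof -
    have "q \<in> ball (Complex x (of_int n * T)) 1" using that by (simp add: dist_norm norm_minus_commute)
    moreover have "ball (Complex x (of_int n * T)) 1 \<inter> S = {}"
    proof -
      have "1 < cmod (z - Complex x (of_int n * T))" if "z \<in> S" for z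
        using that assms(1) \<open>x = c \<or> x = - c\<close> unfolding subset_iff E_iff by blast
      then show ?thesis by (force simp: dist_norm norm_minus_commute)
    qed
    ultimately show ?thesis unfolding eventually_at_topological by blast
  qed
  obtain n where "cmod (q - Complex c (of_int n * T)) \<le> 1 \<or> cmod (q - Complex (-c) (of_int n * T)) \<le> 1"
    using assms(2) unfolding E_iff by (meson not_less)
  then show ?thesis using triv[of c n] triv[of "-c" n] assms(3)[of n] assms(4)[of n] by fastforce
qed

lemma eventually_boundary:
  assumes "S \<subseteq> E" "q \<notin> E" "\<bar>Im q\<bar> \<le> T/2"
    and "cmod (q - of_real c) = 1 \<Longrightarrow> eventually P (at q within S)"
    and "cmod (q + of_real c) = 1 \<Longrightarrow> eventually P (at q within S)"
  shows "eventually P (at q within S)"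
proof (rule eventually_boundary_all[OF assms(1,2)])
  fix n :: int
  have n0: "n = 0" if "cmod (q - Complex x (of_int n * T)) = 1" for x
    using center_far[OF assms(3), of n x] that T_bounds by fastforce
  have e: "q - Complex c (of_int 0 * T) = q - of_real c" "q - Complex (-c) (of_int 0 * T) = q + of_real c"
    by (simp_all add: complex_eq_iff)
  show "eventually P (at q within S)" if "cmod (q - Complex c (of_int n * T)) = 1"
    using n0[OF that] that assms(4) e(1) by metis
  show "eventually P (at q within S)" if "cmod (q - Complex (-c) (of_int n * T)) = 1"
    using n0[OF that] that assms(5) e(2) by metis
qed

text \<open>A ball around \<open>z\<close> of radius at most \<open>cmod (z - c) - 1\<close>
  therefore avoids every disk; this is what makes the gradient estimate uniform in the gaps.\<close>

lemma nearest_centre: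
  assumes "0 \<le> Re z" "\<bar>Im z\<bar> \<le> T/2"
  shows "cmod (z - of_real c) \<le> cmod (z - Complex c (of_int n * T))" "cmod (z - of_real c) \<le> cmod (z - Complex (-c) (of_int n * T))"
proof -
  have im: "\<bar>Im z\<bar> \<le> \<bar>Im z - of_int n * T\<bar>"
  proof (cases "n = 0")
    case False
    then have "\<bar>of_int n\<bar> \<ge> (1::real)" by linarith
    then have "T \<le> \<bar>of_int n\<bar> * T" using T_bounds by simp
    also have "\<dots> = \<bar>of_int n * T\<bar>" using T_bounds by (simp add: abs_mult)
    finally show ?thesis using assms(2) by linarith
  qed simp
  then have im2: "(Im z)\<^sup>2 \<le> (Im z - of_int n * T)\<^sup>2" by (simp only: abs_le_square_iff)
  have "\<bar>Re z - c\<bar> \<le> \<bar>Re z + c\<bar>" using assms(1) c_bounds by linarith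
  then have re2: "(Re z - c)\<^sup>2 \<le> (Re z + c)\<^sup>2" by (simp only: abs_le_square_iff)
  show "cmod (z - of_real c) \<le> cmod (z - Complex c (of_int n * T))" "cmod (z - of_real c) \<le> cmod (z - Complex (-c) (of_int n * T))"
    using im2 re2 by (simp_all add: cmod_def)
qed

lemma reduce_period:
  obtains n :: int where "\<bar>Im (z + of_int n * iT)\<bar> \<le> T/2"
proof -
  obtain m :: int where "\<bar>Im z - of_int m * T\<bar> \<le> T/2"
    using shift_into_period[of T "Im z"] T_bounds by auto
  then show thesis by (intro that[of "- m"]) simp
qed

text \<open>Every point of \<open>E\<close> is joined inside \<open>E\<close> to the imaginary axis by a vertical segment
  to a line halfway between two rows of disks, followed by a horizontal one.\<close>

lemma E_zero_derivative_const:
  fixes D :: "complex \<Rightarrow> real"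
  assumes "\<And>z. z \<in> E \<Longrightarrow> (D has_derivative (\<lambda>h. 0)) (at z)" and z: "z \<in> E"
  shows "D z = D 0"
proof -
  have seg: "D x = D y" if "closed_segment x y \<subseteq> E" for x y
  proof -
    have "\<exists>k. \<forall>w\<in>closed_segment x y. D w = k"
      by (intro has_derivative_zero_constant) (use assms(1) that in \<open>auto intro: has_derivative_at_withinI\<close>)
    then show ?thesis by (metis ends_in_segment)
  qed
  obtain n :: int where n: "\<bar>Im (z + of_int n * iT)\<bar> \<le> T/2" using reduce_period .
  define w where "w = z + of_int n * iT"
  \<comment> \<open>Moving vertically away from row 0 increases the distance to both of its centres;
    the motion stops halfway to the next row.\<close>
  define \<sigma> :: real where "\<sigma> = (if Im w \<ge> 0 then 1 else -1)"
  have wE: "w \<in> E" using E_shift_int z by (simp add: w_def)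
  define w1 where "w1 = Complex (Re w) (\<sigma> * T/2)"
  define w2 where "w2 = Complex 0 (\<sigma> * T/2)"
  have s1: "closed_segment w w1 \<subseteq> E"
  proof
    fix p assume "p \<in> closed_segment w w1"
    then obtain t where t: "0 \<le> t" "t \<le> 1" "p = (1 - t) *\<^sub>R w + t *\<^sub>R w1" by (auto simp: closed_segment_def)
    have Rp: "Re p = Re w" unfolding t(3) by (simp add: w1_def algebra_simps)
    have Ip: "Im p = \<sigma> * ((1 - t) * \<bar>Im w\<bar> + t * (T/2))" unfolding t(3) by (simp add: w1_def \<sigma>_def algebra_simps)
    have "\<bar>Im w\<bar> \<le> T/2" using n by (simp add: w_def)
    have c1: "(1 - t) * \<bar>Im w\<bar> + t * (T/2) \<le> T/2" and c2: "\<bar>Im w\<bar> \<le> (1 - t) * \<bar>Im w\<bar> + t * (T/2)"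
      using convex_bound_le[OF \<open>\<bar>Im w\<bar> \<le> T/2\<close> order_refl, of "1 - t" t] t
        mult_left_mono[OF \<open>\<bar>Im w\<bar> \<le> T/2\<close> t(1)] by (auto simp: algebra_simps)
    have ap: "\<bar>Im p\<bar> = (1 - t) * \<bar>Im w\<bar> + t * (T/2)" unfolding Ip using c2
      by (simp add: abs_mult \<sigma>_def)
    then have ip2: "(Im w)\<^sup>2 \<le> (Im p)\<^sup>2" using c2 by (metis abs_le_square_iff)
    have "cmod (w - of_real x) \<le> cmod (p - of_real x)" for x
      using ip2 Rp by (simp add: cmod_def)
    from this[of c] this[of "-c"] show "p \<in> E"
      using wE E_near_iff[of w] E_near_iff[of p] ap c1 n by (auto simp: w_def[symmetric])
  qed
  have s2: "closed_segment w1 w2 \<subseteq> E"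
  proof
    fix p assume "p \<in> closed_segment w1 w2"
    then obtain t where t: "p = (1 - t) *\<^sub>R w1 + t *\<^sub>R w2" by (auto simp: closed_segment_def)
    then have ip: "\<bar>Im p\<bar> = T/2" unfolding t using T_bounds by (auto simp: w1_def w2_def \<sigma>_def algebra_simps)
    then have "1 < cmod (p - of_real x)" for x
      using abs_Im_le_cmod[of "p - of_real x"] T_bounds by simp
    from this[of c] this[of "-c"] show "p \<in> E" using E_near_iff[of p] ip by auto
  qed
  \<comment> \<open>\<open>D\<close> is not assumed periodic, so the path found near row 0 is
    translated back to start at \<open>z\<close>; its end is still on the imaginary axis.\<close>
  define w' where "w' = w1 - of_int n * iT"
  have s1': "closed_segment z w' \<subseteq> E"
  proof
    fix p assume "p \<in> closed_segment z w'"
    then obtain t where t: "0 \<le> t" "t \<le> 1" "p = (1 - t) *\<^sub>R z + t *\<^sub>R w'" by (auto simp: closed_segment_def)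
    then have "p + of_int n * iT \<in> closed_segment w w1"
      unfolding closed_segment_def w'_def w_def
      by (auto intro!: exI[of _ t] simp: algebra_simps scaleR_conv_of_real)
    then have "p + of_int n * iT \<in> E" using s1 by auto
    then have "p + of_int n * iT + of_int (-n) * iT \<in> E" by (rule E_shift_int)
    then show "p \<in> E" by simp
  qed
  have s2': "closed_segment w' (w2 - of_int n * iT) \<subseteq> E"
  proof
    fix p assume "p \<in> closed_segment w' (w2 - of_int n * iT)"
    then obtain t where t: "0 \<le> t" "t \<le> 1" "p = (1 - t) *\<^sub>R w' + t *\<^sub>R (w2 - of_int n * iT)" by (auto simp: closed_segment_def)
    then have "p + of_int n * iT \<in> closed_segment w1 w2"
      unfolding closed_segment_def w'_def
      by (auto intro!: exI[of _ t] simp: algebra_simps scaleR_conv_of_real)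
    then have "p + of_int n * iT \<in> E" using s2 by auto
    then have "p + of_int n * iT + of_int (-n) * iT \<in> E" by (rule E_shift_int)
    then show "p \<in> E" by simp
  qed
  have s3': "closed_segment (w2 - of_int n * iT) 0 \<subseteq> E"
    by (auto simp: closed_segment_def w2_def intro!: E_imag_axis)
  show "D z = D 0" using seg[OF s1'] seg[OF s2'] seg[OF s3'] by simp
qed

end

section \<open>Elementary bounds for the complex hyperbolic sine\<close>

lemma Re_sinh: "Re (sinh w) = sinh (Re w) * cos (Im w)"
  and Im_sinh: "Im (sinh w) = cosh (Re w) * sin (Im w)"
  and Re_cosh: "Re (cosh w) = cosh (Re w) * cos (Im w)"
  and Im_cosh: "Im (cosh w) = sinh (Re w) * sin (Im w)"
  by (simp_all add: sinh_field_def cosh_field_def Re_exp Im_exp field_simps)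

lemma cmod_sinh_sq: "(cmod (sinh w))\<^sup>2 = (sinh (Re w))\<^sup>2 + (sin (Im w))\<^sup>2"
proof -
  have "(cmod (sinh w))\<^sup>2 = (sinh (Re w))\<^sup>2 * (cos (Im w))\<^sup>2 + (cosh (Re w))\<^sup>2 * (sin (Im w))\<^sup>2"
    by (simp add: cmod_power2 Re_sinh Im_sinh power_mult_distrib)
  also have "\<dots> = (sinh (Re w))\<^sup>2 + (sin (Im w))\<^sup>2"
    unfolding cosh_square_eq cos_squared_eq by (simp add: algebra_simps)
  finally show ?thesis .
qed

lemma sinh_ge_self: "x \<ge> 0 \<Longrightarrow> x \<le> sinh (x::real)"
proof -
  assume "x \<ge> 0"
  have "sinh 0 - 0 \<le> sinh x - x"
    by (rule DERIV_nonneg_imp_nondecreasing[OF \<open>x \<ge> 0\<close>, of "\<lambda>x. sinh x - x"])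
      (auto intro!: exI derivative_eq_intros simp: cosh_real_ge_1)
  then show ?thesis by simp
qed

lemma sinh_le_mult_cosh: "x \<ge> 0 \<Longrightarrow> sinh x \<le> x * cosh (x::real)"
proof -
  assume "x \<ge> 0"
  have "0 * cosh 0 - sinh 0 \<le> x * cosh x - sinh x"
    by (rule DERIV_nonneg_imp_nondecreasing[OF \<open>x \<ge> 0\<close>, of "\<lambda>x. x * cosh x - sinh x"])
      (auto intro!: exI derivative_eq_intros mult_nonneg_nonneg simp: sinh_real_nonneg_iff)
  then show ?thesis by simp
qed

lemma abs_sinh_ge: "\<bar>x\<bar> \<le> \<bar>sinh (x::real)\<bar>"
  using sinh_ge_self[of x] sinh_ge_self[of "-x"] by (cases "x \<ge> 0") auto

text \<open>Split at \<open>pi/3\<close>, where the cosine equals 1/2: up to there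
  \<open>sin y - y/2\<close> increases, and beyond it \<open>sin y\<close> is at least
  \<open>sqrt 3 / 2\<close>, which exceeds \<open>pi/4\<close>.\<close>

lemma sin_ge_half: "0 \<le> y \<Longrightarrow> y \<le> pi/2 \<Longrightarrow> y/2 \<le> sin y"
proof (cases "y \<le> pi/3")
  case True
  assume y: "0 \<le> y"
  have "sin 0 - 0/2 \<le> sin y - y/2"
  proof (rule DERIV_nonneg_imp_nondecreasing[OF y, of "\<lambda>x. sin x - x/2"])
    fix x assume "0 \<le> x" "x \<le> y"
    then have "cos x \<ge> cos (pi/3)" using True pi_gt3 by (subst cos_mono_le_eq) auto
    then have "cos x - 1/2 \<ge> 0" by (simp add: cos_60)
    then show "\<exists>d. ((\<lambda>x. sin x - x/2) has_real_derivative d) (at x) \<and> 0 \<le> d"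
      by (intro exI[of _ "cos x - 1/2"]) (auto intro!: derivative_eq_intros)
  qed
  then show ?thesis by simp
next
  case False
  assume y: "0 \<le> y" "y \<le> pi/2"
  have "sin y \<ge> sin (pi/3)" using False y pi_gt3 by (subst sin_mono_le_eq) auto
  then have "sin y \<ge> sqrt 3 / 2" by (simp add: sin_60)
  moreover have "sqrt 3 \<ge> 1.7" by (rule real_le_rsqrt) (simp add: power2_eq_square)
  ultimately show ?thesis using y pi_less_4 pi_approx by simp
qed

lemma sin_sq_ge: "\<bar>y\<bar> \<le> pi/2 \<Longrightarrow> y\<^sup>2 / 4 \<le> (sin y)\<^sup>2"
proof -
  assume "\<bar>y\<bar> \<le> pi/2"
  then have "\<bar>y\<bar>/2 \<le> sin \<bar>y\<bar>" by (intro sin_ge_half) auto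
  then have "(\<bar>y\<bar>/2)\<^sup>2 \<le> (sin \<bar>y\<bar>)\<^sup>2" by (intro power_mono) auto
  then show ?thesis by (cases "y \<ge> 0") (auto simp: power_divide)
qed

lemma sin_sq_le: "(sin y)\<^sup>2 \<le> (y::real)\<^sup>2"
  using abs_sin_x_le_abs_x abs_le_square_iff by blast

lemma cmod_sinh_ge:
  assumes "\<bar>Im w\<bar> \<le> pi/2"
  shows "cmod w / 2 \<le> cmod (sinh w)"
proof -
  have "(cmod w / 2)\<^sup>2 = (Re w)\<^sup>2/4 + (Im w)\<^sup>2/4" by (simp add: cmod_power2 power_divide add_divide_distrib)
  also have "\<dots> \<le> (sinh (Re w))\<^sup>2 + (sin (Im w))\<^sup>2"
    using sin_sq_ge[OF assms] abs_sinh_ge[of "Re w"] abs_le_square_iff[of "Re w" "sinh (Re w)"]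
      zero_le_power2[of "Re w"] by linarith
  also have "\<dots> = (cmod (sinh w))\<^sup>2" by (simp add: cmod_sinh_sq)
  finally show ?thesis by (rule power2_le_imp_le) simp
qed

lemma cmod_sinh_ge_Re: "\<bar>Re w\<bar> \<le> cmod (sinh w)"
proof -
  have "(Re w)\<^sup>2 \<le> (cmod (sinh w))\<^sup>2"
    using abs_sinh_ge[of "Re w"] abs_le_square_iff[of "Re w" "sinh (Re w)"] by (simp add: cmod_sinh_sq add_increasing2)
  then show ?thesis by (metis abs_le_square_iff abs_norm_cancel)
qed

lemma sinh_add_i_pi: "sinh (w + \<i> * of_real pi) = - sinh w"
  by (simp add: complex_eq_iff Re_sinh Im_sinh)

section \<open>Periodic logarithmic potentials and the maximum principle on unbounded sets\<close>

context cols
begin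

definition s :: real where "s = pi / T"

lemma s_pos: "s > 0" using T_bounds by (simp add: s_def)
lemma sT: "s * T = pi" using T_bounds by (simp add: s_def)

text \<open>Since \<open>s * T = pi\<close>, the function inside vanishes exactly at the points
  \<open>x + \<i> * n * T\<close>: this is the periodic logarithmic potential with one pole per
  period on the line \<open>Re z = x\<close>.\<close>

definition lsinh :: "real \<Rightarrow> complex \<Rightarrow> real" where
  "lsinh x z = ln (cmod (sinh (of_real s * (z - of_real x))))"

lemma cmod_sinh_shift: "cmod (sinh (of_real s * (z + iT - of_real x))) = cmod (sinh (of_real s * (z - of_real x)))"
proof -
  have "of_real s * (z + iT - of_real x) = of_real s * (z - of_real x) + \<i> * of_real pi"
    by (simp add: algebra_simps flip: sT)
  then show ?thesis by (simp add: sinh_add_i_pi)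
qed

lemma lsinh_shift: "lsinh x (z + iT) = lsinh x z"
  by (simp add: lsinh_def cmod_sinh_shift)

lemma lsinh_arg: "Re (of_real s * (z - of_real x)) = s * (Re z - x)" "Im (of_real s * (z - of_real x)) = s * Im z"
  by (auto simp: algebra_simps)

lemma cmod_sinh_lower:
  assumes "\<bar>Im z\<bar> \<le> T/2"
  shows "s * cmod (z - of_real x) / 2 \<le> cmod (sinh (of_real s * (z - of_real x)))"
proof -
  have "\<bar>s * Im z\<bar> \<le> pi/2"
    using mult_left_mono[OF assms, of s] s_pos sT by (simp add: abs_mult)
  then have "cmod (of_real s * (z - of_real x)) / 2 \<le> cmod (sinh (of_real s * (z - of_real x)))"
    by (intro cmod_sinh_ge) (simp add: lsinh_arg)
  then show ?thesis using s_pos by (simp only: norm_mult norm_of_real abs_of_pos)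
qed

lemma cmod_sinh_lower_Re: "s * \<bar>Re z - x\<bar> \<le> cmod (sinh (of_real s * (z - of_real x)))"
  using cmod_sinh_ge_Re[of "of_real s * (z - of_real x)"] s_pos by (simp only: lsinh_arg abs_mult abs_of_pos)

text \<open>The pole at \<open>x\<close> and its translates lie in the open disks of one column, and
  after reduction to one period \<open>cmod_sinh_lower\<close> excludes any other zero.\<close>

lemma sinh_nonzero_on:
  assumes "z \<in> E" "\<bar>x - c\<bar> < 1 \<or> \<bar>x + c\<bar> < 1"
  shows "sinh (of_real s * (z - of_real x)) \<noteq> 0"
proof -
  obtain n :: int where n: "\<bar>Im (z + of_int n * iT)\<bar> \<le> T/2" using reduce_period .
  define w where "w = z + of_int n * iT"
  have wE: "w \<in> E" using E_shift_int assms by (simp add: w_def)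
  then have w1: "1 < cmod (w - of_real c)" "1 < cmod (w + of_real c)" using E_near_iff[of w] n by (auto simp: w_def)
  have "w \<noteq> of_real x"
  proof
    assume "w = of_real x"
    then have "cmod (w - of_real c) = \<bar>x - c\<bar>" "cmod (w + of_real c) = \<bar>x + c\<bar>"
      by (metis norm_of_real of_real_diff, metis norm_of_real of_real_add)
    then show False using w1 assms(2) by auto
  qed
  then have "0 < s * cmod (w - of_real x) / 2" using s_pos by simp
  also have "\<dots> \<le> cmod (sinh (of_real s * (w - of_real x)))" using cmod_sinh_lower[of w x] n by (simp add: w_def)
  also have "\<dots> = cmod (sinh (of_real s * (z - of_real x)))"
    unfolding w_def by (rule periodic_int_shift(2)[where P = "\<lambda>_. True"]) (auto simp: cmod_sinh_shift)
  finally show ?thesis by auto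
qed

definition dlsinh :: "real \<Rightarrow> complex \<Rightarrow> complex" where
  "dlsinh x z = (cosh (of_real s * (z - of_real x)) * of_real s) / sinh (of_real s * (z - of_real x))"

lemma hgrad_lsinh:
  assumes "\<bar>x - c\<bar> < 1 \<or> \<bar>x + c\<bar> < 1"
  shows "hgrad E (lsinh x) (dlsinh x)"
  unfolding lsinh_def[abs_def] dlsinh_def[abs_def]
  by (rule hgrad_ln_cmod[OF open_E])
    (use sinh_nonzero_on[OF _ assms] in \<open>auto intro!: derivative_eq_intros\<close>)

lemma lsinh_c_lower:
  assumes "z \<in> E"
  shows "ln (s/2) \<le> lsinh c z"
proof -
  obtain n :: int where n: "\<bar>Im (z + of_int n * iT)\<bar> \<le> T/2" using reduce_period .
  define w where "w = z + of_int n * iT"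
  have wE: "w \<in> E" using E_shift_int assms by (simp add: w_def)
  then have w1: "1 < cmod (w - of_real c)" using E_near_iff[of w] n by (auto simp: w_def)
  have "s / 2 \<le> s * cmod (w - of_real c) / 2" using s_pos w1 by simp
  also have "\<dots> \<le> cmod (sinh (of_real s * (w - of_real c)))" using cmod_sinh_lower[of w c] n by (simp add: w_def)
  finally have "ln (s/2) \<le> lsinh c w" unfolding lsinh_def using s_pos by (subst ln_le_cancel_iff) auto
  also have "\<dots> = lsinh c z" unfolding w_def
    by (rule periodic_int_shift(2)[where P = "\<lambda>_. True"]) (auto simp: lsinh_shift)
  finally show ?thesis .
qed

lemma lsinh_c_far:
  assumes "X > c" "X \<le> \<bar>Re z\<bar>"
  shows "ln (s * (X - c)) \<le> lsinh c z"
proof -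
  have "X - c \<le> \<bar>Re z - c\<bar>" using assms c_bounds by linarith
  then have "s * (X - c) \<le> s * \<bar>Re z - c\<bar>" using s_pos by simp
  also have "\<dots> \<le> cmod (sinh (of_real s * (z - of_real c)))" by (rule cmod_sinh_lower_Re)
  finally have "s * (X - c) \<le> cmod (sinh (of_real s * (z - of_real c)))" .
  moreover have "0 < s * (X - c)" using s_pos assms by simp
  ultimately show ?thesis unfolding lsinh_def by (subst ln_le_cancel_iff) auto
qed

text \<open>The barrier \<open>lsinh c\<close> is bounded below on \<open>E\<close> and grows as \<open>\<bar>Re z\<bar> \<rightarrow> \<infinity>\<close>.\<close>

lemma periodic_max_principle:
  assumes hg: "hgrad S V f" and SE: "S \<subseteq> E"
    and shift: "\<And>z. z \<in> S \<Longrightarrow> z + iT \<in> S" "\<And>z. z \<in> S \<Longrightarrow> z - iT \<in> S" "\<And>z. z \<in> S \<Longrightarrow> V (z + iT) = V z"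
    and far: "\<And>z. z \<in> S \<Longrightarrow> X0 \<le> \<bar>Re z\<bar> \<Longrightarrow> V z \<le> K0"
    and bd: "\<And>q \<eta>. \<bar>Im q\<bar> \<le> T/2 \<Longrightarrow> q \<notin> S \<Longrightarrow> 0 < \<eta> \<Longrightarrow> eventually (\<lambda>z. V z < M + \<eta>) (at q within S)"
    and z0: "z0 \<in> S"
  shows "V z0 \<le> M"
proof -
  have main: "V z0 - \<eta> * (lsinh c z0 - ln (s/2)) \<le> M" if \<eta>: "\<eta> > 0" for \<eta>
  proof -
    \<comment> \<open>The lower bound of \<open>lsinh\<close> far away is only logarithmic, which
      explains the exponential: for \<open>\<bar>Re z\<bar> \<ge> X\<close> the barrier times
      \<open>\<eta>\<close> is at least \<open>\<bar>K0 - M\<bar>\<close>. The other summands put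
      \<open>X0\<close> and \<open>z0\<close> inside.\<close>
    define X where "X = c + exp (\<bar>K0 - M\<bar> / \<eta>) + \<bar>X0\<bar> + \<bar>Re z0\<bar> + 1"
    have Xe: "exp (\<bar>K0 - M\<bar> / \<eta>) \<le> X - c" by (simp add: X_def)
    have Xc: "X > c" using Xe exp_gt_zero[of "\<bar>K0 - M\<bar> / \<eta>"] by linarith
    have XX: "X > X0" "X > \<bar>Re z0\<bar>" using exp_gt_zero[of "\<bar>K0 - M\<bar> / \<eta>"] c_bounds unfolding X_def by linarith+
    have Bfar: "K0 - \<eta> * (lsinh c z - ln (s/2)) \<le> M" if "X \<le> \<bar>Re z\<bar>" for z
    proof -
      have "ln (s * (X - c)) = ln s + ln (X - c)" using s_pos Xc by (simp add: ln_mult)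
      moreover have "ln (X - c) \<ge> \<bar>K0 - M\<bar> / \<eta>" using Xe Xc by (subst ln_ge_iff) auto
      moreover have "ln (s/2) \<le> ln s" using s_pos by simp
      ultimately have "\<bar>K0 - M\<bar> / \<eta> \<le> lsinh c z - ln (s/2)" using lsinh_c_far[OF Xc that] by linarith
      then have "\<bar>K0 - M\<bar> \<le> \<eta> * (lsinh c z - ln (s/2))" using \<eta> by (simp add: field_simps)
      then show ?thesis by linarith
    qed
    define S' where "S' = S \<inter> {z. \<bar>Re z\<bar> < X}"
    have oS': "open S'" unfolding S'_def
      by (intro open_Int hgradD(1)[OF hg] open_Collect_less continuous_intros)
    define V' where "V' z = V z - \<eta> * (lsinh c z - ln (s/2))" for z
    have hgS: "hgrad S V' (\<lambda>z. f z - of_real \<eta> * (dlsinh c z - 0))"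
      unfolding V'_def using hgradD(1)[OF hg]
      by (intro hgrad_diff hgrad_scale hg hgrad_const hgrad_subset[OF hgrad_lsinh _ SE]) auto
    have "V' z0 \<le> M"
    proof (rule weak_max_principle[where S = S' and V = V' and K = "cbox (Complex (-X) (-T/2)) (Complex X (T/2))"])
      show "hgrad S' V' (\<lambda>z. f z - of_real \<eta> * (dlsinh c z - 0))"
        by (rule hgrad_subset[OF hgS oS']) (auto simp: S'_def)
      show "compact (cbox (Complex (-X) (-T/2)) (Complex X (T/2)))" by simp
      show "z0 \<in> S'" using z0 XX by (simp add: S'_def)
      show "\<exists>z'\<in>S' \<inter> cbox (Complex (-X) (-T/2)) (Complex X (T/2)). V' z' = V' w \<and> Re z' = Re w" if w: "w \<in> S'" for w
      proof -
        obtain n :: int where n: "\<bar>Im (w + of_int n * iT)\<bar> \<le> T/2" using reduce_period .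
        define w' where "w' = w + of_int n * iT"
        have "w \<in> S" using w by (simp add: S'_def)
        have "w' \<in> S" "V' w' = V' w" unfolding w'_def
          by (rule periodic_int_shift[where P = "\<lambda>z. z \<in> S" and h = V'];
              use shift \<open>w \<in> S\<close> in \<open>auto simp: V'_def lsinh_shift\<close>)+
        moreover have "Re w' = Re w" by (simp add: w'_def)
        moreover have "- (T/2) \<le> Im w'" "Im w' \<le> T/2" using n by (auto simp: w'_def[symmetric] abs_le_iff)
        ultimately show ?thesis using w by (intro bexI[of _ w']) (auto simp: S'_def in_cbox_complex_iff)
      qed
      fix q \<eta>' assume q: "q \<in> cbox (Complex (-X) (-T/2)) (Complex X (T/2))" "q \<notin> S'" and \<eta>': "\<eta>' > (0::real)"
      have Imq: "\<bar>Im q\<bar> \<le> T/2" and Req: "\<bar>Re q\<bar> \<le> X" using q by (auto simp: in_cbox_complex_iff)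
      show "eventually (\<lambda>z. V' z < M + \<eta>') (at q within S')"
      proof (cases "q \<in> S")
        case True
        then have "\<bar>Re q\<bar> = X" using q(2) Req by (auto simp: S'_def)
        then have "V' q \<le> M" using far[OF True] Bfar[of q] XX by (auto simp: V'_def)
        then show ?thesis using hgrad_isCont[OF hgS True] \<eta>' by (intro isCont_eventually_less)
      next
        case False
        have "eventually (\<lambda>z. V z < M + \<eta>') (at q within S')"
          by (rule filter_leD[OF at_le bd[OF Imq False \<eta>']]) (auto simp: S'_def)
        moreover have "eventually (\<lambda>z. z \<in> S') (at q within S')"
          by (simp add: eventually_at_topological) blast
        ultimately show ?thesis
        proof eventually_elim
          case (elim z)
          then have "\<eta> * (lsinh c z - ln (s/2)) \<ge> 0" using lsinh_c_lower[of z] SE \<eta>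
            by (intro mult_nonneg_nonneg) (auto simp: S'_def)
          then show ?case using elim by (simp add: V'_def)
        qed
      qed
    qed
    then show ?thesis by (simp add: V'_def)
  qed
  define A where "A = lsinh c z0 - ln (s/2)"
  have A: "A \<ge> 0" using lsinh_c_lower[of z0] z0 SE by (auto simp: A_def)
  show ?thesis
  proof (rule field_le_epsilon)
    fix e :: real assume "e > 0"
    have "V z0 - e / (A + 1) * A \<le> M" using main[of "e / (A + 1)"] A \<open>e > 0\<close> by (simp add: A_def)
    moreover have "e / (A + 1) * A \<le> e" using A \<open>e > 0\<close> by (simp add: field_simps)
    ultimately show "V z0 \<le> M + e" by linarith
  qed
qed

end

text \<open>The filter \<open>at q\<close> omits \<open>q\<close> itself, so \<open>g\<close> must
  send no other point to \<open>g q\<close>.\<close>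

lemma tendsto_at_within_compose_iso:
  assumes lim: "(u \<longlongrightarrow> l) (at (g q) within B)"
    and g: "isCont g q" "\<And>z. z \<in> A \<Longrightarrow> g z \<in> B" "\<And>z. g z = g q \<Longrightarrow> z = q"
  shows "((\<lambda>z. u (g z)) \<longlongrightarrow> l) (at q within A)"
proof -
  have "(g \<longlongrightarrow> g q) (at q within A)"
    using g(1) continuous_at_imp_continuous_at_within continuous_within by blast
  then have "filterlim g (at (g q) within B) (at q within A)"
    unfolding filterlim_at using g(2,3) by (auto simp: eventually_at_filter intro!: always_eventually)
  then show ?thesis using lim by (rule filterlim_compose[rotated])
qed

text \<open>The complex form of a solution. \<open>lineR\<close> and \<open>lineL\<close> keep from the finite energy only that \<open>\<nabla>(u - H)\<close>
  is small on some vertical lines tending to \<open>\<plusminus>\<infinity>\<close>; \<open>flux0\<close> is what the zero flux through \<open>\<partial>D\<^sub>R\<^sub>0\<close> amounts to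
  on the axis between the two columns. In this form the class is invariant under \<open>z \<mapsto> - cnj z\<close>.\<close>

locale sol = cols +
  fixes a b kL kR :: real and u :: "complex \<Rightarrow> real" and f :: "complex \<Rightarrow> complex"
  assumes hg: "hgrad E u f"
    and fper: "\<And>z. z \<in> E \<Longrightarrow> f (z + iT) = f z"
    and limR: "\<And>q. cmod (q - of_real c) = 1 \<Longrightarrow> (u \<longlongrightarrow> kR) (at q within E)"
    and limL: "\<And>q. cmod (q + of_real c) = 1 \<Longrightarrow> (u \<longlongrightarrow> kL) (at q within E)"
    and lineR: "\<And>\<eta> X. 0 < \<eta> \<Longrightarrow> \<exists>x>X. integral {-T/2..T/2} (\<lambda>y. cmod (f (Complex x y) - Complex a (-b))) < \<eta>"
    and lineL: "\<And>\<eta> X. 0 < \<eta> \<Longrightarrow> \<exists>x>X. integral {-T/2..T/2} (\<lambda>y. cmod (f (Complex (-x) y) - Complex a (-b))) < \<eta>"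
    and flux0: "((\<lambda>y. Re (f (Complex 0 y))) has_integral a * T) {-T/2..T/2}"
begin

text \<open>The sign of \<open>a\<close> changes and the boundary constants are exchanged.
  Statements proved for the right half-plane, or for \<open>a \<ge> 0\<close>, thus carry over to
  the left one and to \<open>a \<le> 0\<close>.\<close>

lemma reflect: "sol \<epsilon> \<delta> (-a) b kR kL (\<lambda>z. u (- cnj z)) (\<lambda>z. - cnj (f (- cnj z)))"
proof
  have mE: "z \<in> E \<Longrightarrow> - cnj z \<in> E" for z by (rule E_reflect)
  show "hgrad E (\<lambda>z. u (- cnj z)) (\<lambda>z. - cnj (f (- cnj z)))"
    unfolding hgrad_def
  proof (intro conjI ballI open_E)
    have "f holomorphic_on uminus ` cnj ` E"
      by (rule holomorphic_on_subset[OF hgradD(2)[OF hg]]) (use mE in auto)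
    then have "(f \<circ> uminus) holomorphic_on cnj ` E"
      by (intro holomorphic_on_compose holomorphic_intros)
    from holomorphic_on_compose_cnj_cnj[OF this open_E]
    show "(\<lambda>z. - cnj (f (- cnj z))) holomorphic_on E"
      using holomorphic_on_minus[of "\<lambda>z. cnj (f (- cnj z))" E] by (simp add: o_def)
    fix z assume z: "z \<in> E"
    have 1: "((\<lambda>z. - cnj z) has_derivative (\<lambda>h. - cnj h)) (at z)"
      by (auto intro!: derivative_eq_intros)
    have 2: "((\<lambda>z. u (- cnj z)) has_derivative (\<lambda>h. Re (f (- cnj z) * (- cnj h)))) (at z)"
      by (rule has_derivative_compose[OF 1 hgradD(3)[OF hg mE[OF z]]])
    show "((\<lambda>z. u (- cnj z)) has_derivative (\<lambda>h. Re (- cnj (f (- cnj z)) * h))) (at z)"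
      by (rule has_derivative_eq_rhs[OF 2]) (auto simp: fun_eq_iff)
  qed
  show "- cnj (f (- cnj (z + iT))) = - cnj (f (- cnj z))" if "z \<in> E" for z
    using fper[OF mE[OF that]] by simp
  have nq: "cmod (- cnj q + of_real x) = cmod (q - of_real x)" for q and x :: real
    by (simp add: cmod_def power2_eq_square algebra_simps)
  show "((\<lambda>z. u (- cnj z)) \<longlongrightarrow> kL) (at q within E)" if "cmod (q - of_real c) = 1" for q
    by (rule tendsto_at_within_compose_iso[where B = E])
      (use limL[of "- cnj q"] that nq[of q c] mE in \<open>auto intro!: continuous_intros simp: complex_cnj_cancel_iff\<close>)
  show "((\<lambda>z. u (- cnj z)) \<longlongrightarrow> kR) (at q within E)" if "cmod (q + of_real c) = 1" for q
    by (rule tendsto_at_within_compose_iso[where B = E])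
      (use limR[of "- cnj q"] that nq[of q "-c"] mE in \<open>auto intro!: continuous_intros simp: complex_cnj_cancel_iff\<close>)
  have ln: "cmod (- cnj (f (- cnj (Complex x y))) - Complex (-a) (-b)) = cmod (f (Complex (-x) y) - Complex a (-b))" for x y
  proof -
    have e: "- cnj (Complex x y) = Complex (-x) y" by (simp add: complex_eq_iff)
    have "- cnj (f (Complex (-x) y)) - Complex (-a) (-b) = - cnj (f (Complex (-x) y) - Complex a (-b))"
      by (simp add: complex_eq_iff)
    then show ?thesis unfolding e by (metis complex_mod_cnj norm_minus_cancel)
  qed
  show "\<exists>x>X. integral {-T/2..T/2} (\<lambda>y. cmod (- cnj (f (- cnj (Complex x y))) - Complex (-a) (-b))) < \<eta>" if "0 < \<eta>" for \<eta> X
    unfolding ln by (rule lineL[OF that])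
  show "\<exists>x>X. integral {-T/2..T/2} (\<lambda>y. cmod (- cnj (f (- cnj (Complex (-x) y))) - Complex (-a) (-b))) < \<eta>" if "0 < \<eta>" for \<eta> X
    unfolding ln using lineR[OF that] by simp
  have "- cnj (Complex 0 y) = Complex 0 y" for y by (simp add: complex_eq_iff)
  then show "((\<lambda>y. Re (- cnj (f (- cnj (Complex 0 y))))) has_integral - a * T) {-T/2..T/2}"
    using has_integral_neg[OF flux0] by simp
qed

definition v :: "complex \<Rightarrow> real" where "v z = u z - a * Re z - b * Im z"

lemma hgrad_v: "hgrad E v (\<lambda>z. f z - Complex a (-b))"
proof -
  have "hgrad E (\<lambda>z. u z - a * Re z - b * Im z) (\<lambda>z. f z - of_real a * 1 - of_real b * (- \<i>))"
    by (intro hgrad_diff hgrad_scale hgrad_Re hgrad_Im hg open_E)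
  moreover have "(\<lambda>z. f z - of_real a * 1 - of_real b * (- \<i>)) = (\<lambda>z. f z - Complex a (-b))"
    by (auto simp: complex_eq_iff)
  ultimately show ?thesis by (simp add: v_def[abs_def])
qed

text \<open>\<open>periodic_decay\<close>, applied to the gradient of \<open>u - H\<close>, gives a
  primitive that is periodic and has bounded real part; \<open>v\<close> differs from this real part
  by a constant.\<close>

lemma v_right: "\<exists>X1 B. (\<forall>z. X1 < Re z \<longrightarrow> \<bar>v z\<bar> \<le> B \<and> v (z + iT) = v z) \<and> c + 1 < X1"
proof -
  have sub: "{z. c + 1 < Re z} \<subseteq> E" using E_iff_Re by auto
  have op: "open {z. c + 1 < Re z}" by (rule open_halfspace_Re_gt)
  have hv: "hgrad {z. c + 1 < Re z} v (\<lambda>z. f z - Complex a (-b))"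
    by (rule hgrad_subset[OF hgrad_v op sub])
  have hol: "(\<lambda>z. f z - Complex a (-b)) holomorphic_on {z. c + 1 < Re z}" by (rule hgradD(2)[OF hv])
  have per: "f (z + iT) - Complex a (-b) = f z - Complex a (-b)" if "c + 1 < Re z" for z
    using fper[of z] sub that by auto
  have "T > 0" using T_bounds by simp
  from periodic_decay[OF hol this per lineR]
  obtain h B X1 where h: "\<And>z. c + 1 < Re z \<Longrightarrow> (h has_field_derivative f z - Complex a (-b)) (at z)"
    and hp: "\<And>z. c + 1 < Re z \<Longrightarrow> h (z + iT) = h z"
    and hb: "\<And>z. X1 < Re z \<Longrightarrow> \<bar>Re (h z)\<bar> \<le> B" and X1: "c + 1 < X1"
    by metis
  have "hgrad {z. c + 1 < Re z} (\<lambda>z. Re (h z)) (\<lambda>z. f z - Complex a (-b))"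
    by (rule hgrad_Re_primitive[OF op hgradD(2)[OF hv]]) (use h in auto)
  from hgrad_diff[OF hv this]
  have "\<exists>k. \<forall>z\<in>{z. c + 1 < Re z}. v z - Re (h z) = k"
    by (intro has_derivative_zero_constant convex_halfspace_Re_gt) (auto simp: hgrad_def has_derivative_at_withinI)
  then obtain k where k: "\<And>z. c + 1 < Re z \<Longrightarrow> v z = Re (h z) + k" by (auto simp: diff_eq_eq add.commute)
  show ?thesis
  proof (rule exI[of _ X1], rule exI[of _ "B + \<bar>k\<bar>"], intro conjI allI impI X1)
    fix z assume z: "X1 < Re z"
    show "\<bar>v z\<bar> \<le> B + \<bar>k\<bar>" using k[of z] hb[of z] z X1 by simp
    show "v (z + iT) = v z" using k[of z] k[of "z + iT"] hp[of z] z X1 by simp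
  qed
qed

text \<open>Only the gradient is periodic by assumption. The increment of \<open>v\<close> over a
  period is constant on all of \<open>E\<close>, and \<open>v_right\<close> shows that it vanishes
  far to the right.\<close>

lemma v_per: "z \<in> E \<Longrightarrow> v (z + iT) = v z"
proof -
  have D: "((\<lambda>z. v (z + iT) - v z) has_derivative (\<lambda>h. 0)) (at z)" if z: "z \<in> E" for z
  proof -
    have 1: "((\<lambda>z. z + iT) has_derivative (\<lambda>h. h)) (at z)" by (auto intro!: derivative_eq_intros)
    have "((\<lambda>z. v (z + iT)) has_derivative (\<lambda>h. Re ((f (z + iT) - Complex a (-b)) * h))) (at z)"
      by (rule has_derivative_compose[OF 1 hgradD(3)[OF hgrad_v E_shift(1)[OF z]]])
    from has_derivative_diff[OF this hgradD(3)[OF hgrad_v z]] show ?thesis using fper[OF z] by simp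
  qed
  obtain X1 where X1: "\<And>z. X1 < Re z \<Longrightarrow> v (z + iT) = v z" "c + 1 < X1" using v_right by blast
  have "of_real (X1 + 1) \<in> E" using X1 c_bounds by (intro E_iff_Re) auto
  then have "v (of_real (X1 + 1) + iT) - v (of_real (X1 + 1)) = v (0 + iT) - v 0"
    using E_zero_derivative_const[OF D, of "of_real (X1 + 1)"] by simp
  then have 0: "v (0 + iT) - v 0 = 0" using X1(1)[of "of_real (X1 + 1)"] by simp
  show "z \<in> E \<Longrightarrow> v (z + iT) = v z" using E_zero_derivative_const[OF D, of z] 0 by simp
qed

lemma u_per: "z \<in> E \<Longrightarrow> u (z + iT) = u z + b * T"
  using v_per[of z] by (simp add: v_def algebra_simps)

lemma v_bounded: "\<exists>X1 B. \<forall>z. X1 < \<bar>Re z\<bar> \<longrightarrow> \<bar>v z\<bar> \<le> B"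
proof -
  interpret r: sol \<epsilon> \<delta> "-a" b kR kL "\<lambda>z. u (- cnj z)" "\<lambda>z. - cnj (f (- cnj z))" by (rule reflect)
  obtain X1 B1 where 1: "\<And>z. X1 < Re z \<Longrightarrow> \<bar>v z\<bar> \<le> B1" using v_right by blast
  obtain X2 B2 where 2: "\<And>z. X2 < Re z \<Longrightarrow> \<bar>r.v z\<bar> \<le> B2" using r.v_right by blast
  have e: "v z = r.v (- cnj z)" for z by (simp add: v_def r.v_def)
  have "\<bar>v z\<bar> \<le> max B1 B2" if "max X1 X2 < \<bar>Re z\<bar>" for z
  proof (cases "Re z \<ge> 0")
    case True then show ?thesis using 1[of z] that by auto
  next
    case False then show ?thesis using 2[of "- cnj z"] that e[of z] by auto
  qed
  then show ?thesis by blast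
qed

end

section \<open>The flux through the axis\<close>

context cols
begin

text \<open>Half the width of the narrower gap: circles around \<open>D\<^sub>R\<^sub>0\<close> of
  such radii stay short of the axis, of the lines halfway to the next rows and of all other
  disks.\<close>

lemma annulus_in_E:
  assumes "1 < cmod (z - of_real c)" "cmod (z - of_real c) < 1 + min \<epsilon> \<delta> / 2"
  shows "z \<in> E" "\<bar>Im z\<bar> < T/2" "0 < Re z" "Re z < c + 2"
proof -
  have im: "\<bar>Im z\<bar> \<le> cmod (z - of_real c)" using abs_Im_le_cmod[of "z - of_real c"] by simp
  then show "\<bar>Im z\<bar> < T/2" using assms(2) by (simp add: T_def min_def split: if_splits)
  then have im': "\<bar>Im z\<bar> \<le> T/2" by simp
  have "\<bar>Re z - c\<bar> \<le> cmod (z - of_real c)" using abs_Re_le_cmod[of "z - of_real c"] by simp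
  then show "0 < Re z" "Re z < c + 2" using assms(2) eps by (auto simp: c_def min_def split: if_splits)
  have "cmod (of_real (2 * c) :: complex) \<le> cmod (z + of_real c) + cmod (z - of_real c)"
    using norm_triangle_ineq4[of "z + of_real c" "z - of_real c"] by simp
  then have "2 * c \<le> cmod (z + of_real c) + cmod (z - of_real c)" using c_bounds by simp
  then have "1 < cmod (z + of_real c)" using assms(2) eps by (simp add: c_def min_def split: if_splits)
  then show "z \<in> E" using E_near_iff[OF im'] assms(1) by simp
qed

lemma frame_in_E:
  assumes "Re w = 0 \<or> Re w > c + 1 \<or> \<bar>Im w\<bar> = T/2"
  shows "w \<in> E"
  using assms
proof (elim disjE)
  assume im: "\<bar>Im w\<bar> = T/2"
  then have "1 < cmod (w - of_real c)" "1 < cmod (w + of_real c)"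
    using abs_Im_le_cmod[of "w - of_real c"] abs_Im_le_cmod[of "w + of_real c"] T_bounds by auto
  then show ?thesis using E_near_iff[of w] im by simp
qed (auto intro: E_imag_axis E_iff_Re)

text \<open>The rectangle, a path \<open>l\<close> to the circle, the circle backwards and
  \<open>l\<close> backwards form one closed path in \<open>E\<close>. It has winding number 0 about
  every point outside \<open>E\<close>: a point of the closed disk is encircled once by each curve,
  any other point outside \<open>E\<close> by neither.\<close>

lemma rect_circle_integral:
  assumes hol: "f holomorphic_on E" and r: "1 < r" "r < 1 + min \<epsilon> \<delta> / 2"
  shows "contour_integral (rectpath (Complex 0 (-T/2)) (Complex (c+2) (T/2))) f = contour_integral (circlepath (of_real c) r) f"
proof -
  define a1 where "a1 = Complex 0 (-T/2)"
  define a3 where "a3 = Complex (c+2) (T/2)"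
  define R where "R = rectpath a1 a3"
  define C where "C = circlepath (of_real c) r"
  define l where "l = linepath a1 (Complex (c+2) (-T/2)) +++ (linepath (Complex (c+2) (-T/2)) (of_real (c+2)) +++ linepath (of_real (c+2)) (of_real (c + r)))"
  have r0: "0 < r" using r by simp
  have le: "Re a1 \<le> Re a3" "Im a1 \<le> Im a3" using c_bounds T_bounds by (auto simp: a1_def a3_def)
  have RE: "path_image R \<subseteq> E"
  proof
    fix w assume "w \<in> path_image R"
    then have "w \<in> cbox a1 a3 - box a1 a3" using path_image_rectpath_cbox_minus_box[OF le] by (simp add: R_def)
    then show "w \<in> E" using c_bounds T_bounds by (intro frame_in_E) (auto simp: in_cbox_complex_iff in_box_complex_iff a1_def a3_def)
  qed
  have CE: "path_image C \<subseteq> E"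
    unfolding C_def using r0 r by (auto simp: path_image_circlepath dist_norm norm_minus_commute intro!: annulus_in_E(1))
  have lE: "path_image l \<subseteq> E"
  proof -
    have "closed_segment a1 (Complex (c+2) (-T/2)) \<subseteq> E"
    proof
      fix w assume "w \<in> closed_segment a1 (Complex (c+2) (-T/2))"
      then obtain t where w: "w = (1 - t) *\<^sub>R a1 + t *\<^sub>R Complex (c+2) (-T/2)" by (auto simp: closed_segment_def)
      have "Im w = -T/2" unfolding w by (simp add: a1_def algebra_simps)
      then show "w \<in> E" using T_bounds by (intro frame_in_E) auto
    qed
    moreover have "closed_segment (Complex (c+2) (-T/2)) (of_real (c+2)) \<subseteq> E"
    proof
      fix w assume "w \<in> closed_segment (Complex (c+2) (-T/2)) (of_real (c+2))"
      then obtain t where w: "w = (1 - t) *\<^sub>R Complex (c+2) (-T/2) + t *\<^sub>R of_real (c+2)" by (auto simp: closed_segment_def)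
      have "Re w = c + 2" unfolding w by (simp add: algebra_simps)
      then show "w \<in> E" by (intro frame_in_E) auto
    qed
    moreover have "closed_segment (of_real (c+2)) (of_real (c + r)) \<subseteq> E"
    proof
      fix w assume "w \<in> closed_segment (of_real (c+2) :: complex) (of_real (c + r))"
      then obtain t where t: "0 \<le> t" "t \<le> 1" "w = (1 - t) *\<^sub>R of_real (c+2) + t *\<^sub>R of_real (c + r)" by (auto simp: closed_segment_def)
      then have w: "w = of_real (c + ((1 - t) * 2 + t * r))" by (simp add: scaleR_conv_of_real algebra_simps)
      have "1 < (1 - t) * 2 + t * r"
      proof (cases "t = 0")
        case False
        then have "t * 1 < t * r" using r t by (intro mult_strict_left_mono) auto
        then have "1 < 2 - 2 * t + t * r" using t(1,2) by linarith
        then show ?thesis by (simp add: algebra_simps)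
      qed simp
      then show "w \<in> E" using w by (intro frame_in_E) auto
    qed
    ultimately show ?thesis unfolding l_def by (auto simp: path_image_join)
  qed
  have vp: "valid_path R" "valid_path C" "valid_path l" by (auto simp: R_def C_def l_def)
  have ps: "pathstart R = a1" "pathfinish R = a1" "pathstart C = of_real c + of_real r" "pathfinish C = of_real c + of_real r" "pathstart l = a1" "pathfinish l = of_real c + of_real r"
    by (auto simp: R_def C_def l_def)
  have pt: "path R" "path C" "path l" using vp valid_path_imp_path by auto
  define g where "g = R +++ (l +++ (reversepath C +++ reversepath l))"
  have "(f has_contour_integral 0) g"
  proof (rule Cauchy_theorem_global[OF open_E hol])
    show "valid_path g" unfolding g_def using vp ps by simp
    show "pathfinish g = pathstart g" unfolding g_def using ps by simp
    show "path_image g \<subseteq> E" unfolding g_def using RE CE lE ps by (simp add: path_image_join)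
    fix w assume w: "w \<notin> E"
    have wn: "w \<notin> path_image R" "w \<notin> path_image C" "w \<notin> path_image l" using w RE CE lE by auto
    have "winding_number g w = winding_number R w + (winding_number l w + (- winding_number C w + - winding_number l w))"
      unfolding g_def using wn pt ps
      by (simp add: winding_number_join winding_number_reversepath path_image_join)
    also have "\<dots> = winding_number R w - winding_number C w" by simp
    also have "\<dots> = 0"
    proof (cases "cmod (w - of_real c) \<le> 1")
      case True
      have "\<bar>Re w - c\<bar> \<le> 1" "\<bar>Im w\<bar> \<le> 1"
        using True abs_Re_le_cmod[of "w - of_real c"] abs_Im_le_cmod[of "w - of_real c"] by auto
      then have "0 < Re w" "Re w < c + 2" "-T/2 < Im w" "Im w < T/2" using c_bounds T_bounds by linarith+
      then have "w \<in> box a1 a3" by (auto simp: in_box_complex_iff a1_def a3_def)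
      then have "winding_number R w = 1" unfolding R_def by (rule winding_number_rectpath)
      moreover have "winding_number C w = 1" unfolding C_def using True r by (intro winding_number_circlepath) auto
      ultimately show ?thesis by simp
    next
      case False
      have "w \<notin> cbox a1 a3"
      proof
        assume "w \<in> cbox a1 a3"
        then have wb: "0 \<le> Re w" "\<bar>Im w\<bar> \<le> T/2" by (auto simp: in_cbox_complex_iff a1_def a3_def)
        then have "cmod (w + of_real c) \<le> 1" using E_near_iff[of w] w False by auto
        then show False using abs_Re_le_cmod[of "w + of_real c"] wb c_bounds by auto
      qed
      moreover have "cball (of_real c) r \<subseteq> cbox a1 a3"
      proof
        fix y assume "y \<in> cball (complex_of_real c) r"
        then have "cmod (y - of_real c) \<le> r" by (simp add: dist_norm norm_minus_commute)
        then have "\<bar>Re y - c\<bar> \<le> r" "\<bar>Im y\<bar> \<le> r"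
          using abs_Re_le_cmod[of "y - of_real c"] abs_Im_le_cmod[of "y - of_real c"] by auto
        moreover have "r < c" "r < T/2" "r < 2" using r eps del by (auto simp: c_def T_def min_def split: if_splits)
        ultimately have "0 \<le> Re y" "Re y \<le> c + 2" "-T/2 \<le> Im y" "Im y \<le> T/2" by linarith+
        then show "y \<in> cbox a1 a3" by (auto simp: in_cbox_complex_iff a1_def a3_def)
      qed
      ultimately have "winding_number C w = 0"
        unfolding C_def using r0 by (intro winding_number_zero_outside[of _ "cball (of_real c) r"]) (auto simp: path_image_circlepath)
      moreover have "winding_number R w = 0" unfolding R_def by (rule winding_number_rectpath_outside[OF le \<open>w \<notin> cbox a1 a3\<close>])
      ultimately show ?thesis by simp
    qed
    finally show "winding_number g w = 0" .
  qed
  then have "0 = contour_integral g f" by (simp add: contour_integral_unique)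
  also have "\<dots> = contour_integral R f - contour_integral C f"
  proof -
    have i: "f contour_integrable_on R" "f contour_integrable_on C" "f contour_integrable_on l"
      using contour_integrable_holomorphic_simple[OF hol open_E] vp RE CE lE by auto
    show ?thesis unfolding g_def using i vp ps
      by (simp add: contour_integral_join contour_integral_reversepath contour_integrable_reversepath_eq contour_integrable_joinI valid_path_reversepath)
  qed
  finally show ?thesis by (simp add: R_def C_def a1_def a3_def)
qed

text \<open>Periodicity cancels the two horizontal sides.\<close>

lemma rect_integral:
  assumes hol: "f holomorphic_on E" and per: "\<And>z. z \<in> E \<Longrightarrow> f (z + iT) = f z"
  shows "contour_integral (rectpath (Complex 0 (-T/2)) (Complex (c+2) (T/2))) f
    = \<i> * integral {-T/2..T/2} (\<lambda>y. f (Complex (c+2) y)) - \<i> * integral {-T/2..T/2} (\<lambda>y. f (Complex 0 y))"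
proof -
  define a1 where "a1 = Complex 0 (-T/2)"
  define a2 where "a2 = Complex (c+2) (-T/2)"
  define a3 where "a3 = Complex (c+2) (T/2)"
  define a4 where "a4 = Complex 0 (T/2)"
  have seg: "closed_segment x y \<subseteq> E"
    if "Re x = 0 \<and> Re y = 0 \<or> Re x = c+2 \<and> Re y = c+2 \<or> Im x = T/2 \<and> Im y = T/2 \<or> Im x = -T/2 \<and> Im y = -T/2" for x y
  proof
    fix w assume "w \<in> closed_segment x y"
    then obtain t where w: "w = (1 - t) *\<^sub>R x + t *\<^sub>R y" by (auto simp: closed_segment_def)
    then have "Re w = 0 \<or> Re w = c+2 \<or> Im w = T/2 \<or> Im w = -T/2" using that unfolding w by (auto simp: algebra_simps)
    then show "w \<in> E" using T_bounds by (intro frame_in_E) auto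
  qed
  have cont: "continuous_on E f" using hol holomorphic_on_imp_continuous_on by blast
  have ci: "f contour_integrable_on (linepath x y)" if "closed_segment x y \<subseteq> E" for x y
    by (rule contour_integrable_continuous_linepath[OF continuous_on_subset[OF cont that]])
  have I: "f contour_integrable_on (linepath a1 a2)" "f contour_integrable_on (linepath a2 a3)" "f contour_integrable_on (linepath a3 a4)" "f contour_integrable_on (linepath a4 a1)"
    by (intro ci seg; simp add: a1_def a2_def a3_def a4_def)+
  have "rectpath a1 a3 = linepath a1 a2 +++ linepath a2 a3 +++ linepath a3 a4 +++ linepath a4 a1"
    by (simp add: rectpath_def Let_def a1_def a2_def a3_def a4_def)
  then have "contour_integral (rectpath a1 a3) f = contour_integral (linepath a1 a2) f + (contour_integral (linepath a2 a3) f + (contour_integral (linepath a3 a4) f + contour_integral (linepath a4 a1) f))"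
    using I by (simp add: contour_integrable_joinI)
  moreover have "contour_integral (linepath a3 a4) f = - contour_integral (linepath a4 a3) f"
    using contour_integral_reverse_linepath[of a3 a4 f] continuous_on_subset[OF cont, of "closed_segment a3 a4"] seg[of a3 a4]
    by (simp add: a3_def a4_def)
  moreover have "contour_integral (linepath a4 a3) f = contour_integral (linepath a1 a2) f"
  proof -
    have e: "a3 - a4 = a2 - a1" by (simp add: a1_def a2_def a3_def a4_def complex_eq_iff)
    have "f (linepath a4 a3 x) = f (linepath a1 a2 x)" if "x \<in> {0..1}" for x
    proof -
      have "linepath a4 a3 x = linepath a1 a2 x + iT" by (simp add: linepath_def a1_def a2_def a3_def a4_def complex_eq_iff algebra_simps)
      moreover have "linepath a1 a2 x \<in> E"
        using seg[of a1 a2] that linepath_in_path[of x a1 a2] by (auto simp: a1_def a2_def)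
      ultimately show ?thesis using per by simp
    qed
    then have "integral {0..1} (\<lambda>x. f (linepath a4 a3 x) * (a3 - a4)) = integral {0..1} (\<lambda>x. f (linepath a1 a2 x) * (a2 - a1))"
      unfolding e by (intro integral_cong) simp
    then show ?thesis by (simp add: contour_integral_integral)
  qed
  moreover have "contour_integral (linepath a2 a3) f = \<i> * integral {-T/2..T/2} (\<lambda>y. f (Complex (c+2) y))"
    by (rule contour_integral_linepath_same_Re) (use T_bounds in \<open>auto simp: a2_def a3_def\<close>)
  moreover have "contour_integral (linepath a4 a1) f = - (\<i> * integral {-T/2..T/2} (\<lambda>y. f (Complex 0 y)))"
  proof -
    have "contour_integral (linepath a1 a4) f = \<i> * integral {-T/2..T/2} (\<lambda>y. f (Complex 0 y))"
      by (rule contour_integral_linepath_same_Re) (use T_bounds in \<open>auto simp: a1_def a4_def\<close>)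
    then show ?thesis
      using contour_integral_reverse_linepath[of a4 a1 f] continuous_on_subset[OF cont, of "closed_segment a4 a1"] seg[of a4 a1]
      by (simp add: a1_def a4_def)
  qed
  ultimately show ?thesis by (simp add: a1_def a3_def)
qed

text \<open>The gradient has boundary limits only pointwise. A sequence violating every bound would
  accumulate at a point of the circle, where the limit exists; the uniform bound is the majorant for
  dominated convergence.\<close>

lemma bounded_near_circle:
  assumes G: "\<And>q. cmod (q - of_real c) = 1 \<Longrightarrow> (f \<longlongrightarrow> G q) (at q within E)"
  shows "\<exists>m>0. \<exists>M. \<forall>z\<in>E. cmod (z - of_real c) < 1 + m \<longrightarrow> cmod (f z) \<le> M"
proof (rule ccontr)
  assume "\<not> ?thesis"
  then have "\<exists>z\<in>E. cmod (z - of_real c) < 1 + inverse (of_nat (Suc n)) \<and> cmod (f z) > of_nat n" for n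
    by (metis inverse_positive_iff_positive not_le of_nat_0_less_iff zero_less_Suc)
  then obtain zs where zs: "\<And>n. zs n \<in> E" "\<And>n. cmod (zs n - of_real c) < 1 + inverse (of_nat (Suc n))" "\<And>n. cmod (f (zs n)) > of_nat n"
    by metis
  have "zs n \<in> cball (of_real c) 2" for n
  proof -
    have "inverse (of_nat (Suc n)) \<le> (1::real)" by (simp add: field_simps)
    then show ?thesis using zs(2)[of n] by (simp add: dist_norm norm_minus_commute)
  qed
  moreover have "compact (cball (complex_of_real c) 2)" by simp
  ultimately obtain q \<sigma> where q: "strict_mono \<sigma>" "(zs \<circ> \<sigma>) \<longlonglongrightarrow> q"
    unfolding compact_def by metis
  have n1: "1 < cmod (z - of_real c)" if "z \<in> E" for z
  proof -
    have "1 < cmod (z - Complex c (of_int 0 * T))" using that E_iff by blast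
    then show ?thesis by (simp only: complex_of_real_def of_int_0 mult_zero_left)
  qed
  have "(\<lambda>n. cmod ((zs \<circ> \<sigma>) n - of_real c)) \<longlonglongrightarrow> cmod (q - of_real c)" by (intro tendsto_intros q)
  moreover have "(\<lambda>n. cmod ((zs \<circ> \<sigma>) n - of_real c)) \<longlonglongrightarrow> 1"
  proof (rule tendsto_sandwich[of "\<lambda>_. 1" _ _ "\<lambda>n. 1 + inverse (of_nat (Suc (\<sigma> n)))"])
    have "(\<lambda>n. inverse (real (Suc n))) \<longlonglongrightarrow> 0" by (rule LIMSEQ_inverse_real_of_nat)
    then have "(\<lambda>n. inverse (real (Suc (\<sigma> n)))) \<longlonglongrightarrow> 0"
      using LIMSEQ_subseq_LIMSEQ[OF _ q(1)] by (auto simp: o_def)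
    then show "(\<lambda>n. 1 + inverse (real (Suc (\<sigma> n)))) \<longlonglongrightarrow> 1" using tendsto_add[OF tendsto_const[of 1]] by fastforce
  qed (use n1 zs in \<open>auto intro!: always_eventually less_imp_le\<close>)
  ultimately have q1: "cmod (q - of_real c) = 1" using LIMSEQ_unique by blast
  then have "q \<notin> E" using n1 by force
  then have "filterlim (zs \<circ> \<sigma>) (at q within E) sequentially"
    unfolding filterlim_at using q(2) zs(1) by (auto intro!: always_eventually)
  then have "(\<lambda>n. f ((zs \<circ> \<sigma>) n)) \<longlonglongrightarrow> G q" using G[OF q1] filterlim_compose by blast
  then have "Bseq (\<lambda>n. f ((zs \<circ> \<sigma>) n))" by (intro convergent_imp_Bseq convergentI)
  then obtain K where K: "\<And>n. cmod (f ((zs \<circ> \<sigma>) n)) \<le> K" by (auto simp: Bseq_def)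
  obtain n :: nat where "K < of_nat n" using reals_Archimedean2 by blast
  also have "of_nat n \<le> real (\<sigma> n)" using seq_suble[OF q(1)] by simp
  also have "\<dots> < cmod (f ((zs \<circ> \<sigma>) n))" using zs(3) by simp
  finally show False using K[of n] by simp
qed

text \<open>Between the axis and the line \<open>Re z = c + 2\<close> there is, per period, one
  disk, and its flux is zero; hence both lines carry the same flux. The assumption on the disk
  concerns boundary limits, so it is reached through circles of radius \<open>r n\<close> tending to
  1.\<close>

lemma flux_through_axis:
  assumes hol: "f holomorphic_on E" and per: "\<And>z. z \<in> E \<Longrightarrow> f (z + iT) = f z"
    and right: "((\<lambda>y. f (Complex (c+2) y)) has_integral I) {-T/2..T/2}"
    and G: "\<And>q. cmod (q - of_real c) = 1 \<Longrightarrow> (f \<longlongrightarrow> G q) (at q within E)"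
    and fl: "((\<lambda>t. Re (G (of_real c + cis t) * cis t)) has_integral 0) {0..2*pi}"
  shows "((\<lambda>y. Re (f (Complex 0 y))) has_integral Re I) {-T/2..T/2}"
proof -
  define J where "J = integral {-T/2..T/2} (\<lambda>y. f (Complex 0 y))"
  have cont: "continuous_on E f" using hol holomorphic_on_imp_continuous_on by blast
  have "continuous_on {-T/2..T/2} (\<lambda>y. f (Complex 0 y))"
    unfolding Complex_eq by (rule continuous_on_compose2[OF cont]) (auto intro!: continuous_intros E_imag_axis)
  then have "((\<lambda>y. f (Complex 0 y)) has_integral J) {-T/2..T/2}"
    unfolding J_def by (intro integrable_integral integrable_continuous_real)
  then have ReJ: "((\<lambda>y. Re (f (Complex 0 y))) has_integral Re J) {-T/2..T/2}"
    by (rule has_integral_Re)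
  \<comment> \<open>The integrand of the imaginary part of the contour integral of \<open>f\<close>,
    that is, the outward normal derivative times arc length.\<close>
  define F where "F r t = Re (f (of_real c + of_real r * cis t) * of_real r * cis t)" for r t
  have circ: "(F r has_integral Re I - Re J) {0..2*pi}" if r: "1 < r" "r < 1 + min \<epsilon> \<delta> / 2" for r
  proof -
    have "contour_integral (circlepath (of_real c) r) f = \<i> * I - \<i> * J"
      using rect_circle_integral[OF hol r] rect_integral[OF hol per] integral_unique[OF right] by (simp add: J_def)
    moreover have "f contour_integrable_on (circlepath (of_real c) r)"
      using r by (intro contour_integrable_continuous_circlepath continuous_on_subset[OF cont])
        (auto simp: dist_norm norm_minus_commute intro!: annulus_in_E(1))
    ultimately have "(f has_contour_integral (\<i> * I - \<i> * J)) (circlepath (of_real c) r)"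
      by (metis has_contour_integral_integral)
    then have "((\<lambda>t. f (of_real c + of_real r * cis t) * of_real r * \<i> * cis t) has_integral (\<i> * I - \<i> * J)) {0..2*pi}"
      unfolding circlepath_def by (subst (asm) has_contour_integral_part_circlepath_iff) auto
    from has_integral_Im[OF this] show ?thesis by (simp add: F_def[abs_def] algebra_simps)
  qed
  obtain m M where m: "m > 0" and M: "\<And>z. z \<in> E \<Longrightarrow> cmod (z - of_real c) < 1 + m \<Longrightarrow> cmod (f z) \<le> M"
    using bounded_near_circle[OF G] by blast
  define m0 where "m0 = min (min m (min \<epsilon> \<delta> / 2)) 1 / 2"
  have m0: "0 < m0" "m0 < m" "m0 < min \<epsilon> \<delta> / 2" "m0 < 1" using m eps del by (auto simp: m0_def min_def)
  define r where "r n = 1 + m0 / of_nat (Suc n)" for n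
  have rn: "1 < r n" "r n \<le> 1 + m0" for n
  proof -
    show "1 < r n" using m0 by (simp add: r_def)
    have "m0 / of_nat (Suc n) \<le> m0 / 1" using m0 by (intro divide_left_mono) auto
    then show "r n \<le> 1 + m0" by (simp add: r_def)
  qed
  have rlim: "r \<longlonglongrightarrow> 1"
  proof -
    have "(\<lambda>n. 1 + m0 * inverse (real (Suc n))) \<longlonglongrightarrow> 1 + m0 * 0" by (intro tendsto_intros LIMSEQ_inverse_real_of_nat)
    then show ?thesis by (simp add: r_def[abs_def] divide_inverse)
  qed
  have zE: "of_real c + of_real (r n) * cis t \<in> E" and znorm: "cmod (of_real c + of_real (r n) * cis t - of_real c) = r n" for n t
  proof -
    show nn: "cmod (of_real c + of_real (r n) * cis t - of_real c) = r n" using rn(1)[of n] by (simp add: norm_mult)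
    show "of_real c + of_real (r n) * cis t \<in> E"
      by (rule annulus_in_E(1)) (use rn[of n] m0 nn in \<open>linarith+\<close>)
  qed
  have circn: "(F (r n) has_integral Re I - Re J) {0..2*pi}" for n
    by (rule circ) (use rn[of n] m0 in \<open>linarith+\<close>)
  have "(\<lambda>n. integral {0..2*pi} (F (r n))) \<longlonglongrightarrow> integral {0..2*pi} (\<lambda>t. Re (G (of_real c + cis t) * cis t))"
  proof (rule dominated_convergence(2)[where h = "\<lambda>_. 2 * \<bar>M\<bar>"])
    show "F (r n) integrable_on {0..2*pi}" for n using circn by blast
    show "(\<lambda>_. 2 * \<bar>M\<bar>) integrable_on {0..2*pi}"
      by (intro integrable_continuous_real continuous_on_const)
    show "norm (F (r n) t) \<le> 2 * \<bar>M\<bar>" for n t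
    proof -
      have "norm (F (r n) t) \<le> cmod (f (of_real c + of_real (r n) * cis t) * of_real (r n) * cis t)"
        unfolding F_def by (simp only: real_norm_def abs_Re_le_cmod)
      also have "\<dots> = cmod (f (of_real c + of_real (r n) * cis t)) * r n" using rn(1)[of n] by (simp add: norm_mult)
      also have "\<dots> \<le> \<bar>M\<bar> * 2"
      proof (rule mult_mono)
        have "cmod (of_real c + of_real (r n) * cis t - of_real c) < 1 + m" using znorm rn(2)[of n] m0 by simp
        from M[OF zE this] show "cmod (f (of_real c + of_real (r n) * cis t)) \<le> \<bar>M\<bar>" by linarith
        show "r n \<le> 2" using rn(2)[of n] m0 by linarith
      qed (use rn(1)[of n] in auto)
      finally show ?thesis by simp
    qed
    show "(\<lambda>n. F (r n) t) \<longlonglongrightarrow> Re (G (of_real c + cis t) * cis t)" for t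
    proof -
      have ne: "of_real c + of_real (r n) * cis t \<noteq> of_real c + cis t" for n
      proof
        assume "of_real c + of_real (r n) * cis t = of_real c + cis t"
        then have "cmod (of_real c + of_real (r n) * cis t - of_real c) = cmod (of_real c + cis t - of_real c)" by simp
        then show False using znorm[of n t] rn(1)[of n] by simp
      qed
      have "(\<lambda>n. of_real c + of_real (r n) * cis t) \<longlonglongrightarrow> of_real c + of_real 1 * cis t" by (intro tendsto_intros rlim)
      then have "filterlim (\<lambda>n. of_real c + of_real (r n) * cis t) (at (of_real c + cis t) within E) sequentially"
        unfolding filterlim_at using zE ne by (auto intro!: always_eventually)
      moreover have "cmod (of_real c + cis t - of_real c) = 1" by simp
      ultimately have "(\<lambda>n. f (of_real c + of_real (r n) * cis t)) \<longlonglongrightarrow> G (of_real c + cis t)"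
        using G filterlim_compose by blast
      then have "(\<lambda>n. Re (f (of_real c + of_real (r n) * cis t) * of_real (r n) * cis t)) \<longlonglongrightarrow> Re (G (of_real c + cis t) * of_real 1 * cis t)"
        by (intro tendsto_intros rlim)
      then show ?thesis by (simp add: F_def)
    qed
  qed
  moreover have "integral {0..2*pi} (F (r n)) = Re I - Re J" for n using circn by (rule integral_unique)
  moreover have "integral {0..2*pi} (\<lambda>t. Re (G (of_real c + cis t) * cis t)) = 0" using fl by (rule integral_unique)
  ultimately have "Re I - Re J = 0" using LIMSEQ_unique[OF tendsto_const] by (simp add: LIMSEQ_const_iff)
  then show ?thesis using ReJ by simp
qed

end

section \<open>The difference of the boundary constants\<close>

lemma Re_coth: "Re (cosh w / sinh w) = sinh (Re w) * cosh (Re w) / ((sinh (Re w))\<^sup>2 + (sin (Im w))\<^sup>2)"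
proof -
  have "cosh w / sinh w = cosh w * cnj (sinh w) / of_real ((cmod (sinh w))\<^sup>2)"
    by (metis complex_div_cnj of_real_power)
  then have "Re (cosh w / sinh w) = Re (cosh w * cnj (sinh w)) / (cmod (sinh w))\<^sup>2"
    by (simp only: Re_divide_of_real)
  moreover have "Re (cosh w * cnj (sinh w)) = sinh (Re w) * cosh (Re w) * ((cos (Im w))\<^sup>2 + (sin (Im w))\<^sup>2)"
  proof -
    have "Re (cosh w * cnj (sinh w)) = sinh (Re w) * cosh (Re w) * (cos (Im w) * cos (Im w)) + sinh (Re w) * cosh (Re w) * (sin (Im w) * sin (Im w))"
      by (simp add: Re_cosh Im_cosh Re_sinh Im_sinh)
    also have "\<dots> = sinh (Re w) * cosh (Re w) * ((cos (Im w))\<^sup>2 + (sin (Im w))\<^sup>2)"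
      by (simp only: power2_eq_square distrib_left)
    finally show ?thesis .
  qed
  ultimately show ?thesis by (simp add: cmod_sinh_sq)
qed

lemma sinh_sq_diff: "(sinh (x + y))\<^sup>2 = (sinh (x - y))\<^sup>2 + sinh (2 * x) * sinh (2 * y)" for x y :: real
proof -
  have "sinh (2 * x) * sinh (2 * y) = 4 * (sinh x * cosh x) * (sinh y * cosh y)"
    by (simp add: sinh_double)
  then show ?thesis by (simp add: sinh_add sinh_diff power2_eq_square algebra_simps)
qed

text \<open>Convexity puts \<open>sinh\<close> below its chord over the interval from 0 to 2, whose
  slope is \<open>sinh 2 / 2\<close>.\<close>

lemma sinh_le_2: "0 \<le> x \<Longrightarrow> x \<le> 2 \<Longrightarrow> sinh x \<le> 2 * (x::real)"
proof -
  assume x: "0 \<le> x" "x \<le> 2"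
  have conv: "convex_on {0..2} (sinh :: real \<Rightarrow> real)"
    by (rule convex_on_realI[where f' = cosh]) (auto intro!: derivative_eq_intros simp: cosh_real_nonneg_le_iff)
  have s2: "sinh (2::real) \<le> 4"
  proof -
    have "exp (2::real) = exp 1 * exp 1" by (simp flip: exp_add)
    also have "\<dots> \<le> 14/5 * (14/5)" using e_approx_32 by (intro mult_mono) (auto simp: abs_if split: if_splits)
    finally have "exp (2::real) \<le> 8" by simp
    moreover have "sinh (2::real) \<le> exp 2 / 2" by (simp add: sinh_field_def)
    ultimately show ?thesis by linarith
  qed
  have "sinh ((1 - x/2) *\<^sub>R 0 + (x/2) *\<^sub>R 2) \<le> (1 - x/2) * sinh 0 + (x/2) * sinh 2"
    using x by (intro convex_onD[OF conv]) auto
  then have "sinh x \<le> x/2 * sinh 2" by simp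
  also have "\<dots> \<le> x/2 * 4" using x s2 by (intro mult_left_mono) auto
  finally show ?thesis by simp
qed

text \<open>The factor in the bound of \<open>psi\<close> on the right circle: 7 and 1 bound
  \<open>2 * s * Re z\<close> and \<open>2 * s * p\<close> there.\<close>

definition C1 :: real where "C1 = 8 * cosh 7 * cosh 1"

lemma C1_pos: "C1 > 0" by (simp add: C1_def)

context cols
begin

text \<open>The points \<open>p\<close> and \<open>-p\<close> are inverse to each other in both unit
  circles with centres \<open>c\<close> and \<open>-c\<close>. For a single pair of disks,
  logarithmic poles at these points would give a potential constant on each circle. The size of
  \<open>p\<close> is that of \<open>sqrt \<epsilon>\<close>.\<close>

definition p :: real where "p = sqrt (c\<^sup>2 - 1)"

lemma p_sq: "p\<^sup>2 = c\<^sup>2 - 1"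
  using c_bounds by (simp add: p_def)

lemma p_bounds: "0 < p" "p < 11/100"
proof -
  show "0 < p" using c_bounds by (simp add: p_def)
  have "c\<^sup>2 \<le> (201/200)\<^sup>2" using c_bounds by (intro power_mono) auto
  then have "p\<^sup>2 < (11/100)\<^sup>2" unfolding p_sq by (simp add: power2_eq_square)
  then show "p < 11/100" by (rule power2_less_imp_less) simp
qed

lemma c_p_prod: "(c - p) * (c + p) = 1"
  using p_sq by (simp add: power2_eq_square algebra_simps)

lemma c_minus_p: "1/2 < c - p" "c - p < 1"
proof -
  show "1/2 < c - p" using c_bounds p_bounds by simp
  then have "c - p < (c - p) * (c + p)" using c_bounds p_bounds by (simp add: mult_less_cancel_left1)
  then show "c - p < 1" by (simp add: c_p_prod)
qed

lemma s_bounds: "3/2 < s" "s < 8/5"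
  using T_bounds pi_approx by (auto simp: s_def field_simps)

lemma sp_bounds: "0 < s * p" "s * p < 1/4"
proof -
  show "0 < s * p" using s_pos p_bounds by simp
  have "s * p \<le> 8/5 * (11/100)" using s_bounds p_bounds by (intro mult_mono) auto
  then show "s * p < 1/4" by simp
qed

text \<open>\<open>psi\<close> vanishes on the imaginary axis, is comparable to \<open>p\<close> on the right disks, and has
  flux of order 1 per period through the axis.\<close>
definition psi :: "complex \<Rightarrow> real" where "psi z = lsinh (-p) z - lsinh p z"
definition dpsi :: "complex \<Rightarrow> complex" where "dpsi z = dlsinh (-p) z - dlsinh p z"

lemma hgrad_psi: "hgrad E psi dpsi"
  unfolding psi_def[abs_def] dpsi_def[abs_def]
  by (intro hgrad_diff hgrad_lsinh) (use c_minus_p in auto)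

lemma psi_shift: "psi (z + iT) = psi z"
  by (simp add: psi_def lsinh_shift)

lemma cmod_sinh_p:
  "(cmod (sinh (of_real s * (z - of_real x))))\<^sup>2 = (sinh (s * (Re z - x)))\<^sup>2 + (sin (s * Im z))\<^sup>2"
  by (simp only: cmod_sinh_sq lsinh_arg)

lemma lsinh_eq: "lsinh x z = ln ((sinh (s * (Re z - x)))\<^sup>2 + (sin (s * Im z))\<^sup>2) / 2"
proof -
  have "ln ((cmod (sinh (of_real s * (z - of_real x))))\<^sup>2) = 2 * lsinh x z"
    by (cases "cmod (sinh (of_real s * (z - of_real x))) = 0") (auto simp: lsinh_def ln_realpow)
  then show ?thesis by (simp add: cmod_sinh_p)
qed

lemma psi_zero: "Re z = 0 \<Longrightarrow> psi z = 0"
  by (simp add: psi_def lsinh_eq)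

text \<open>\<open>sinh_sq_diff\<close> turns the quotient of the squared moduli into 1 plus a term
  in which \<open>Re z\<close> and \<open>p\<close> enter as separate small factors.\<close>

lemma psi_formula:
  assumes "sinh (of_real s * (z - of_real p)) \<noteq> 0" "Re z \<ge> 0"
  defines "D \<equiv> (sinh (s * (Re z - p)))\<^sup>2 + (sin (s * Im z))\<^sup>2"
  shows "psi z = ln (1 + sinh (2 * s * Re z) * sinh (2 * s * p) / D) / 2" "D > 0"
proof -
  have "D = (cmod (sinh (of_real s * (z - of_real p))))\<^sup>2" by (simp add: D_def cmod_sinh_p)
  then show D: "D > 0" using assms(1) by simp
  define A where "A = sinh (2 * s * Re z) * sinh (2 * s * p)"
  have "(sinh (s * (Re z + p)))\<^sup>2 = (sinh (s * (Re z - p)))\<^sup>2 + A"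
    using sinh_sq_diff[of "s * Re z" "s * p"] by (simp add: A_def algebra_simps)
  then have "(sinh (s * (Re z - - p)))\<^sup>2 + (sin (s * Im z))\<^sup>2 = D + A" by (simp add: D_def)
  moreover have "D + A = D * (1 + A / D)" using D by (simp add: distrib_left)
  ultimately have N: "(sinh (s * (Re z - - p)))\<^sup>2 + (sin (s * Im z))\<^sup>2 = D * (1 + A / D)" by simp
  have "0 \<le> A / D" using assms(2) s_pos p_bounds D by (simp add: A_def)
  then have "ln (D * (1 + A / D)) = ln D + ln (1 + A / D)" using D by (intro ln_mult_pos) auto
  then show "psi z = ln (1 + sinh (2 * s * Re z) * sinh (2 * s * p) / D) / 2"
    unfolding psi_def lsinh_eq N A_def[symmetric] D_def[symmetric] by (simp add: add_divide_distrib)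
qed

lemma sinh_nonzero_near:
  assumes "\<bar>Im z\<bar> \<le> T/2" "z \<noteq> of_real x"
  shows "sinh (of_real s * (z - of_real x)) \<noteq> 0"
proof
  assume "sinh (of_real s * (z - of_real x)) = 0"
  then have "s * cmod (z - of_real x) \<le> 0" using cmod_sinh_lower[OF assms(1), of x] by simp
  then show False using s_pos assms(2) by (simp add: mult_le_0_iff)
qed

text \<open>The last assumption makes the denominator at most of order \<open>Re z\<close>, like the
  numerator, so the quotient is at least \<open>p/3\<close> however small \<open>Re z\<close> is.
  The bound 6/5 keeps the argument of \<open>sinh\<close> below 2.\<close>

lemma psi_lower_aux:
  assumes z: "0 \<le> Re z" "\<bar>Re z - p\<bar> \<le> 6/5" "\<bar>Im z\<bar> \<le> T/2" "z \<noteq> of_real p"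
    and q: "(cmod (z - of_real p))\<^sup>2 \<le> 3 * Re z"
  shows "p/8 \<le> psi z"
proof -
  define D where "D = (sinh (s * (Re z - p)))\<^sup>2 + (sin (s * Im z))\<^sup>2"
  have nz: "cmod (z - of_real p) > 0" using z by simp
  have "sinh (of_real s * (z - of_real p)) \<noteq> 0"
    by (rule sinh_nonzero_near[OF z(3,4)])
  note F = psi_formula[OF this z(1), folded D_def]
  have "s * \<bar>Re z - p\<bar> \<le> 8/5 * (6/5)" using s_bounds z by (intro mult_mono) auto
  then have "sinh \<bar>s * (Re z - p)\<bar> \<le> 2 * \<bar>s * (Re z - p)\<bar>" using s_pos by (intro sinh_le_2) (auto simp: abs_mult)
  moreover have "\<bar>sinh (s * (Re z - p))\<bar> = sinh \<bar>s * (Re z - p)\<bar>" by (cases "s * (Re z - p) \<ge> 0") (auto simp: abs_if)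
  ultimately have "(sinh (s * (Re z - p)))\<^sup>2 \<le> (2 * (s * (Re z - p)))\<^sup>2" by (subst abs_le_square_iff[symmetric]) (simp add: abs_mult)
  moreover have "(sin (s * Im z))\<^sup>2 \<le> (s * Im z)\<^sup>2" by (rule sin_sq_le)
  moreover have "(2 * (s * (Re z - p)))\<^sup>2 = 4 * (s\<^sup>2 * (Re z - p)\<^sup>2)" "(s * Im z)\<^sup>2 = s\<^sup>2 * (Im z)\<^sup>2"
    by (simp_all add: power_mult_distrib)
  moreover have "4 * s\<^sup>2 * (cmod (z - of_real p))\<^sup>2 = 4 * (s\<^sup>2 * (Re z - p)\<^sup>2) + 4 * (s\<^sup>2 * (Im z)\<^sup>2)"
    by (simp add: cmod_power2 distrib_left)
  moreover have "s\<^sup>2 * (Im z)\<^sup>2 \<ge> 0" by simp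
  ultimately have "D \<le> 4 * s\<^sup>2 * (cmod (z - of_real p))\<^sup>2"
    unfolding D_def by linarith
  also have "\<dots> \<le> 4 * s\<^sup>2 * (3 * Re z)" using q by (intro mult_left_mono) auto
  finally have D: "D \<le> 12 * s\<^sup>2 * Re z" by simp
  have "(2 * s * Re z) * (2 * s * p) \<le> sinh (2 * s * Re z) * sinh (2 * s * p)"
    using z s_pos p_bounds by (intro mult_mono sinh_ge_self) auto
  moreover have "p/3 * D \<le> p/3 * (12 * s\<^sup>2 * Re z)" using D p_bounds by (intro mult_left_mono) auto
  ultimately have "p/3 * D \<le> sinh (2 * s * Re z) * sinh (2 * s * p)" by (simp add: power2_eq_square algebra_simps)
  then have "p/3 \<le> sinh (2 * s * Re z) * sinh (2 * s * p) / D" using F(2) by (simp add: field_simps)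
  then have "ln (1 + p/3) \<le> ln (1 + sinh (2 * s * Re z) * sinh (2 * s * p) / D)"
    using p_bounds by (intro ln_mono) linarith+
  moreover have "p/4 \<le> ln (1 + p/3)"
  proof -
    have "1 - 1 / (1 + p/3) \<le> ln (1 + p/3)"
      using ln_le_minus_one[of "1 / (1 + p/3)"] p_bounds by (simp add: ln_div)
    moreover have "p/4 \<le> 1 - 1 / (1 + p/3)" using p_bounds by (simp add: field_simps)
    ultimately show ?thesis by linarith
  qed
  ultimately show ?thesis unfolding F(1) by linarith
qed

text \<open>Because \<open>p\<^sup>2 = c\<^sup>2 - 1\<close>, the squared distance to the pole is
  proportional to \<open>Re z\<close> on the circle; both estimates of \<open>psi\<close> there rest
  on this.\<close>

lemma circle_cmod_p:
  assumes "cmod (z - of_real c) = 1"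
  shows "(cmod (z - of_real p))\<^sup>2 = 2 * Re z * (c - p)" "c - 1 \<le> Re z" "Re z \<le> c + 1" "\<bar>Im z\<bar> \<le> 1" "z \<noteq> of_real p" "z \<noteq> - of_real p"
proof -
  have 1: "(Re z - c)\<^sup>2 + (Im z)\<^sup>2 = 1" using assms cmod_power2[of "z - of_real c"] by simp
  show "(cmod (z - of_real p))\<^sup>2 = 2 * Re z * (c - p)"
    unfolding cmod_power2 using 1 p_sq by (simp add: power2_eq_square algebra_simps)
  show r: "c - 1 \<le> Re z" "Re z \<le> c + 1" using abs_Re_le_cmod[of "z - of_real c"] assms by auto
  show "\<bar>Im z\<bar> \<le> 1" using abs_Im_le_cmod[of "z - of_real c"] assms by auto
  show "z \<noteq> of_real p"
  proof
    assume "z = of_real p"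
    then have "cmod (z - of_real c) = \<bar>p - c\<bar>" by (metis norm_of_real of_real_diff)
    then show False using assms c_minus_p by auto
  qed
  show "z \<noteq> - of_real p" using r c_bounds p_bounds by auto
qed

text \<open>Only the half facing the axis: \<open>k_lower\<close> compares in the strip
  \<open>0 < Re z < c\<close>, and the gaps of its right side are covered by
  \<open>psi_lower_section\<close>.\<close>

lemma psi_lower_circle:
  assumes "cmod (z - of_real c) = 1" "Re z \<le> c"
  shows "p/8 \<le> psi z"
proof (rule psi_lower_aux)
  note C = circle_cmod_p[OF assms(1)]
  show "0 \<le> Re z" using C c_bounds by linarith
  then have "2 * Re z * (c - p) \<le> 2 * Re z * 1" using c_minus_p by (intro mult_left_mono) auto
  then show "(cmod (z - of_real p))\<^sup>2 \<le> 3 * Re z" using C(1) \<open>0 \<le> Re z\<close> by linarith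
  show "\<bar>Re z - p\<bar> \<le> 6/5" using assms(2) \<open>0 \<le> Re z\<close> c_bounds p_bounds by linarith
  show "\<bar>Im z\<bar> \<le> T/2" using C T_bounds by linarith
qed (use circle_cmod_p[OF assms(1)] in auto)

lemma psi_lower_section:
  assumes "Re z = c" "\<bar>Im z\<bar> \<le> T/2"
  shows "p/8 \<le> psi z"
proof (rule psi_lower_aux)
  show "\<bar>Re z - p\<bar> \<le> 6/5" using assms c_bounds p_bounds by linarith
  show "z \<noteq> of_real p" using assms c_minus_p by auto
  have "(Im z)\<^sup>2 \<le> (T/2)\<^sup>2" using assms(2) T_bounds by (simp add: abs_le_square_iff[symmetric])
  also have "\<dots> \<le> (11/10)\<^sup>2" using T_bounds by (intro power_mono) auto
  finally have "(Im z)\<^sup>2 \<le> 121/100" by (simp add: power2_eq_square)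
  moreover have "(c - p)\<^sup>2 \<le> 1\<^sup>2" using c_minus_p by (intro power_mono) auto
  ultimately show "(cmod (z - of_real p))\<^sup>2 \<le> 3 * Re z" using assms c_bounds by (simp add: cmod_power2)
qed (use assms c_bounds in auto)

lemma psi_upper_circle:
  assumes "cmod (z - of_real c) = 1"
  shows "psi z \<le> C1 * p"
proof -
  note C = circle_cmod_p[OF assms]
  define D where "D = (sinh (s * (Re z - p)))\<^sup>2 + (sin (s * Im z))\<^sup>2"
  have x: "Re z > 0" using C c_bounds by linarith
  have Im: "\<bar>Im z\<bar> \<le> T/2" using C T_bounds by linarith
  have nz: "cmod (z - of_real p) > 0" using C by simp
  have "sinh (of_real s * (z - of_real p)) \<noteq> 0"
    by (rule sinh_nonzero_near[OF Im C(5)])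
  note F = psi_formula[OF this less_imp_le[OF x], folded D_def]
  have "(s * cmod (z - of_real p) / 2)\<^sup>2 \<le> (cmod (sinh (of_real s * (z - of_real p))))\<^sup>2"
    using cmod_sinh_lower[OF Im, of p] s_pos by (intro power_mono) auto
  also have "\<dots> = D" by (simp add: D_def cmod_sinh_p)
  finally have "s\<^sup>2 / 4 * (cmod (z - of_real p))\<^sup>2 \<le> D" by (simp add: power_mult_distrib power_divide)
  then have "s\<^sup>2 / 4 * (2 * Re z * (c - p)) \<le> D" unfolding C(1) .
  moreover have "s\<^sup>2 / 4 * (2 * Re z * (1/2)) \<le> s\<^sup>2 / 4 * (2 * Re z * (c - p))"
    using c_minus_p x by (intro mult_left_mono) auto
  ultimately have "s\<^sup>2 / 4 * (2 * Re z * (1/2)) \<le> D" by (rule order_trans[rotated])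
  then have D: "D \<ge> s\<^sup>2 / 4 * Re z" by simp
  have x7: "2 * s * Re z \<le> 7"
  proof -
    have "2 * s * Re z \<le> 2 * (8/5) * (401/200)" using s_bounds C c_bounds x by (intro mult_mono) auto
    then show ?thesis by linarith
  qed
  have "sinh (2 * s * Re z) \<le> 2 * s * Re z * cosh (2 * s * Re z)" using s_pos x by (intro sinh_le_mult_cosh) auto
  also have "\<dots> \<le> 2 * s * Re z * cosh 7" using s_pos x x7 by (intro mult_left_mono) (auto simp: cosh_real_nonneg_le_iff)
  finally have A: "sinh (2 * s * Re z) \<le> 2 * s * Re z * cosh 7" .
  have "sinh (2 * s * p) \<le> 2 * s * p * cosh (2 * s * p)" using s_pos p_bounds by (intro sinh_le_mult_cosh) auto
  also have "\<dots> \<le> 2 * s * p * cosh 1" using s_pos p_bounds sp_bounds by (intro mult_left_mono) (auto simp: cosh_real_nonneg_le_iff)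
  finally have B: "sinh (2 * s * p) \<le> 2 * s * p * cosh 1" .
  have "sinh (2 * s * Re z) * sinh (2 * s * p) \<le> (2 * s * Re z * cosh 7) * (2 * s * p * cosh 1)"
    using A B s_pos x p_bounds by (intro mult_mono) auto
  also have "\<dots> = 2 * C1 * p * (s\<^sup>2 / 4 * Re z)" by (simp add: C1_def power2_eq_square)
  also have "\<dots> \<le> 2 * C1 * p * D" using D C1_pos p_bounds by (intro mult_left_mono) auto
  finally have "sinh (2 * s * Re z) * sinh (2 * s * p) / D \<le> 2 * C1 * p" using F(2) by (simp add: field_simps)
  moreover have "ln (1 + sinh (2 * s * Re z) * sinh (2 * s * p) / D) \<le> sinh (2 * s * Re z) * sinh (2 * s * p) / D"
    using F(2) s_pos x p_bounds by (intro ln_add_one_self_le_self) auto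
  ultimately show ?thesis unfolding F(1) by linarith
qed

lemma isCont_psi_circle:
  assumes "cmod (z - of_real c) = 1"
  shows "isCont psi z"
proof -
  note C = circle_cmod_p[OF assms]
  have Im: "\<bar>Im z\<bar> \<le> T/2" using C T_bounds by linarith
  show ?thesis
    unfolding psi_def[abs_def] lsinh_def[abs_def]
    using sinh_nonzero_near[OF Im, of p] sinh_nonzero_near[OF Im, of "-p"] C by (intro continuous_intros) auto
qed

text \<open>Supplies the a priori bound at infinity that \<open>right_max_principle\<close> asks
  for.\<close>

lemma psi_far:
  assumes "Re z \<ge> 3"
  shows "psi z \<le> 1 + ln 4"
proof -
  have "lsinh (-p) z \<le> s * (Re z + p)"
  proof -
    have "(sinh (s * (Re z + p)))\<^sup>2 + (sin (s * Im z))\<^sup>2 \<le> (cosh (s * (Re z + p)))\<^sup>2"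
      using abs_sin_le_one[of "s * Im z"] abs_square_le_1[of "sin (s * Im z)"] by (simp add: cosh_square_eq)
    moreover have "(sinh (s * (Re z + p)))\<^sup>2 + (sin (s * Im z))\<^sup>2 > 0"
      using assms s_pos p_bounds by (intro add_pos_nonneg) (auto simp: zero_less_power2)
    ultimately have "lsinh (-p) z \<le> ln ((cosh (s * (Re z + p)))\<^sup>2) / 2"
      unfolding lsinh_eq by simp
    also have "\<dots> = ln (cosh (s * (Re z + p)))" by (simp add: ln_realpow)
    also have "\<dots> \<le> ln (exp (s * (Re z + p)))"
    proof (subst ln_le_cancel_iff)
      have "exp (- (s * (Re z + p))) \<le> exp (s * (Re z + p))" using assms s_pos p_bounds by simp
      then show "cosh (s * (Re z + p)) \<le> exp (s * (Re z + p))" by (simp add: cosh_field_def)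
    qed auto
    finally show ?thesis by simp
  qed
  moreover have "lsinh p z \<ge> s * (Re z - p) - ln 4"
  proof -
    define t where "t = s * (Re z - p)"
    have "3/2 * 2 \<le> s * (Re z - p)" using s_bounds assms p_bounds by (intro mult_mono) auto
    then have t: "t \<ge> 1" by (simp add: t_def)
    have "exp (-t) \<le> exp t / 2"
    proof -
      have "2 \<le> exp (2 * t)" using exp_ge_add_one_self[of "2 * t"] t by linarith
      also have "exp (2 * t) = exp t / exp (- t)" by (simp add: exp_minus divide_inverse flip: exp_add)
      finally show ?thesis by (simp add: field_simps)
    qed
    then have e: "exp t / 4 \<le> sinh t" by (simp add: sinh_field_def)
    have "exp t / 4 > 0" by simp
    then have "(exp t / 4)\<^sup>2 \<le> (sinh t)\<^sup>2 + (sin (s * Im z))\<^sup>2"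
      using power_mono[OF e, of 2] by (simp add: add_increasing2)
    then have "ln ((exp t / 4)\<^sup>2) / 2 \<le> lsinh p z"
      unfolding lsinh_eq t_def[symmetric] by (intro divide_right_mono) (auto intro!: ln_mono)
    moreover have "ln ((exp t / 4)\<^sup>2) / 2 = t - ln 4" by (simp add: ln_realpow ln_div)
    ultimately show ?thesis by (simp add: t_def)
  qed
  ultimately show ?thesis using sp_bounds by (simp add: psi_def algebra_simps)
qed

lemma Re_dpsi:
  "Re (dpsi (Complex 0 y)) = 2 * s * sinh (s * p) * cosh (s * p) / ((sinh (s * p))\<^sup>2 + (sin (s * y))\<^sup>2)"
proof -
  have 1: "dlsinh x z = of_real s * (cosh (of_real s * (z - of_real x)) / sinh (of_real s * (z - of_real x)))" for x z
    by (simp add: dlsinh_def)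
  have e: "Re (of_real r * w) = r * Re w" for r and w :: complex by simp
  have "Re (dlsinh x (Complex 0 y)) = s * (sinh (s * (-x)) * cosh (s * (-x)) / ((sinh (s * (-x)))\<^sup>2 + (sin (s * y))\<^sup>2))" for x
    unfolding 1 e Re_coth lsinh_arg by simp
  then show ?thesis by (simp add: dpsi_def)
qed

lemma cosh_sp: "cosh (s * p) \<le> 2"
proof -
  have "2 * cosh (s * p) = exp (s * p) + exp (- (s * p))" by (simp add: cosh_field_def)
  moreover have "exp (s * p) \<le> exp 1" "exp (- (s * p)) \<le> 1" using sp_bounds by auto
  moreover have "exp 1 < (3::real)" using e_less_272 by simp
  ultimately show ?thesis by linarith
qed

text \<open>On the axis the derivative is a peak of height of order \<open>1/p\<close> and width of
  order \<open>p\<close>. The lower bound comes from the interval from \<open>-p\<close> to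
  \<open>p\<close> alone; the upper bound from a multiple of
  \<open>\<alpha> / (1 + (\<alpha> * y)\<^sup>2)\<close> with integral at most
  \<open>8 * pi\<close>.\<close>

lemma dpsi_integral: "(\<lambda>y. Re (dpsi (Complex 0 y))) integrable_on {-T/2..T/2}"
  "4/5 \<le> integral {-T/2..T/2} (\<lambda>y. Re (dpsi (Complex 0 y)))"
  "integral {-T/2..T/2} (\<lambda>y. Re (dpsi (Complex 0 y))) \<le> 26"
proof -
  define X where "X = s * p"
  have X: "0 < X" "X < 1/4" "sinh X > 0" using sp_bounds by (auto simp: X_def)
  define F where "F y = 2 * s * sinh X * cosh X / ((sinh X)\<^sup>2 + (sin (s * y))\<^sup>2)" for y
  have Fe: "Re (dpsi (Complex 0 y)) = F y" for y by (simp add: Re_dpsi F_def X_def)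
  have den: "(sinh X)\<^sup>2 + (sin (s * y))\<^sup>2 > 0" for y using X by (simp add: add_pos_nonneg)
  have Fpos: "F y \<ge> 0" for y unfolding F_def using X s_pos by (intro divide_nonneg_nonneg) auto
  have cont: "continuous_on A F" for A
    unfolding F_def using den by (intro continuous_intros) (auto simp: less_imp_neq[symmetric])
  then have int: "F integrable_on {x..y}" for x y by (intro integrable_continuous_real)
  show "(\<lambda>y. Re (dpsi (Complex 0 y))) integrable_on {-T/2..T/2}" unfolding Fe by (rule int)
  have low: "F y \<ge> 2 / (5 * p)" if "y \<in> {-p..p}" for y
  proof -
    have "\<bar>s * y\<bar> \<le> X" using that s_pos by (auto simp: X_def abs_le_iff abs_mult mult_le_cancel_left_pos)
    then have "(s * y)\<^sup>2 \<le> X\<^sup>2" using X by (simp add: abs_le_square_iff[symmetric])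
    then have "(sin (s * y))\<^sup>2 \<le> X\<^sup>2" using sin_sq_le order_trans by blast
    moreover have "(sinh X)\<^sup>2 \<le> (2 * X)\<^sup>2" using X by (intro power_mono sinh_le_2) auto
    ultimately have "(sinh X)\<^sup>2 + (sin (s * y))\<^sup>2 \<le> 5 * X\<^sup>2" by (simp add: power2_eq_square)
    moreover have "X * 1 \<le> sinh X * cosh X" using X by (intro mult_mono sinh_ge_self cosh_real_ge_1) auto
    ultimately have "2 * s * X / (5 * X\<^sup>2) \<le> F y" unfolding F_def using den s_pos X
      by (intro frac_le) (auto simp: mult.assoc)
    moreover have "2 * s * X / (5 * X\<^sup>2) = 2 / (5 * p)" using s_pos p_bounds by (simp add: X_def power2_eq_square field_simps)
    ultimately show ?thesis by simp
  qed
  have "4/5 = integral {-p..p} (\<lambda>y. 2 / (5 * p))" using p_bounds by simp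
  also have "\<dots> \<le> integral {-p..p} F" by (intro integral_le int low) auto
  also have "\<dots> \<le> integral {-T/2..T/2} F" using p_bounds T_bounds Fpos by (intro integral_subset_le int) auto
  finally show "4/5 \<le> integral {-T/2..T/2} (\<lambda>y. Re (dpsi (Complex 0 y)))" unfolding Fe .
  define \<alpha> where "\<alpha> = s / (2 * sinh X)"
  have \<alpha>: "\<alpha> > 0" using s_pos X by (simp add: \<alpha>_def)
  define G where "G y = 4 * cosh X * (\<alpha> / (1 + (\<alpha> * y)\<^sup>2))" for y
  have up: "F y \<le> G y" if "y \<in> {-T/2..T/2}" for y
  proof -
    have "\<bar>y\<bar> \<le> T/2" using that by auto
    then have "\<bar>s * y\<bar> \<le> pi/2" using mult_left_mono[of "\<bar>y\<bar>" "T/2" s] s_pos sT by (simp add: abs_mult)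
    then have "(s * y)\<^sup>2 / 4 \<le> (sin (s * y))\<^sup>2" by (rule sin_sq_ge)
    then have "F y \<le> 2 * s * sinh X * cosh X / ((sinh X)\<^sup>2 + (s * y)\<^sup>2 / 4)"
      unfolding F_def using X s_pos by (intro divide_left_mono mult_pos_pos add_pos_nonneg) auto
    also have "\<dots> = G y"
    proof -
      define Q where "Q = (sinh X)\<^sup>2 + (s * y)\<^sup>2 / 4"
      have "1 + (\<alpha> * y)\<^sup>2 = Q / (sinh X)\<^sup>2"
        using X by (simp add: Q_def \<alpha>_def power2_eq_square field_simps)
      then have "G y = 4 * cosh X * (s / (2 * sinh X) / (Q / (sinh X)\<^sup>2))" by (simp add: G_def \<alpha>_def)
      also have "\<dots> = 2 * s * sinh X * cosh X / Q" using X(3) by (simp add: power2_eq_square)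
      finally show ?thesis by (simp add: Q_def)
    qed
    finally show ?thesis .
  qed
  have "(G has_integral 4 * cosh X * arctan (\<alpha> * (T/2)) - 4 * cosh X * arctan (\<alpha> * (-T/2))) {-T/2..T/2}"
  proof (rule fundamental_theorem_of_calculus)
    fix y
    have "((\<lambda>y. 4 * cosh X * arctan (\<alpha> * y)) has_real_derivative G y) (at y)"
      unfolding G_def by (auto intro!: derivative_eq_intros simp: divide_inverse mult_ac)
    then show "((\<lambda>y. 4 * cosh X * arctan (\<alpha> * y)) has_vector_derivative G y) (at y within {-T/2..T/2})"
      by (simp add: has_real_derivative_iff_has_vector_derivative has_vector_derivative_at_within)
  qed (use T_bounds in auto)
  then have "integral {-T/2..T/2} F \<le> 4 * cosh X * arctan (\<alpha> * (T/2)) - 4 * cosh X * arctan (\<alpha> * (-T/2))"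
    using int up by (intro has_integral_le[OF integrable_integral]) auto
  also have "\<dots> = 4 * cosh X * (2 * arctan (\<alpha> * T/2))" by (simp add: arctan_minus algebra_simps)
  also have "\<dots> \<le> 4 * 2 * (2 * (pi/2))"
    using cosh_sp arctan_ubound[of "\<alpha> * T/2"] \<alpha> T_bounds by (intro mult_mono) (auto simp: X_def)
  also have "\<dots> \<le> 26" using pi_approx by simp
  finally show "integral {-T/2..T/2} (\<lambda>y. Re (dpsi (Complex 0 y))) \<le> 26" unfolding Fe .
qed

end

text \<open>Turns an inequality between two potentials that agree on the axis into one between their
  fluxes through it.\<close>

lemma hgrad_Re_nonpos:
  assumes hg: "hgrad S V g" and z: "z \<in> S" and V0: "V z = 0" and r: "r > 0"
    and neg: "\<And>t. 0 < t \<Longrightarrow> t < r \<Longrightarrow> V (z + of_real t) \<le> 0"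
  shows "Re (g z) \<le> 0"
proof (rule ccontr)
  assume "\<not> Re (g z) \<le> 0"
  moreover have "((\<lambda>t. V (z + of_real t * 1)) has_real_derivative Re (g (z + of_real 0 * 1) * 1)) (at 0)"
    by (rule hgrad_line_deriv[OF hg]) (use z in auto)
  ultimately obtain d where d: "d > 0" "\<And>h. 0 < h \<Longrightarrow> h < d \<Longrightarrow> V (z + of_real 0 * 1) < V (z + of_real (0 + h) * 1)"
    using DERIV_pos_inc_right[of "\<lambda>t. V (z + of_real t * 1)" "Re (g z)" 0] by auto
  define m where "m = min d r / 2"
  have m: "0 < m" "m < d" "m < r" using d(1) r by (auto simp: m_def)
  have "V z < V (z + of_real m)" using d(2)[of m] m by simp
  then show False using neg[of m] m V0 by simp
qed

context cols
begin

text \<open>\<open>bnd\<close> selects the region: the strip \<open>0 < Re z < X\<close> if it is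
  true, the whole half-plane \<open>0 < Re z\<close> if it is false. Values on the edge are asked
  for in one period only.\<close>

lemma right_max_principle:
  fixes bnd :: bool
  assumes hV: "hgrad E V g" and per: "\<And>z. z \<in> E \<Longrightarrow> V (z + iT) = V z"
    and axis: "\<And>z. Re z = 0 \<Longrightarrow> V z \<le> M"
    and lim: "\<And>q. cmod (q - of_real c) = 1 \<Longrightarrow> (bnd \<longrightarrow> Re q \<le> X) \<Longrightarrow> \<exists>l\<le>M. (V \<longlongrightarrow> l) (at q within E)"
    and edge: "\<And>z. bnd \<Longrightarrow> z \<in> E \<Longrightarrow> Re z = X \<Longrightarrow> \<bar>Im z\<bar> \<le> T/2 \<Longrightarrow> V z \<le> M"
    and far: "\<And>z. z \<in> E \<Longrightarrow> X0 \<le> Re z \<Longrightarrow> (bnd \<longrightarrow> Re z < X) \<Longrightarrow> V z \<le> K0"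
    and z0: "z0 \<in> E" "0 < Re z0" "bnd \<longrightarrow> Re z0 < X"
  shows "V z0 \<le> M"
proof -
  define S where "S = E \<inter> ({z. 0 < Re z} \<inter> {z. bnd \<longrightarrow> Re z < X})"
  have op2: "open {z. bnd \<longrightarrow> Re z < X}" by (cases bnd) (auto intro: open_halfspace_Re_lt)
  have oS: "open S" unfolding S_def by (intro open_Int open_E op2 open_halfspace_Re_gt)
  have SE: "S \<subseteq> E" by (auto simp: S_def)
  show ?thesis
  proof (rule periodic_max_principle[where S = S and V = V and ?X0.0 = X0 and ?K0.0 = K0])
    show "hgrad S V g" by (rule hgrad_subset[OF hV oS SE])
    show "z0 \<in> S" using z0 by (simp add: S_def)
    show "z + iT \<in> S" "z - iT \<in> S" "V (z + iT) = V z" if "z \<in> S" for z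
      using that E_shift[of z] per[of z] by (auto simp: S_def)
    show "V z \<le> K0" if "z \<in> S" "X0 \<le> \<bar>Re z\<bar>" for z using far[of z] that by (auto simp: S_def)
    fix q \<eta> assume q: "\<bar>Im q\<bar> \<le> T/2" "q \<notin> S" and \<eta>: "\<eta> > (0::real)"
    consider "Re q < 0" | "bnd" "Re q > X" | "0 \<le> Re q" "bnd \<longrightarrow> Re q \<le> X" "q \<notin> E" | "q \<in> E" "Re q = 0" | "q \<in> E" "bnd" "Re q = X"
      using q(2) by (force simp: S_def)
    then show "eventually (\<lambda>z. V z < M + \<eta>) (at q within S)"
    proof cases
      case 1
      have "open {z. Re z < 0}" by (rule open_halfspace_Re_lt)
      then show ?thesis unfolding eventually_at_topological using 1
        by (intro exI[of _ "{z. Re z < 0}"]) (auto simp: S_def)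
    next
      case 2
      have "open {z. X < Re z}" by (rule open_halfspace_Re_gt)
      then show ?thesis unfolding eventually_at_topological using 2
        by (intro exI[of _ "{z. X < Re z}"]) (auto simp: S_def)
    next
      case 3
      show ?thesis
      proof (rule eventually_boundary[OF SE 3(3) q(1)])
        assume "cmod (q - of_real c) = 1"
        then obtain l where "l \<le> M" "(V \<longlongrightarrow> l) (at q within E)" using lim 3 by blast
        then show ?thesis using \<eta> SE
          by (intro tendsto_eventually_less[of V l]) (auto intro: tendsto_within_subset)
      next
        assume "cmod (q + of_real c) = 1"
        then have "Re q < 0" using abs_Re_le_cmod[of "q + of_real c"] c_bounds by auto
        then show ?thesis using 3 by simp
      qed
    next
      case 4
      then show ?thesis using hgrad_isCont[OF hV] axis \<eta> by (intro isCont_eventually_less) auto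
    next
      case 5
      then show ?thesis using hgrad_isCont[OF hV] edge q(1) \<eta> by (intro isCont_eventually_less) auto
    qed
  qed (use SE in auto)
qed

end

context sol
begin

definition k :: real where "k = (kR - kL) / 2"
definition k0 :: real where "k0 = (kR + kL) / 2"

lemma limR_n:
  assumes "cmod (q - Complex c (of_int n * T)) = 1"
  shows "(u \<longlongrightarrow> kR + of_int n * b * T) (at q within E)"
proof -
  have "((\<lambda>z. u (z + of_int (-n) * iT)) \<longlongrightarrow> kR) (at q within E)"
  proof (rule tendsto_at_within_compose_iso[where B = E])
    have "q + of_int (-n) * iT - of_real c = q - Complex c (of_int n * T)" by (simp add: complex_eq_iff)
    then show "(u \<longlongrightarrow> kR) (at (q + of_int (-n) * iT) within E)" using assms limR by metis
    show "isCont (\<lambda>z. z + of_int (-n) * iT) q" by (intro continuous_intros)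
    show "z + of_int (-n) * iT \<in> E" if "z \<in> E" for z using E_shift_int[OF that] .
  qed auto
  then have "((\<lambda>z. u (z + of_int (-n) * iT) + of_int n * b * T) \<longlongrightarrow> kR + of_int n * b * T) (at q within E)"
    by (intro tendsto_intros)
  moreover have "u (z + of_int (-n) * iT) + of_int n * b * T = u z" if "z \<in> E" for z
  proof -
    have "v (z + of_int (-n) * iT) = v z"
      by (rule periodic_int_shift(2)[where P = "\<lambda>z. z \<in> E"]) (use v_per E_shift that in auto)
    then show ?thesis by (simp add: v_def algebra_simps)
  qed
  then have "eventually (\<lambda>z. u (z + of_int (-n) * iT) + of_int n * b * T = u z) (at q within E)"
    by (auto simp: eventually_at_topological)
  ultimately show ?thesis by (rule Lim_transform_eventually)
qed

text \<open>On the circles \<open>v\<close> equals a boundary constant minus the linear part, with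
  \<open>\<bar>Re q\<bar> \<le> 3\<close> and \<open>\<bar>Im q\<bar> \<le> 1\<close>; the maximum
  principle carries the bound into \<open>E\<close>.\<close>

lemma v_estimate:
  assumes "z \<in> E"
  shows "\<bar>v z - k0\<bar> \<le> \<bar>k\<bar> + 3 * \<bar>a\<bar> + \<bar>b\<bar>"
proof -
  obtain X1 B where XB: "\<And>z. X1 < \<bar>Re z\<bar> \<Longrightarrow> \<bar>v z\<bar> \<le> B" using v_bounded by blast
  have bnd: "\<bar>kk - a * Re q - b * Im q - k0\<bar> \<le> \<bar>k\<bar> + 3 * \<bar>a\<bar> + \<bar>b\<bar>"
    if "kk = k0 + k \<or> kk = k0 - k" "\<bar>Re q\<bar> \<le> 3" "\<bar>Im q\<bar> \<le> 1" for kk q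
  proof -
    have "\<bar>a * Re q\<bar> \<le> \<bar>a\<bar> * 3" "\<bar>b * Im q\<bar> \<le> \<bar>b\<bar> * 1"
      unfolding abs_mult using that by (intro mult_left_mono; simp)+
    then show ?thesis using that(1) by (auto simp: abs_le_iff)
  qed
  have kk: "kR = k0 + k" "kL = k0 - k" by (auto simp: k_def k0_def field_simps)
  have "\<sigma> * (v z - k0) \<le> \<bar>k\<bar> + 3 * \<bar>a\<bar> + \<bar>b\<bar>" if \<sigma>: "\<sigma> = 1 \<or> \<sigma> = -1" for \<sigma> :: real
  proof (rule periodic_max_principle[where S = E and V = "\<lambda>z. \<sigma> * (v z - k0)" and ?X0.0 = "X1 + 1" and ?K0.0 = "B + \<bar>k0\<bar>"])
    show "hgrad E (\<lambda>z. \<sigma> * (v z - k0)) (\<lambda>z. of_real \<sigma> * (f z - Complex a (-b) - 0))"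
      by (intro hgrad_scale hgrad_diff hgrad_v hgrad_const open_E)
    show "\<sigma> * (v z - k0) \<le> B + \<bar>k0\<bar>" if "z \<in> E" "X1 + 1 \<le> \<bar>Re z\<bar>" for z
      using XB[of z] that \<sigma> by auto
    fix q \<eta> assume q: "\<bar>Im q\<bar> \<le> T/2" "q \<notin> E" and \<eta>: "\<eta> > (0::real)"
    have lim: "eventually (\<lambda>z. \<sigma> * (v z - k0) < \<bar>k\<bar> + 3 * \<bar>a\<bar> + \<bar>b\<bar> + \<eta>) (at q within E)"
      if u: "(u \<longlongrightarrow> kk) (at q within E)" and kk: "kk = k0 + k \<or> kk = k0 - k" and qq: "\<bar>Re q\<bar> \<le> 3" "\<bar>Im q\<bar> \<le> 1" for kk
    proof (rule tendsto_eventually_less[OF _ _ \<eta>])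
      show "((\<lambda>z. \<sigma> * (v z - k0)) \<longlongrightarrow> \<sigma> * (kk - a * Re q - b * Im q - k0)) (at q within E)"
        unfolding v_def by (intro tendsto_intros u)
      show "\<sigma> * (kk - a * Re q - b * Im q - k0) \<le> \<bar>k\<bar> + 3 * \<bar>a\<bar> + \<bar>b\<bar>"
        using bnd[OF kk qq] \<sigma> by auto
    qed
    show "eventually (\<lambda>z. \<sigma> * (v z - k0) < \<bar>k\<bar> + 3 * \<bar>a\<bar> + \<bar>b\<bar> + \<eta>) (at q within E)"
    proof (rule eventually_boundary[OF order_refl q(2,1)])
      assume "cmod (q - of_real c) = 1"
      then show "eventually (\<lambda>z. \<sigma> * (v z - k0) < \<bar>k\<bar> + 3 * \<bar>a\<bar> + \<bar>b\<bar> + \<eta>) (at q within E)"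
        using abs_Re_le_cmod[of "q - of_real c"] abs_Im_le_cmod[of "q - of_real c"] c_bounds kk
        by (intro lim[OF limR]) auto
    next
      assume "cmod (q + of_real c) = 1"
      then show "eventually (\<lambda>z. \<sigma> * (v z - k0) < \<bar>k\<bar> + 3 * \<bar>a\<bar> + \<bar>b\<bar> + \<eta>) (at q within E)"
        using abs_Re_le_cmod[of "q + of_real c"] abs_Im_le_cmod[of "q + of_real c"] c_bounds kk
        by (intro lim[OF limL]) auto
    qed
  qed (use E_shift v_per assms in auto)
  from this[of 1] this[of "-1"] show ?thesis by (auto simp: abs_le_iff)
qed

text \<open>The odd part is periodic, since the increments \<open>b * T\<close> cancel; it vanishes
  on the axis and has the same limit \<open>k\<close> on every circle of the right column.\<close>

definition uo :: "complex \<Rightarrow> real" where "uo z = 1/2 * (u z - u (- cnj z))"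
definition fo :: "complex \<Rightarrow> complex" where "fo z = of_real (1/2) * (f z - (- cnj (f (- cnj z))))"

lemma hgrad_uo: "hgrad E uo fo"
proof -
  interpret r: sol \<epsilon> \<delta> "-a" b kR kL "\<lambda>z. u (- cnj z)" "\<lambda>z. - cnj (f (- cnj z))" by (rule reflect)
  show ?thesis unfolding uo_def[abs_def] fo_def[abs_def] by (intro hgrad_scale hgrad_diff hg r.hg)
qed

lemma uo_per: "z \<in> E \<Longrightarrow> uo (z + iT) = uo z"
  using u_per[of z] u_per[OF E_reflect[of z]] by (simp add: uo_def)

lemma uo_lim: "cmod (q - Complex c (of_int n * T)) = 1 \<Longrightarrow> (uo \<longlongrightarrow> k) (at q within E)"
proof -
  assume q: "cmod (q - Complex c (of_int n * T)) = 1"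
  interpret r: sol \<epsilon> \<delta> "-a" b kR kL "\<lambda>z. u (- cnj z)" "\<lambda>z. - cnj (f (- cnj z))" by (rule reflect)
  have "(uo \<longlongrightarrow> 1/2 * ((kR + of_int n * b * T) - (kL + of_int n * b * T))) (at q within E)"
    unfolding uo_def by (intro tendsto_intros limR_n[OF q] r.limR_n[OF q])
  then show ?thesis by (simp add: k_def)
qed

lemma uo_axis: "Re z = 0 \<Longrightarrow> uo z = 0"
proof -
  assume "Re z = 0"
  then have "- cnj z = z" by (simp add: complex_eq_iff)
  then show ?thesis by (simp add: uo_def)
qed

lemma fo_axis: "Re z = 0 \<Longrightarrow> Re (fo z) = Re (f z)"
proof -
  assume "Re z = 0"
  then have "- cnj z = z" by (simp add: complex_eq_iff)
  then show ?thesis by (simp add: fo_def)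
qed

lemma uo_far: "\<exists>X1 B. \<forall>z. X1 < \<bar>Re z\<bar> \<longrightarrow> \<bar>uo z - a * Re z\<bar> \<le> B"
proof -
  obtain X1 B where XB: "\<And>z. X1 < \<bar>Re z\<bar> \<Longrightarrow> \<bar>v z\<bar> \<le> B" using v_bounded by blast
  have e: "uo z - a * Re z = (v z - v (- cnj z)) / 2" for z by (simp add: uo_def v_def field_simps)
  have "\<bar>uo z - a * Re z\<bar> \<le> B" if "X1 < \<bar>Re z\<bar>" for z
    using XB[of z] XB[of "- cnj z"] that unfolding e by simp
  then show ?thesis by blast
qed

end

text \<open>Outside the unit disk \<open>y\<close> is at least \<open>sqrt (1 - x\<^sup>2)\<close>,
  which is itself at least the polynomial on the left.\<close>

lemma gap_coordinate:
  fixes x y :: real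
  assumes "x\<^sup>2 + y\<^sup>2 \<ge> 1" "y \<ge> 0" "\<bar>x\<bar> \<le> 1"
  shows "1 - x\<^sup>2 \<le> y"
proof (rule ccontr)
  assume "\<not> ?thesis"
  then have "y < 1 - x\<^sup>2" by simp
  then have "y\<^sup>2 < (1 - x\<^sup>2)\<^sup>2" using assms(2) by (intro power_strict_mono) auto
  also have "\<dots> = (1 - x\<^sup>2) * (1 - x\<^sup>2)" by (simp add: power2_eq_square)
  also have "\<dots> \<le> (1 - x\<^sup>2) * 1"
    using assms(3) abs_square_le_1[of x] by (intro mult_left_mono) auto
  finally show False using assms(1) by simp
qed

context cols
begin

text \<open>The two disks leave only
  \<open>\<bar>y - T/2\<bar> \<le> \<delta>/2 + x\<^sup>2\<close>; for
  \<open>\<bar>x\<bar> \<le> 1/2\<close> the square of this bound is at most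
  \<open>\<delta> + x\<^sup>2/2\<close>.\<close>

lemma gap_barrier:
  fixes x y :: real
  assumes "\<bar>x\<bar> \<le> 1/2" "x\<^sup>2 + y\<^sup>2 \<ge> 1" "x\<^sup>2 + (y - T)\<^sup>2 \<ge> 1" "0 \<le> y" "y \<le> T"
  shows "x\<^sup>2/2 \<le> x\<^sup>2 - (y - T/2)\<^sup>2 + \<delta>"
proof -
  have 1: "1 - x\<^sup>2 \<le> y" using assms by (intro gap_coordinate) auto
  have 2: "1 - x\<^sup>2 \<le> T - y" using assms by (intro gap_coordinate) (auto simp: power2_commute)
  have x2: "x\<^sup>2 \<le> 1/4" using assms(1) abs_le_square_iff[of x "1/2"] by (simp add: power2_eq_square)
  have "\<bar>y - T/2\<bar> \<le> \<delta>/2 + x\<^sup>2" using 1 2 T_def by linarith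
  then have "(y - T/2)\<^sup>2 \<le> (\<delta>/2 + x\<^sup>2)\<^sup>2"
    using del by (subst abs_le_square_iff[symmetric]) auto
  also have "\<dots> = \<delta> * (\<delta>/4) + x\<^sup>2 * (\<delta> + x\<^sup>2)" by (simp add: power2_eq_square algebra_simps)
  also have "\<dots> \<le> \<delta> * 1 + x\<^sup>2 * (1/2)"
    using del x2 by (intro add_mono mult_left_mono) auto
  finally show ?thesis by simp
qed

end

context sol
begin

text \<open>For \<open>a \<ge> 0\<close>, subtracting \<open>a * Re z\<close> only lowers the
  boundary values \<open>k\<close> and makes the function bounded at infinity.\<close>

lemma uo_upper:
  assumes "a \<ge> 0" "z \<in> E" "0 < Re z"
  shows "uo z \<le> max k 0 + a * Re z"
proof -
  obtain X1 B where XB: "\<And>z. X1 < \<bar>Re z\<bar> \<Longrightarrow> \<bar>uo z - a * Re z\<bar> \<le> B" using uo_far by blast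
  have "uo z - a * Re z \<le> max k 0"
  proof (rule right_max_principle[where bnd = False and V = "\<lambda>z. uo z - a * Re z" and ?X0.0 = "\<bar>X1\<bar> + 1" and ?K0.0 = B])
    show "hgrad E (\<lambda>z. uo z - a * Re z) (\<lambda>z. fo z - of_real a * 1)"
      by (intro hgrad_diff hgrad_scale hgrad_Re hgrad_uo open_E)
    show "\<exists>l\<le>max k 0. ((\<lambda>z. uo z - a * Re z) \<longlongrightarrow> l) (at q within E)" if q: "cmod (q - of_real c) = 1" for q
    proof (intro exI[of _ "k - a * Re q"] conjI)
      have "(uo \<longlongrightarrow> k) (at q within E)"
        by (rule uo_lim[of _ 0]) (use q in \<open>simp add: complex_of_real_def\<close>)
      then show "((\<lambda>z. uo z - a * Re z) \<longlongrightarrow> k - a * Re q) (at q within E)" by (intro tendsto_intros)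
      have "a * Re q \<ge> 0" using circle_cmod_p(2)[OF q] c_bounds assms by simp
      then show "k - a * Re q \<le> max k 0" by simp
    qed
    show "uo z - a * Re z \<le> B" if "z \<in> E" "\<bar>X1\<bar> + 1 \<le> Re z" for z
    proof -
      have "X1 < \<bar>Re z\<bar>" using that by linarith
      then show ?thesis using XB[of z] by linarith
    qed
  qed (use uo_per uo_axis assms in auto)
  then show ?thesis by simp
qed

text \<open>Comparison with the barrier \<open>16 * a * \<psi>\<close> in the part of the gap with
  \<open>\<bar>Re z - c\<bar> < 1/2\<close>. On the vertical sides the barrier is at least
  \<open>2 * a\<close>, which outweighs the \<open>a * Re z\<close> of \<open>uo_upper\<close>; on
  the section \<open>Re z = c\<close> it is at most \<open>16 * a * \<delta>\<close>.\<close>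

lemma uo_gap:
  assumes a: "a \<ge> 0" and z: "z \<in> E" "Re z = c" "0 < Im z" "Im z < T"
  shows "uo z \<le> max k 0 + 16 * a * \<delta>"
proof -
  define m where "m = Complex c (T/2)"
  define \<psi> where "\<psi> w = (Re w - c)\<^sup>2 - (Im w - T/2)\<^sup>2 + \<delta>" for w
  define S where "S = E \<inter> ({z. \<bar>Re z - c\<bar> < 1/2} \<inter> ({z. 0 < Im z} \<inter> {z. Im z < T}))"
  have oS: "open S" unfolding S_def
    by (intro open_Int open_E open_Collect_less continuous_intros)
  have h\<psi>: "hgrad UNIV \<psi> (\<lambda>w. 2 * (w - m) + 0)"
  proof -
    have "hgrad UNIV (\<lambda>w. Re ((w - m)\<^sup>2) + \<delta>) (\<lambda>w. 2 * (w - m) + 0)"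
      by (intro hgrad_add hgrad_const hgrad_Re_primitive holomorphic_intros)
        (auto intro!: derivative_eq_intros)
    then show ?thesis by (simp add: \<psi>_def[abs_def] m_def power2_eq_square)
  qed
  have \<psi>pos: "(Re w - c)\<^sup>2/2 \<le> \<psi> w"
    if "\<bar>Re w - c\<bar> \<le> 1/2" "0 \<le> Im w" "Im w \<le> T" "1 \<le> cmod (w - Complex c 0)" "1 \<le> cmod (w - Complex c T)" for w
  proof -
    have "1 \<le> (cmod (w - Complex c 0))\<^sup>2" "1 \<le> (cmod (w - Complex c T))\<^sup>2" using that by auto
    then show ?thesis unfolding \<psi>_def cmod_power2 using that by (intro gap_barrier) auto
  qed
  have SE1: "1 < cmod (w - Complex c 0)" "1 < cmod (w - Complex c T)" if "w \<in> E" for w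
    using that unfolding E_iff by (auto dest: spec[of _ 0] spec[of _ 1])
  have "uo z - 16 * a * \<psi> z \<le> max k 0"
  proof (rule weak_max_principle[where S = S and V = "\<lambda>z. uo z - 16 * a * \<psi> z" and K = "cbox (Complex (c - 1/2) 0) (Complex (c + 1/2) T)"])
    show "hgrad S (\<lambda>z. uo z - 16 * a * \<psi> z) (\<lambda>z. fo z - of_real (16 * a) * (2 * (z - m) + 0))"
      by (intro hgrad_diff hgrad_scale hgrad_subset[OF hgrad_uo oS] hgrad_subset[OF h\<psi> oS]) (auto simp: S_def)
    show "z \<in> S" using z by (simp add: S_def)
    show "\<exists>z'\<in>S \<inter> cbox (Complex (c - 1/2) 0) (Complex (c + 1/2) T).
        uo z' - 16 * a * \<psi> z' = uo w - 16 * a * \<psi> w \<and> Re z' = Re w" if "w \<in> S" for w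
    proof -
      have "\<bar>Re w - c\<bar> < 1/2" using that by (simp add: S_def)
      then have "c - 1/2 \<le> Re w" "Re w \<le> c + 1/2" by linarith+
      then show ?thesis using that by (intro bexI[of _ w]) (auto simp: S_def in_cbox_complex_iff)
    qed
    fix q \<eta> assume q: "q \<in> cbox (Complex (c - 1/2) 0) (Complex (c + 1/2) T)" "q \<notin> S" and \<eta>: "\<eta> > (0::real)"
    have "c - 1/2 \<le> Re q" "Re q \<le> c + 1/2" and qb23: "0 \<le> Im q" "Im q \<le> T"
      using q by (auto simp: in_cbox_complex_iff)
    then have "\<bar>Re q - c\<bar> \<le> 1/2" by linarith
    note qb = this qb23
    show "eventually (\<lambda>z. uo z - 16 * a * \<psi> z < max k 0 + \<eta>) (at q within S)"
    proof (cases "\<bar>Re q - c\<bar> = 1/2")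
      case True
      have "(Re q - c)\<^sup>2 = (1/2)\<^sup>2" using True by (metis power2_abs)
      then have h: "(Re q - c)\<^sup>2 = 1/4" by (simp add: power2_eq_square)
      have "Re q \<le> 2" using qb(1) c_bounds by linarith
      then have "a * Re q \<le> a * 2" using a by (intro mult_left_mono) auto
      then have g: "max k 0 + a * Re q - 8 * a * (Re q - c)\<^sup>2 \<le> max k 0" unfolding h by linarith
      have "isCont (\<lambda>z. max k 0 + a * Re z - 8 * a * (Re z - c)\<^sup>2) q"
        by (intro continuous_intros linear_continuous_at bounded_linear_Re)
      from isCont_eventually_less[OF this g \<eta>]
      have "eventually (\<lambda>z. max k 0 + a * Re z - 8 * a * (Re z - c)\<^sup>2 < max k 0 + \<eta>) (at q within S)" .
      moreover have "eventually (\<lambda>z. z \<in> S) (at q within S)" by (simp add: eventually_at_topological) blast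
      ultimately show ?thesis
      proof eventually_elim
        case (elim w)
        have wE: "w \<in> E" "\<bar>Re w - c\<bar> < 1/2" "0 < Im w" "Im w < T" using elim by (auto simp: S_def)
        have "0 < Re w" using wE(2) c_bounds by linarith
        then have "uo w \<le> max k 0 + a * Re w" by (rule uo_upper[OF a wE(1)])
        moreover have "16 * a * ((Re w - c)\<^sup>2/2) \<le> 16 * a * \<psi> w"
          using \<psi>pos[of w] SE1[OF wE(1)] wE a by (intro mult_left_mono) auto
        ultimately show ?case using elim by simp
      qed
    next
      case False
      then have qb1: "\<bar>Re q - c\<bar> < 1/2" using qb by linarith
      have qE: "q \<notin> E"
      proof
        assume qE: "q \<in> E"
        then have "Im q = 0 \<or> Im q = T" using q(2) qb qb1 by (auto simp: S_def)
        then have "cmod (q - Complex c 0) = \<bar>Re q - c\<bar> \<or> cmod (q - Complex c T) = \<bar>Re q - c\<bar>"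
          by (auto simp: cmod_def)
        then show False using SE1[OF qE] qb1 by auto
      qed
      show ?thesis
      proof (rule eventually_boundary_all[OF _ qE])
        fix n :: int assume n: "cmod (q - Complex c (of_int n * T)) = 1"
        have *: "\<bar>Im q - of_int n * T\<bar> \<le> 1" using abs_Im_le_cmod[of "q - Complex c (of_int n * T)"] n by simp
        have n01: "n = 0 \<or> n = 1"
        proof (rule ccontr)
          assume "\<not> (n = 0 \<or> n = 1)"
          then have "of_int n \<le> (-1::real) \<or> of_int n \<ge> (2::real)" by linarith
          then have "of_int n * T \<le> -1 * T \<or> of_int n * T \<ge> 2 * T" using T_bounds
            mult_right_mono[of "of_int n" "-1" T] mult_right_mono[of 2 "of_int n" T] by linarith
          then show False using * qb T_bounds by linarith
        qed
        have other: "1 \<le> \<bar>Im q - of_int (1 - n) * T\<bar>"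
          using n01
        proof
          assume "n = 0" then show ?thesis using * qb T_bounds by simp
        next
          assume "n = 1" then show ?thesis using * qb T_bounds by simp
        qed
        then have "1 \<le> cmod (q - Complex c (of_int (1 - n) * T))"
          using abs_Im_le_cmod[of "q - Complex c (of_int (1 - n) * T)"] by simp
        then have "1 \<le> cmod (q - Complex c 0)" "1 \<le> cmod (q - Complex c T)" using n n01 by auto
        then have "(Re q - c)\<^sup>2/2 \<le> \<psi> q" by (rule \<psi>pos[OF qb])
        then have "0 \<le> 16 * a * \<psi> q" using a zero_le_power2[of "Re q - c"] by (intro mult_nonneg_nonneg) linarith+
        then have le: "k - 16 * a * \<psi> q \<le> max k 0" by linarith
        have "isCont \<psi> q" using hgrad_isCont[OF h\<psi>] by simp
        then have "(\<psi> \<longlongrightarrow> \<psi> q) (at q within S)"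
          using continuous_at_imp_continuous_at_within continuous_within by blast
        moreover have "(uo \<longlongrightarrow> k) (at q within S)"
          by (rule tendsto_within_subset[OF uo_lim[OF n]]) (auto simp: S_def)
        ultimately have "((\<lambda>z. uo z - 16 * a * \<psi> z) \<longlongrightarrow> k - 16 * a * \<psi> q) (at q within S)"
          by (intro tendsto_intros)
        then show ?thesis by (rule tendsto_eventually_less[OF _ le \<eta>])
      next
        fix n :: int assume "cmod (q - Complex (-c) (of_int n * T)) = 1"
        then have "\<bar>Re q + c\<bar> \<le> 1" using abs_Re_le_cmod[of "q - Complex (-c) (of_int n * T)"] by simp
        then have False using qb(1) c_bounds by linarith
        then show ?thesis ..
      qed (auto simp: S_def)
    qed
  qed simp
  moreover have "16 * a * \<psi> z \<le> 16 * a * \<delta>" using a z by (intro mult_left_mono) (auto simp: \<psi>_def)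
  ultimately show ?thesis by linarith
qed

lemma uo_section:
  assumes a: "a \<ge> 0" and z: "z \<in> E" "Re z = c" "\<bar>Im z\<bar> \<le> T/2"
  shows "uo z \<le> max k 0 + 16 * a * \<delta>"
proof -
  have "Im z \<noteq> 0"
  proof
    assume "Im z = 0"
    then have "z = of_real c" using z by (simp add: complex_eq_iff)
    then show False using z E_near_iff[of z] by simp
  qed
  then consider "0 < Im z" | "Im z < 0" by linarith
  then show ?thesis
  proof cases
    case 1
    then show ?thesis using z T_bounds by (intro uo_gap[OF a]) auto
  next
    case 2
    then have "uo (z + iT) \<le> max k 0 + 16 * a * \<delta>" using z T_bounds E_shift(1)[OF z(1)] by (intro uo_gap[OF a]) auto
    then show ?thesis using uo_per[OF z(1)] by simp
  qed
qed

text \<open>On the left half of the circle and on the section \<open>Re z = c\<close> the potential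
  \<open>\<kappa> * psi\<close> is at least \<open>max k 0\<close>, and the leak
  \<open>16 * a * \<delta>\<close> through the section is absorbed by \<open>a/2 * Re z\<close>. So
  \<open>uo \<le> \<kappa> * psi + a/2 * Re z\<close> in the strip, with equality on the axis;
  integrating the derivatives there gives \<open>a * T \<le> 26 * \<kappa> + a/2 * T\<close>. The
  constant is \<open>208 = 8 * 26\<close>.\<close>

lemma k_lower:
  assumes a: "a \<ge> 0"
  shows "a * p \<le> 208 * max k 0"
proof -
  define \<kappa> where "\<kappa> = 8 * max k 0 / p"
  have \<kappa>: "\<kappa> \<ge> 0" using p_bounds by (simp add: \<kappa>_def)
  have \<kappa>p: "max k 0 \<le> \<kappa> * t" if "p/8 \<le> t" for t
  proof -
    have "max k 0 = \<kappa> * (p/8)" using p_bounds by (simp add: \<kappa>_def)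
    also have "\<dots> \<le> \<kappa> * t" using \<kappa> that by (intro mult_left_mono)
    finally show ?thesis .
  qed
  define V where "V z = uo z - \<kappa> * psi z - a/2 * Re z" for z
  have hV: "hgrad E V (\<lambda>z. fo z - of_real \<kappa> * dpsi z - of_real (a/2) * 1)"
    unfolding V_def by (intro hgrad_diff hgrad_scale hgrad_Re hgrad_uo hgrad_psi open_E)
  have neg: "V z \<le> 0" if "z \<in> E" "0 < Re z" "Re z < c" for z
  proof (rule right_max_principle[OF hV, where bnd = True and X = c and ?X0.0 = c and ?K0.0 = 0])
    show "V (w + iT) = V w" if "w \<in> E" for w using uo_per[OF that] by (simp add: V_def psi_shift)
    show "\<exists>l\<le>0. (V \<longlongrightarrow> l) (at q within E)" if q: "cmod (q - of_real c) = 1" "True \<longrightarrow> Re q \<le> c" for q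
    proof (intro exI[of _ "k - \<kappa> * psi q - a/2 * Re q"] conjI)
      have "(uo \<longlongrightarrow> k) (at q within E)"
        by (rule uo_lim[of _ 0]) (use q in \<open>simp add: complex_of_real_def\<close>)
      moreover have "(psi \<longlongrightarrow> psi q) (at q within E)"
        using isCont_psi_circle[OF q(1)] continuous_at_imp_continuous_at_within continuous_within by blast
      ultimately show "(V \<longlongrightarrow> k - \<kappa> * psi q - a/2 * Re q) (at q within E)" unfolding V_def by (intro tendsto_intros)
      have "a * Re q \<ge> 0" using circle_cmod_p(2)[OF q(1)] c_bounds assms by simp
      moreover have "max k 0 \<le> \<kappa> * psi q" using q by (intro \<kappa>p psi_lower_circle) auto
      ultimately show "k - \<kappa> * psi q - a/2 * Re q \<le> 0" by simp
    qed
    show "V w \<le> 0" if "w \<in> E" "Re w = c" "\<bar>Im w\<bar> \<le> T/2" for w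
    proof -
      have "uo w \<le> max k 0 + 16 * a * \<delta>" by (rule uo_section[OF a that])
      moreover have "max k 0 \<le> \<kappa> * psi w" using that by (intro \<kappa>p psi_lower_section) auto
      moreover have "16 * a * \<delta> \<le> a/2 * Re w"
      proof -
        have "a * (16 * \<delta>) \<le> a * (1/2 * c)" using a del c_bounds by (intro mult_left_mono) auto
        then show ?thesis using that by simp
      qed
      ultimately show ?thesis unfolding V_def by linarith
    qed
  qed (use that uo_axis psi_zero in \<open>auto simp: V_def\<close>)
  have pt: "Re (f (Complex 0 y)) \<le> \<kappa> * Re (dpsi (Complex 0 y)) + a/2" for y
  proof -
    have "Re (fo (Complex 0 y) - of_real \<kappa> * dpsi (Complex 0 y) - of_real (a/2) * 1) \<le> 0"
    proof (rule hgrad_Re_nonpos[OF hV, where r = "c - 1"])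
      show "Complex 0 y \<in> E" by (rule E_imag_axis) simp
      show "V (Complex 0 y) = 0" by (simp add: V_def uo_axis psi_zero)
      show "c - 1 > 0" using c_bounds by simp
      show "V (Complex 0 y + of_real t) \<le> 0" if t: "0 < t" "t < c - 1" for t
      proof (rule neg)
        show "Complex 0 y + of_real t \<in> E" by (rule E_near_axis) (use t in simp)
      qed (use t in auto)
    qed
    then show ?thesis using fo_axis[of "Complex 0 y"] by simp
  qed
  have c: "((\<lambda>y. a/2) has_integral (a/2 * T)) {-T/2..T/2}"
    using has_integral_const_real[of "a/2" "-T/2" "T/2"] T_bounds by (simp add: mult.commute)
  have "((\<lambda>y. \<kappa> * Re (dpsi (Complex 0 y)) + a/2) has_integral (\<kappa> * integral {-T/2..T/2} (\<lambda>y. Re (dpsi (Complex 0 y))) + a/2 * T)) {-T/2..T/2}"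
    by (intro has_integral_add has_integral_mult_right integrable_integral dpsi_integral c)
  from has_integral_le[OF flux0 this]
  have "a * T \<le> \<kappa> * integral {-T/2..T/2} (\<lambda>y. Re (dpsi (Complex 0 y))) + a/2 * T" using pt by auto
  moreover have "\<kappa> * integral {-T/2..T/2} (\<lambda>y. Re (dpsi (Complex 0 y))) \<le> \<kappa> * 26"
    using dpsi_integral(3) \<kappa> by (intro mult_left_mono)
  moreover have "a * 2 \<le> a * T" using a T_bounds by (intro mult_left_mono) auto
  ultimately have "a \<le> \<kappa> * 26" by linarith
  then have "a * p \<le> \<kappa> * 26 * p" using p_bounds by (intro mult_right_mono) auto
  then show ?thesis using p_bounds by (simp add: \<kappa>_def)
qed

text \<open>Now \<open>\<kappa> * psi\<close> is at most \<open>k\<close> on the whole circle and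
  \<open>uo\<close> is bounded below far away, so \<open>\<kappa> * psi \<le> uo\<close> holds in
  the entire half-plane and the gaps cause no difficulty. The factor 3 is 12/5 divided by 4/5, the
  bounds of \<open>T\<close> and of the flux of \<open>psi\<close>.\<close>

lemma k_upper:
  assumes a: "a \<ge> 0" and k: "k \<ge> 0"
  shows "k \<le> 3 * C1 * a * p"
proof -
  define \<kappa> where "\<kappa> = k / (C1 * p)"
  have \<kappa>: "\<kappa> \<ge> 0" using p_bounds C1_pos k by (simp add: \<kappa>_def)
  obtain X1 B where XB: "\<And>z. X1 < \<bar>Re z\<bar> \<Longrightarrow> \<bar>uo z - a * Re z\<bar> \<le> B" using uo_far by blast
  define V where "V z = \<kappa> * psi z - uo z" for z
  have hV: "hgrad E V (\<lambda>z. of_real \<kappa> * dpsi z - fo z)"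
    unfolding V_def by (intro hgrad_diff hgrad_scale hgrad_uo hgrad_psi)
  have neg: "V z \<le> 0" if "z \<in> E" "0 < Re z" for z
  proof (rule right_max_principle[OF hV, where bnd = False and ?X0.0 = "\<bar>X1\<bar> + 3" and ?K0.0 = "\<kappa> * (1 + ln 4) + B"])
    show "V (w + iT) = V w" if "w \<in> E" for w using uo_per[OF that] by (simp add: V_def psi_shift)
    show "\<exists>l\<le>0. (V \<longlongrightarrow> l) (at q within E)" if q: "cmod (q - of_real c) = 1" for q
    proof (intro exI[of _ "\<kappa> * psi q - k"] conjI)
      have "(uo \<longlongrightarrow> k) (at q within E)"
        by (rule uo_lim[of _ 0]) (use q in \<open>simp add: complex_of_real_def\<close>)
      moreover have "(psi \<longlongrightarrow> psi q) (at q within E)"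
        using isCont_psi_circle[OF q(1)] continuous_at_imp_continuous_at_within continuous_within by blast
      ultimately show "(V \<longlongrightarrow> \<kappa> * psi q - k) (at q within E)" unfolding V_def by (intro tendsto_intros)
      have "\<kappa> * psi q \<le> \<kappa> * (C1 * p)" using \<kappa> psi_upper_circle[OF q] by (intro mult_left_mono)
      then show "\<kappa> * psi q - k \<le> 0" using C1_pos p_bounds by (simp add: \<kappa>_def)
    qed
    show "V w \<le> \<kappa> * (1 + ln 4) + B" if "w \<in> E" "\<bar>X1\<bar> + 3 \<le> Re w" for w
    proof -
      have "\<kappa> * psi w \<le> \<kappa> * (1 + ln 4)" using \<kappa> psi_far[of w] that by (intro mult_left_mono) auto
      moreover have "X1 < \<bar>Re w\<bar>" using that by linarith
      then have "- B \<le> uo w - a * Re w" using XB[of w] by linarith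
      moreover have "0 \<le> a * Re w" using a that by (intro mult_nonneg_nonneg) auto
      ultimately show ?thesis by (simp add: V_def)
    qed
  qed (use that uo_axis psi_zero in \<open>auto simp: V_def\<close>)
  have pt: "\<kappa> * Re (dpsi (Complex 0 y)) \<le> Re (f (Complex 0 y))" for y
  proof -
    have "Re (of_real \<kappa> * dpsi (Complex 0 y) - fo (Complex 0 y)) \<le> 0"
    proof (rule hgrad_Re_nonpos[OF hV, where r = "c - 1"])
      show "Complex 0 y \<in> E" by (rule E_imag_axis) simp
      show "V (Complex 0 y) = 0" by (simp add: V_def uo_axis psi_zero)
      show "c - 1 > 0" using c_bounds by simp
      show "V (Complex 0 y + of_real t) \<le> 0" if t: "0 < t" "t < c - 1" for t
      proof (rule neg)
        show "Complex 0 y + of_real t \<in> E" by (rule E_near_axis) (use t in simp)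
      qed (use t in auto)
    qed
    then show ?thesis using fo_axis[of "Complex 0 y"] by simp
  qed
  have "((\<lambda>y. \<kappa> * Re (dpsi (Complex 0 y))) has_integral (\<kappa> * integral {-T/2..T/2} (\<lambda>y. Re (dpsi (Complex 0 y))))) {-T/2..T/2}"
    by (intro has_integral_mult_right integrable_integral dpsi_integral)
  from has_integral_le[OF this flux0]
  have "\<kappa> * integral {-T/2..T/2} (\<lambda>y. Re (dpsi (Complex 0 y))) \<le> a * T" using pt by auto
  moreover have "\<kappa> * (4/5) \<le> \<kappa> * integral {-T/2..T/2} (\<lambda>y. Re (dpsi (Complex 0 y)))"
    using dpsi_integral(2) \<kappa> by (intro mult_left_mono)
  moreover have "a * T \<le> a * (12/5)" using a T_bounds by (intro mult_left_mono) auto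
  ultimately have "\<kappa> \<le> 3 * a" by linarith
  then have "k \<le> 3 * a * (C1 * p)" using C1_pos p_bounds by (simp add: \<kappa>_def field_simps)
  then show ?thesis by (simp add: mult_ac)
qed

text \<open>The sign comes from the lower bound, which forces \<open>k > 0\<close> for
  \<open>a > 0\<close>. The case \<open>a < 0\<close> is the reflected one, and for
  \<open>a = 0\<close> the upper bounds of both give \<open>k = 0\<close>.\<close>

lemma k_bounds:
  shows "\<bar>a\<bar> * p \<le> 208 * \<bar>k\<bar>" "\<bar>k\<bar> \<le> 3 * C1 * \<bar>a\<bar> * p" "0 \<le> a * k"
proof -
  interpret r: sol \<epsilon> \<delta> "-a" b kR kL "\<lambda>z. u (- cnj z)" "\<lambda>z. - cnj (f (- cnj z))" by (rule reflect)
  have rk: "r.k = - k" by (simp add: k_def r.k_def field_simps)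
  have "\<bar>a\<bar> * p \<le> 208 * \<bar>k\<bar> \<and> \<bar>k\<bar> \<le> 3 * C1 * \<bar>a\<bar> * p \<and> 0 \<le> a * k"
  proof (cases a "0::real" rule: linorder_cases)
    case greater
    then have "0 < a * p" using p_bounds by simp
    then have "k > 0" using k_lower greater by (auto simp: max_def split: if_splits)
    then show ?thesis using k_lower k_upper greater by auto
  next
    case less
    then have "0 < - a * p" using p_bounds by (simp add: mult_neg_pos)
    then have "- k > 0" using r.k_lower less rk by (auto simp: max_def split: if_splits)
    then show ?thesis using r.k_lower r.k_upper less rk by (auto simp: mult_nonpos_nonpos)
  next
    case equal
    have "k = 0" using k_upper r.k_upper equal rk by (cases "k \<ge> 0") auto
    then show ?thesis using equal by simp
  qed
  then show "\<bar>a\<bar> * p \<le> 208 * \<bar>k\<bar>" "\<bar>k\<bar> \<le> 3 * C1 * \<bar>a\<bar> * p" "0 \<le> a * k" by auto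
qed

end

section \<open>Bipolar potentials and the gradient in the gaps\<close>

text \<open>Bipolar coordinates of two unit disks with centres \<open>0\<close> and \<open>- 2 x\<close>: the poles \<open>- x \<plusminus> bp x\<close> are the limit
  points of the pencil spanned by the two circles, so \<open>th x\<close> is harmonic off them, \<open>0\<close> on the first circle
  and \<open>- 2 * bL x\<close> on the second.\<close>

definition bp :: "real \<Rightarrow> real" where "bp x = sqrt (x\<^sup>2 - 1)"
definition bL :: "real \<Rightarrow> real" where "bL x = ln (x + bp x)"

definition th :: "real \<Rightarrow> complex \<Rightarrow> real" where
  "th x \<zeta> = ln (cmod (\<zeta> + of_real (x + bp x))) - ln (cmod (\<zeta> + of_real (x - bp x))) - bL x"

definition dth :: "real \<Rightarrow> complex \<Rightarrow> complex" where
  "dth x \<zeta> = 1 / (\<zeta> + of_real (x + bp x)) - 1 / (\<zeta> + of_real (x - bp x))"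

context
  fixes x :: real
  assumes x: "1 < x"
begin

lemma bp_sq: "(bp x)\<^sup>2 = x\<^sup>2 - 1"
  using x by (simp add: bp_def)

lemma bp_pos: "0 < bp x"
  using x by (simp add: bp_def)

lemma bp_prod: "(x - bp x) * (x + bp x) = 1"
  using bp_sq by (simp add: power2_eq_square algebra_simps)

lemma bp_minus: "0 < x - bp x" "x - bp x < 1"
proof -
  have s: "0 < x + bp x" "1 < x + bp x" using x bp_pos by auto
  then show "0 < x - bp x" using bp_prod by (metis zero_less_mult_pos2 zero_less_one)
  then have "(x - bp x) * 1 < (x - bp x) * (x + bp x)" using s by (intro mult_strict_left_mono) auto
  then show "x - bp x < 1" by (simp add: bp_prod)
qed

text \<open>\<open>bL x\<close> is the inverse hyperbolic cosine of \<open>x\<close>, and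
  \<open>bp x\<close> is its hyperbolic sine; the bounds are
  \<open>y \<le> sinh y \<le> y * cosh y\<close>.\<close>

lemma bL_bounds: "bp x \<le> bL x * x" "bL x \<le> bp x" "0 < bL x"
proof -
  have s: "1 < x + bp x" using x bp_pos by auto
  then show "0 < bL x" by (simp add: bL_def)
  have e: "exp (bL x) = x + bp x" using s by (simp add: bL_def)
  have "exp (- bL x) = 1 / (x + bp x)" by (simp add: exp_minus e divide_inverse)
  also have "\<dots> = x - bp x" using bp_prod s by (simp add: field_simps)
  finally have e': "exp (- bL x) = x - bp x" .
  have "sinh (bL x) = bp x" "cosh (bL x) = x" by (simp_all add: sinh_field_def cosh_field_def e e')
  then show "bp x \<le> bL x * x" "bL x \<le> bp x"
    using sinh_le_mult_cosh[of "bL x"] sinh_ge_self[of "bL x"] \<open>0 < bL x\<close> by auto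
qed

text \<open>Both \<open>x + bp x\<close> and \<open>x - bp x\<close> solve
  \<open>y\<^sup>2 = 2 * x * y - 1\<close>, which removes the square of \<open>y\<close>.\<close>

lemma cmod_plus_pole:
  assumes "y = x + bp x \<or> y = x - bp x"
  shows "(cmod (\<zeta> + of_real y))\<^sup>2 = (cmod \<zeta>)\<^sup>2 - 1 + 2 * (Re \<zeta> + x) * y"
proof -
  have "y * y = 2 * x * y - 1"
    using assms
  proof
    assume y: "y = x + bp x"
    show ?thesis unfolding y using bp_sq by (simp add: power2_eq_square algebra_simps)
  next
    assume y: "y = x - bp x"
    show ?thesis unfolding y using bp_sq by (simp add: power2_eq_square algebra_simps)
  qed
  then show ?thesis unfolding cmod_power2 by (simp add: power2_eq_square algebra_simps)
qed

lemma pole_nonzero: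
  assumes "1 \<le> cmod \<zeta>" "1 \<le> cmod (\<zeta> + of_real (2 * x))"
  shows "0 < cmod (\<zeta> + of_real (x + bp x))" "0 < cmod (\<zeta> + of_real (x - bp x))"
proof -
  show "0 < cmod (\<zeta> + of_real (x - bp x))"
  proof (rule ccontr)
    assume "\<not> ?thesis"
    then have "\<zeta> = of_real (- (x - bp x))" by (simp add: add_eq_0_iff2)
    then have "cmod \<zeta> = \<bar>- (x - bp x)\<bar>" by (metis norm_of_real)
    then show False using assms bp_minus by simp
  qed
  show "0 < cmod (\<zeta> + of_real (x + bp x))"
  proof (rule ccontr)
    assume "\<not> ?thesis"
    then have "\<zeta> = of_real (- (x + bp x))" by (simp add: add_eq_0_iff2)
    then have "\<zeta> + of_real (2 * x) = of_real (x - bp x)" by simp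
    then have "cmod (\<zeta> + of_real (2 * x)) = \<bar>x - bp x\<bar>" by (metis norm_of_real)
    then show False using assms bp_minus by simp
  qed
qed

text \<open>The factor \<open>(cmod \<zeta>)\<^sup>2 - 1\<close> decides three things about
  \<open>th\<close>: its zeros on the unit circle, its sign outside, and its size near the
  circle.\<close>

lemma pole_identity:
  "((x + bp x) * cmod (\<zeta> + of_real (x - bp x)))\<^sup>2 - (cmod (\<zeta> + of_real (x + bp x)))\<^sup>2
    = 2 * bp x * (x + bp x) * ((cmod \<zeta>)\<^sup>2 - 1)"
proof -
  have 1: "(x + bp x)\<^sup>2 * (x - bp x) = x + bp x"
    using bp_prod by (simp add: power2_eq_square mult.assoc mult.commute[of "x - bp x"])
  have 2: "(x + bp x)\<^sup>2 = 1 + 2 * bp x * (x + bp x)"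
    using bp_sq by (simp add: power2_eq_square algebra_simps)
  have "((x + bp x) * cmod (\<zeta> + of_real (x - bp x)))\<^sup>2 = (x + bp x)\<^sup>2 * ((cmod \<zeta>)\<^sup>2 - 1) + 2 * (Re \<zeta> + x) * ((x + bp x)\<^sup>2 * (x - bp x))"
    unfolding power_mult_distrib by (subst cmod_plus_pole) (auto simp: algebra_simps)
  also have "\<dots> = (x + bp x)\<^sup>2 * ((cmod \<zeta>)\<^sup>2 - 1) + 2 * (Re \<zeta> + x) * (x + bp x)" unfolding 1 ..
  finally have A: "((x + bp x) * cmod (\<zeta> + of_real (x - bp x)))\<^sup>2 = (x + bp x)\<^sup>2 * ((cmod \<zeta>)\<^sup>2 - 1) + 2 * (Re \<zeta> + x) * (x + bp x)" .
  have B: "(cmod (\<zeta> + of_real (x + bp x)))\<^sup>2 = (cmod \<zeta>)\<^sup>2 - 1 + 2 * (Re \<zeta> + x) * (x + bp x)"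
    by (rule cmod_plus_pole) simp
  have "((x + bp x) * cmod (\<zeta> + of_real (x - bp x)))\<^sup>2 - (cmod (\<zeta> + of_real (x + bp x)))\<^sup>2 = ((x + bp x)\<^sup>2 - 1) * ((cmod \<zeta>)\<^sup>2 - 1)"
    unfolding A B by (simp add: algebra_simps)
  then show ?thesis unfolding 2 by simp
qed

lemma th_eq_ln:
  assumes "1 \<le> cmod \<zeta>" "1 \<le> cmod (\<zeta> + of_real (2 * x))"
  shows "th x \<zeta> = - ln ((x + bp x) * cmod (\<zeta> + of_real (x - bp x)) / cmod (\<zeta> + of_real (x + bp x)))"
proof -
  have "0 < x + bp x" using x bp_pos by simp
  then show ?thesis using pole_nonzero[OF assms]
    by (simp add: th_def bL_def ln_div ln_mult_pos del: of_real_add of_real_diff)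
qed

lemma th_nonpos:
  assumes "1 \<le> cmod \<zeta>" "1 \<le> cmod (\<zeta> + of_real (2 * x))"
  shows "th x \<zeta> \<le> 0"
proof -
  have "0 \<le> 2 * bp x * (x + bp x) * ((cmod \<zeta>)\<^sup>2 - 1)" using assms x bp_pos by (intro mult_nonneg_nonneg) auto
  then have "(cmod (\<zeta> + of_real (x + bp x)))\<^sup>2 \<le> ((x + bp x) * cmod (\<zeta> + of_real (x - bp x)))\<^sup>2"
    using pole_identity[of \<zeta>] by linarith
  then have "cmod (\<zeta> + of_real (x + bp x)) \<le> (x + bp x) * cmod (\<zeta> + of_real (x - bp x))"
    using x bp_pos by (elim power2_le_imp_le) simp
  then have "1 \<le> (x + bp x) * cmod (\<zeta> + of_real (x - bp x)) / cmod (\<zeta> + of_real (x + bp x))"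
    using pole_nonzero[OF assms] by (simp add: field_simps del: of_real_add of_real_diff)
  then show ?thesis unfolding th_eq_ln[OF assms] by simp
qed

text \<open>Away from the pole in the other disk \<open>th\<close> is of order \<open>bp x\<close>
  times the distance to the unit circle: \<open>ln y \<le> (y\<^sup>2 - 1) / 2\<close>, and
  \<open>pole_identity\<close> evaluates the right-hand side.\<close>

lemma th_small:
  assumes "1 \<le> cmod \<zeta>" "1 \<le> cmod (\<zeta> + of_real (2 * x))" "1 \<le> cmod (\<zeta> + of_real (x + bp x))"
  shows "\<bar>th x \<zeta>\<bar> \<le> bp x * (x + bp x) * ((cmod \<zeta>)\<^sup>2 - 1)"
proof -
  define A where "A = cmod (\<zeta> + of_real (x + bp x))"
  define B where "B = cmod (\<zeta> + of_real (x - bp x))"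
  define y where "y = (x + bp x) * B / A"
  have AB: "A > 0" "B > 0" "1 \<le> A" using pole_nonzero[OF assms(1,2)] assms(3) by (auto simp: A_def B_def simp del: of_real_add of_real_diff)
  have xb: "x + bp x > 0" using x bp_pos by simp
  have y: "y > 0" using AB xb by (simp add: y_def)
  have id: "((x + bp x) * B)\<^sup>2 - A\<^sup>2 = 2 * bp x * (x + bp x) * ((cmod \<zeta>)\<^sup>2 - 1)"
    unfolding A_def B_def by (rule pole_identity)
  have R: "0 \<le> 2 * bp x * (x + bp x) * ((cmod \<zeta>)\<^sup>2 - 1)"
    using assms(1) xb bp_pos by (intro mult_nonneg_nonneg) auto
  have "\<bar>th x \<zeta>\<bar> = ln y" using th_nonpos[OF assms(1,2)] unfolding th_eq_ln[OF assms(1,2)] A_def[symmetric] B_def[symmetric] y_def by simp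
  also have "\<dots> = ln (y\<^sup>2) / 2" using y by (simp add: ln_realpow)
  also have "\<dots> \<le> (y\<^sup>2 - 1) / 2" using ln_le_minus_one[of "y\<^sup>2"] y by simp
  also have "y\<^sup>2 - 1 = (2 * bp x * (x + bp x) * ((cmod \<zeta>)\<^sup>2 - 1)) / A\<^sup>2"
    unfolding id[symmetric] y_def using AB by (simp add: power_divide diff_divide_distrib)
  also have "\<dots> / 2 \<le> (2 * bp x * (x + bp x) * ((cmod \<zeta>)\<^sup>2 - 1)) / 2"
  proof -
    have "1 \<le> A\<^sup>2" using AB by simp
    then have "(2 * bp x * (x + bp x) * ((cmod \<zeta>)\<^sup>2 - 1)) / A\<^sup>2 \<le> (2 * bp x * (x + bp x) * ((cmod \<zeta>)\<^sup>2 - 1)) / 1"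
      using R by (intro divide_left_mono) auto
    then show ?thesis by simp
  qed
  finally show ?thesis by simp
qed

lemma th_circle:
  assumes "cmod \<zeta> = 1" "1 \<le> cmod (\<zeta> + of_real (2 * x))"
  shows "th x \<zeta> = 0"
proof -
  have "((x + bp x) * cmod (\<zeta> + of_real (x - bp x)))\<^sup>2 = (cmod (\<zeta> + of_real (x + bp x)))\<^sup>2"
    using pole_identity[of \<zeta>] assms by simp
  then have "(x + bp x) * cmod (\<zeta> + of_real (x - bp x)) = cmod (\<zeta> + of_real (x + bp x))"
    using x bp_pos by (elim power2_eq_imp_eq) auto
  then show ?thesis using th_eq_ln[of \<zeta>] assms pole_nonzero[of \<zeta>] by (simp del: of_real_add of_real_diff)
qed

text \<open>The point reflection that exchanges the two disks; it transfers the estimates at the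
  first circle to the second.\<close>

lemma th_opposite: "th x (- of_real (2 * x) - \<zeta>) = - 2 * bL x - th x \<zeta>"
proof -
  have "cmod (- of_real (2 * x) - \<zeta> + of_real (x + bp x)) = cmod (\<zeta> + of_real (x - bp x))"
    "cmod (- of_real (2 * x) - \<zeta> + of_real (x - bp x)) = cmod (\<zeta> + of_real (x + bp x))"
    by (subst norm_minus_cancel[symmetric], simp add: algebra_simps)+
  then show ?thesis by (simp add: th_def)
qed

lemma th_opposite_cond:
  "cmod (- of_real (2 * x) - \<zeta>) = cmod (\<zeta> + of_real (2 * x))" "cmod (- of_real (2 * x) - \<zeta> + of_real (2 * x)) = cmod \<zeta>"
  by (subst norm_minus_cancel[symmetric], simp)+

lemma th_lower:
  assumes "1 \<le> cmod \<zeta>" "1 \<le> cmod (\<zeta> + of_real (2 * x))"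
  shows "- 2 * bL x \<le> th x \<zeta>"
  using th_nonpos[of "- of_real (2 * x) - \<zeta>"] assms unfolding th_opposite th_opposite_cond by linarith

lemma th_other_circle:
  assumes "1 \<le> cmod \<zeta>" "cmod (\<zeta> + of_real (2 * x)) = 1"
  shows "th x \<zeta> = - 2 * bL x"
  using th_circle[of "- of_real (2 * x) - \<zeta>"] assms unfolding th_opposite th_opposite_cond by linarith

text \<open>The factor \<open>\<mu>\<close> turns the pair of disks: with 1 the second disk is on
  the left, with \<i> above, with -\<i> below.\<close>

lemma hgrad_th:
  assumes "open S" and S: "\<And>z. z \<in> S \<Longrightarrow> 1 \<le> cmod (\<mu> * (z - z1)) \<and> 1 \<le> cmod (\<mu> * (z - z1) + of_real (2 * x))"
  shows "hgrad S (\<lambda>z. th x (\<mu> * (z - z1))) (\<lambda>z. \<mu> * dth x (\<mu> * (z - z1)))"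
proof -
  have "hgrad S (\<lambda>z. th x (\<mu> * (z - z1)))
    (\<lambda>z. \<mu> / (\<mu> * (z - z1) + of_real (x + bp x)) - \<mu> / (\<mu> * (z - z1) + of_real (x - bp x)) - 0)"
    unfolding th_def
  proof (intro hgrad_diff hgrad_const assms(1) hgrad_ln_cmod)
    fix z assume z: "z \<in> S"
    show "((\<lambda>z. \<mu> * (z - z1) + of_real (x + bp x)) has_field_derivative \<mu>) (at z)"
      "((\<lambda>z. \<mu> * (z - z1) + of_real (x - bp x)) has_field_derivative \<mu>) (at z)"
      by (auto intro!: derivative_eq_intros)
    show "\<mu> * (z - z1) + of_real (x + bp x) \<noteq> 0" "\<mu> * (z - z1) + of_real (x - bp x) \<noteq> 0"
      using pole_nonzero[of "\<mu> * (z - z1)"] S[OF z] by auto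
  qed
  moreover have "(\<lambda>z. \<mu> / (\<mu> * (z - z1) + of_real (x + bp x)) - \<mu> / (\<mu> * (z - z1) + of_real (x - bp x)) - 0) = (\<lambda>z. \<mu> * dth x (\<mu> * (z - z1)))"
    by (simp add: dth_def fun_eq_iff right_diff_distrib)
  ultimately show ?thesis by simp
qed

lemma isCont_th:
  assumes "1 \<le> cmod \<zeta>" "1 \<le> cmod (\<zeta> + of_real (2 * x))"
  shows "isCont (th x) \<zeta>"
  unfolding th_def[abs_def] using pole_nonzero[OF assms] by (intro continuous_intros) auto

lemma dth_eq:
  assumes "\<zeta> + of_real x \<noteq> of_real (bp x)" "\<zeta> + of_real x \<noteq> - of_real (bp x)"
  shows "dth x \<zeta> = - of_real (2 * bp x) / ((\<zeta> + of_real x)\<^sup>2 - of_real ((bp x)\<^sup>2))"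
proof -
  define w where "w = \<zeta> + of_real x"
  have "dth x \<zeta> = 1 / (w + of_real (bp x)) - 1 / (w - of_real (bp x))" by (simp add: dth_def w_def algebra_simps)
  moreover have "w + of_real (bp x) \<noteq> 0" "w - of_real (bp x) \<noteq> 0" using assms by (auto simp: w_def add_eq_0_iff2)
  moreover have "w\<^sup>2 - of_real ((bp x)\<^sup>2) = (w + of_real (bp x)) * (w - of_real (bp x))"
    by (simp add: power2_eq_square algebra_simps)
  ultimately show ?thesis by (simp add: diff_frac_eq w_def[symmetric])
qed

end

lemma ln_radius:
  assumes "1 \<le> r" "r \<le> 3/2"
  shows "r\<^sup>2 - 1 \<le> 5 * ln (r::real)"
proof -
  have r2: "1 \<le> r\<^sup>2" using assms(1) by simp
  have "r\<^sup>2 \<le> (3/2)\<^sup>2" using assms by (intro power_mono) auto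
  then have r3: "r\<^sup>2 \<le> 5/2" by (simp add: power2_eq_square)
  have "ln (1 / r\<^sup>2) \<le> 1 / r\<^sup>2 - 1" using assms by (intro ln_le_minus_one) simp
  moreover have "ln (1 / r\<^sup>2) = - 2 * ln r" using assms by (simp add: ln_div ln_realpow)
  ultimately have "1 - 1 / r\<^sup>2 \<le> 2 * ln r" by linarith
  then have "r\<^sup>2 * (1 - 1 / r\<^sup>2) \<le> r\<^sup>2 * (2 * ln r)" by (intro mult_left_mono) auto
  moreover have "r\<^sup>2 * (1 - 1 / r\<^sup>2) = r\<^sup>2 - 1" using assms by (simp add: right_diff_distrib)
  moreover have "r\<^sup>2 * (2 * ln r) \<le> 5/2 * (2 * ln r)" using r3 assms by (intro mult_right_mono) auto
  ultimately show ?thesis by linarith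
qed

lemma abs_combine:
  fixes x y k b r :: real
  assumes "\<bar>x\<bar> \<le> 2 * k * r" "\<bar>y\<bar> \<le> 2 * b * r" "0 \<le> b * r"
  shows "\<bar>- x - y\<bar> \<le> (2 * k + 4 * b) * r" "\<bar>- x + y\<bar> \<le> (2 * k + 4 * b) * r"
  unfolding distrib_right using assms by linarith+

lemma abs_combine':
  fixes x y k b r :: real
  assumes "\<bar>x\<bar> \<le> 2 * b * r" "\<bar>y\<bar> \<le> 2 * b * r" "0 \<le> k * r"
  shows "\<bar>x - y\<bar> \<le> (2 * k + 4 * b) * r"
  unfolding distrib_right using assms by linarith

lemma circle_dist:
  fixes q z1 z2 :: complex
  assumes "cmod (q - z1) = 1" "2 \<le> cmod (z1 - z2)"
  shows "1 \<le> cmod (q - z2)"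
proof -
  have "cmod (z1 - z2) \<le> cmod (q - z1) + cmod (q - z2)"
    by (metis add.commute norm_triangle_sub diff_add_cancel dist_norm dist_triangle3 dist_commute)
  then show ?thesis using assms by linarith
qed

section \<open>The remainder near one disk\<close>

context cols
begin

definition d :: real where "d = T/2"

lemma d_bounds: "1 < d" "d < 201/200" using T_bounds by (auto simp: d_def)

lemma bp_c: "bp c = p" by (simp add: bp_def p_def)

lemma d_sq: "(bp d)\<^sup>2 = \<delta> + \<delta>\<^sup>2/4"
  using bp_sq[of d] d_bounds by (simp add: d_def T_def power2_eq_square field_simps)

lemma bp_d_bounds: "0 < bp d" "bp d < 11/100"
proof -
  show "0 < bp d" using bp_pos d_bounds by simp
  have "d\<^sup>2 \<le> (201/200)\<^sup>2" using d_bounds by (intro power_mono) auto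
  then have "(bp d)\<^sup>2 < (11/100)\<^sup>2" using bp_sq[of d] d_bounds by (simp add: power2_eq_square)
  then show "bp d < 11/100" by (rule power2_less_imp_less) simp
qed

text \<open>The four disks that come within distance 3/2 of the centre of \<open>D\<^sub>R\<^sub>0\<close>, itself included.\<close>
definition outside4 :: "complex \<Rightarrow> bool" where
  "outside4 z \<longleftrightarrow> 1 \<le> cmod (z - of_real c) \<and> 1 \<le> cmod (z + of_real c) \<and>
     1 \<le> cmod (z - Complex c T) \<and> 1 \<le> cmod (z - Complex c (-T))"

lemma E_outside4:
  assumes "z \<in> E" shows "outside4 z"
proof -
  have e: "Complex x 0 = of_real x" for x by (simp add: complex_of_real_def)
  have A: "1 < cmod (z - Complex c (of_int n * T))" "1 < cmod (z - Complex (-c) (of_int n * T))" for n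
    using assms unfolding E_iff by blast+
  show ?thesis using A[of 0] A(1)[of 1] A(1)[of "-1"] e[of c] e[of "-c"] by (auto simp: outside4_def)
qed

lemma th_args:
  fixes z :: complex
  shows "cmod (\<i> * (z - of_real c)) = cmod (z - of_real c)" "cmod (- \<i> * (z - of_real c)) = cmod (z - of_real c)"
    "cmod (\<i> * (z - of_real c) + of_real (2 * d)) = cmod (z - Complex c T)"
    "cmod (- \<i> * (z - of_real c) + of_real (2 * d)) = cmod (z - Complex c (-T))"
    "1 * (z - of_real c) + of_real (2 * c) = z + of_real c"
proof -
  show "cmod (\<i> * (z - of_real c)) = cmod (z - of_real c)" "cmod (- \<i> * (z - of_real c)) = cmod (z - of_real c)"
    by (simp_all add: norm_mult)
  have "\<i> * (z - of_real c) + of_real (2 * d) = \<i> * (z - Complex c T)" by (simp add: complex_eq_iff d_def)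
  then show "cmod (\<i> * (z - of_real c) + of_real (2 * d)) = cmod (z - Complex c T)" by (simp add: norm_mult)
  have "- \<i> * (z - of_real c) + of_real (2 * d) = - \<i> * (z - Complex c (-T))" by (simp add: complex_eq_iff d_def)
  then show "cmod (- \<i> * (z - of_real c) + of_real (2 * d)) = cmod (z - Complex c (-T))" by (simp add: norm_mult)
qed simp

lemma outside4_th:
  assumes "outside4 z"
  shows "1 \<le> cmod (1 * (z - of_real c)) \<and> 1 \<le> cmod (1 * (z - of_real c) + of_real (2 * c))"
    "1 \<le> cmod (\<i> * (z - of_real c)) \<and> 1 \<le> cmod (\<i> * (z - of_real c) + of_real (2 * d))"
    "1 \<le> cmod (- \<i> * (z - of_real c)) \<and> 1 \<le> cmod (- \<i> * (z - of_real c) + of_real (2 * d))"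
  using assms unfolding th_args outside4_def by simp_all

text \<open>The poles are \<open>2 * bp x\<close> apart and of opposite sign, so away from both
  their fields cancel up to a factor of this order.\<close>

lemma dth_far:
  assumes "x = c \<or> x = d" "1/2 \<le> cmod (\<zeta> + of_real (x + bp x))" "1/2 \<le> cmod (\<zeta> + of_real (x - bp x))"
  shows "cmod (dth x \<zeta>) \<le> 8 * bp x"
proof -
  define P where "P = \<zeta> + of_real (x + bp x)"
  define Q where "Q = \<zeta> + of_real (x - bp x)"
  have PQ: "1/2 \<le> cmod P" "1/2 \<le> cmod Q" using assms by (auto simp: P_def Q_def)
  then have nz: "P \<noteq> 0" "Q \<noteq> 0" by auto
  have bp: "0 < bp x" using assms(1) bp_pos c_bounds d_bounds by auto
  have "dth x \<zeta> = (Q - P) / (P * Q)" unfolding dth_def P_def[symmetric] Q_def[symmetric] using nz by (simp add: diff_frac_eq)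
  also have "Q - P = of_real (- 2 * bp x)" by (simp add: P_def Q_def)
  finally have "cmod (dth x \<zeta>) = 2 * bp x / (cmod P * cmod Q)" using bp by (simp add: norm_divide norm_mult)
  also have "\<dots> \<le> 2 * bp x / (1/2 * (1/2))"
    using bp PQ nz by (intro divide_left_mono mult_mono mult_pos_pos) auto
  finally show ?thesis by simp
qed

end

context sol
begin

text \<open>Since \<open>th\<close> equals \<open>-2 * bL\<close> on the other circle, the two
  factors reproduce the jumps \<open>-2 * k\<close> to the left and \<open>\<plusminus>b * T\<close>
  upwards and downwards.\<close>

definition \<kappa>v :: real where "\<kappa>v = k / bL c"
definition \<kappa>h :: real where "\<kappa>h = b * T / (2 * bL d)"

text \<open>\<open>W\<close> carries the jumps of \<open>u\<close> from \<open>D\<^sub>R\<^sub>0\<close> to its neighbours on the left, above and below, so that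
  \<open>u - kR - W\<close> vanishes on \<open>\<partial>D\<^sub>R\<^sub>0\<close> and is small on the other three circles.\<close>
definition W :: "complex \<Rightarrow> real" where
  "W z = \<kappa>v * th c (1 * (z - of_real c)) - \<kappa>h * (th d (\<i> * (z - of_real c)) - th d (- \<i> * (z - of_real c)))"
definition dW :: "complex \<Rightarrow> complex" where
  "dW z = of_real \<kappa>v * (1 * dth c (1 * (z - of_real c)))
    - of_real \<kappa>h * (\<i> * dth d (\<i> * (z - of_real c)) - (- \<i>) * dth d (- \<i> * (z - of_real c)))"

lemma hgrad_W: "hgrad E W dW"
  unfolding W_def[abs_def] dW_def[abs_def]
  using hgrad_th[OF c_bounds(1) open_E outside4_th(1)[OF E_outside4]]
    hgrad_th[OF d_bounds(1) open_E outside4_th(2)[OF E_outside4]]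
    hgrad_th[OF d_bounds(1) open_E outside4_th(3)[OF E_outside4]]
  by (intro hgrad_diff hgrad_scale)

lemma isCont_W:
  assumes "outside4 z"
  shows "isCont W z"
proof -
  have "isCont (\<lambda>z. th x (\<mu> * (z - of_real c))) z"
    if "1 < x" "1 \<le> cmod (\<mu> * (z - of_real c)) \<and> 1 \<le> cmod (\<mu> * (z - of_real c) + of_real (2 * x))" for x \<mu>
    by (rule isCont_o2[where g = "th x"]) (use isCont_th that in \<open>auto intro!: continuous_intros\<close>)
  from this[OF c_bounds(1) outside4_th(1)[OF assms]] this[OF d_bounds(1) outside4_th(2)[OF assms]]
    this[OF d_bounds(1) outside4_th(3)[OF assms]]
  show ?thesis unfolding W_def[abs_def] by (intro isCont_diff isCont_mult continuous_const)
qed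

lemma \<kappa>_bL: "\<kappa>v * bL c = k" "\<kappa>h * (2 * bL d) = b * T"
  using bL_bounds(3)[of c] bL_bounds(3)[of d] c_bounds d_bounds by (auto simp: \<kappa>v_def \<kappa>h_def)

lemma \<kappa>_bp: "\<bar>\<kappa>v\<bar> * p \<le> 201/200 * \<bar>k\<bar>" "\<bar>\<kappa>h\<bar> * bp d \<le> 11/10 * \<bar>b\<bar>"
proof -
  note C = bL_bounds[of c, OF c_bounds(1)] and D = bL_bounds[of d, OF d_bounds(1)]
  have "\<bar>\<kappa>v\<bar> * p \<le> \<bar>\<kappa>v\<bar> * (bL c * c)" using C(1) by (intro mult_left_mono) (auto simp: bp_c)
  also have "\<dots> = \<bar>\<kappa>v * bL c\<bar> * c" using C(3) by (simp add: abs_mult)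
  also have "\<dots> = \<bar>k\<bar> * c" by (simp add: \<kappa>_bL)
  also have "\<dots> \<le> \<bar>k\<bar> * (201/200)" using c_bounds by (intro mult_left_mono) auto
  finally show "\<bar>\<kappa>v\<bar> * p \<le> 201/200 * \<bar>k\<bar>" by (simp add: mult.commute)
  have "\<bar>\<kappa>h\<bar> * bp d \<le> \<bar>\<kappa>h\<bar> * (bL d * d)" using D(1) by (intro mult_left_mono) auto
  also have "\<dots> = \<bar>\<kappa>h * (2 * bL d)\<bar> * (d/2)" using D(3) by (simp add: abs_mult)
  also have "\<bar>\<kappa>h * (2 * bL d)\<bar> = \<bar>b\<bar> * T" using T_bounds by (simp only: \<kappa>_bL abs_mult)
  also have "\<bar>b\<bar> * T * (d/2) = \<bar>b\<bar> * (d * d)" by (simp add: d_def)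
  also have "\<dots> \<le> \<bar>b\<bar> * (201/200 * (201/200))" using d_bounds by (intro mult_left_mono mult_mono) auto
  also have "\<dots> \<le> \<bar>b\<bar> * (11/10)" by (intro mult_left_mono) auto
  finally show "\<bar>\<kappa>h\<bar> * bp d \<le> 11/10 * \<bar>b\<bar>" by (simp add: mult.commute)
qed

lemma th_scaled_bound:
  assumes "1 \<le> cmod \<zeta>" "1 \<le> cmod (\<zeta> + of_real (2 * c))" shows "\<bar>\<kappa>v * th c \<zeta>\<bar> \<le> 2 * \<bar>k\<bar>"
proof -
  have "\<bar>th c \<zeta>\<bar> \<le> 2 * bL c" using th_lower[OF c_bounds(1) assms] th_nonpos[OF c_bounds(1) assms] by linarith
  then have "\<bar>\<kappa>v\<bar> * \<bar>th c \<zeta>\<bar> \<le> \<bar>\<kappa>v\<bar> * (2 * bL c)" by (intro mult_left_mono) auto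
  also have "\<dots> = 2 * \<bar>\<kappa>v * bL c\<bar>" using bL_bounds(3)[OF c_bounds(1)] by (simp add: abs_mult)
  finally show ?thesis by (simp add: abs_mult \<kappa>_bL)
qed

lemma th_scaled_bound':
  assumes "1 \<le> cmod \<zeta>" "1 \<le> cmod (\<zeta> + of_real (2 * d))" shows "\<bar>\<kappa>h * th d \<zeta>\<bar> \<le> 3 * \<bar>b\<bar>"
proof -
  have "\<bar>th d \<zeta>\<bar> \<le> 2 * bL d" using th_lower[OF d_bounds(1) assms] th_nonpos[OF d_bounds(1) assms] by linarith
  then have "\<bar>\<kappa>h\<bar> * \<bar>th d \<zeta>\<bar> \<le> \<bar>\<kappa>h\<bar> * (2 * bL d)" by (intro mult_left_mono) auto
  also have "\<dots> = \<bar>\<kappa>h * (2 * bL d)\<bar>" using bL_bounds(3)[OF d_bounds(1)] by (simp add: abs_mult)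
  also have "\<dots> = \<bar>b\<bar> * T" using T_bounds by (simp add: abs_mult \<kappa>_bL)
  also have "\<dots> \<le> \<bar>b\<bar> * 3" using T_bounds by (intro mult_left_mono) auto
  finally show ?thesis by (simp add: abs_mult)
qed

lemma th_scaled_small:
  assumes "1 \<le> cmod \<zeta>" "1 \<le> cmod (\<zeta> + of_real (2 * c))" "1 \<le> cmod (\<zeta> + of_real (c + bp c))"
  shows "\<bar>\<kappa>v * th c \<zeta>\<bar> \<le> 2 * \<bar>k\<bar> * ((cmod \<zeta>)\<^sup>2 - 1)"
proof -
  have R: "0 \<le> (cmod \<zeta>)\<^sup>2 - 1" using assms(1) by simp
  have "\<bar>\<kappa>v\<bar> * \<bar>th c \<zeta>\<bar> \<le> \<bar>\<kappa>v\<bar> * (p * (c + p) * ((cmod \<zeta>)\<^sup>2 - 1))"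
    using th_small[OF c_bounds(1) assms] by (intro mult_left_mono) (auto simp: bp_c)
  also have "\<dots> = (\<bar>\<kappa>v\<bar> * p) * (c + p) * ((cmod \<zeta>)\<^sup>2 - 1)" by (simp add: mult_ac)
  also have "\<dots> \<le> (201/200 * \<bar>k\<bar>) * (3/2) * ((cmod \<zeta>)\<^sup>2 - 1)"
    using c_bounds p_bounds R by (intro mult_right_mono[OF mult_mono[OF \<kappa>_bp(1)]]) auto
  also have "\<dots> \<le> 2 * \<bar>k\<bar> * ((cmod \<zeta>)\<^sup>2 - 1)" using R by (intro mult_right_mono) auto
  finally show ?thesis by (simp add: abs_mult)
qed

lemma th_scaled_small':
  assumes "1 \<le> cmod \<zeta>" "1 \<le> cmod (\<zeta> + of_real (2 * d))" "1 \<le> cmod (\<zeta> + of_real (d + bp d))"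
  shows "\<bar>\<kappa>h * th d \<zeta>\<bar> \<le> 2 * \<bar>b\<bar> * ((cmod \<zeta>)\<^sup>2 - 1)"
proof -
  have R: "0 \<le> (cmod \<zeta>)\<^sup>2 - 1" using assms(1) by simp
  have "\<bar>\<kappa>h\<bar> * \<bar>th d \<zeta>\<bar> \<le> \<bar>\<kappa>h\<bar> * (bp d * (d + bp d) * ((cmod \<zeta>)\<^sup>2 - 1))"
    using th_small[OF d_bounds(1) assms] by (intro mult_left_mono) auto
  also have "\<dots> = (\<bar>\<kappa>h\<bar> * bp d) * (d + bp d) * ((cmod \<zeta>)\<^sup>2 - 1)" by (simp add: mult_ac)
  also have "\<dots> \<le> (11/10 * \<bar>b\<bar>) * (3/2) * ((cmod \<zeta>)\<^sup>2 - 1)"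
    using d_bounds bp_d_bounds R by (intro mult_right_mono[OF mult_mono[OF \<kappa>_bp(2)]]) auto
  also have "\<dots> \<le> 2 * \<bar>b\<bar> * ((cmod \<zeta>)\<^sup>2 - 1)" using R by (intro mult_right_mono) auto
  finally show ?thesis by (simp add: abs_mult)
qed

text \<open>Chosen for the barrier \<open>A * ln r\<close>: it must exceed the errors on the
  neighbouring circles, at most \<open>(10 * \<bar>k\<bar> + 20 * \<bar>b\<bar>) * ln r\<close>, and
  \<open>A / 3\<close> must dominate the crude bound of the remainder up to radius 3/2.
  \<open>k_le\<close> expresses \<open>k\<close> by \<open>a\<close>.\<close>

definition A :: real where "A = (20 * C1 + 100) * (\<bar>a\<bar> + \<bar>b\<bar>)"

lemma k_le: "\<bar>k\<bar> \<le> C1 * \<bar>a\<bar>"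
proof -
  have "\<bar>k\<bar> \<le> C1 * \<bar>a\<bar> * (3 * p)" using k_bounds(2) by (simp add: mult_ac)
  also have "\<dots> \<le> C1 * \<bar>a\<bar> * 1" using p_bounds C1_pos by (intro mult_left_mono) auto
  finally show ?thesis by simp
qed

lemma A_ge: "A \<ge> 0" "20 * \<bar>k\<bar> + 100 * \<bar>a\<bar> + 100 * \<bar>b\<bar> \<le> A"
proof -
  show "A \<ge> 0" using C1_pos by (simp add: A_def)
  have "0 \<le> C1 * \<bar>b\<bar>" using C1_pos by simp
  then show "20 * \<bar>k\<bar> + 100 * \<bar>a\<bar> + 100 * \<bar>b\<bar> \<le> A" using k_le by (simp add: A_def algebra_simps)
qed

lemma w_crude:
  assumes "z \<in> E" "cmod (z - of_real c) < 3/2"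
  shows "\<bar>u z - kR - W z\<bar> \<le> A / 3"
proof -
  note O = outside4_th[OF E_outside4[OF assms(1)]]
  have comb: "x \<le> m / 3"
    if "x \<le> x1 + x2" "x1 \<le> y1 + k' + y3 + y4" "y3 \<le> a' * 3" "y4 \<le> b' * 2" "y1 \<le> k' + 3 * a' + b'"
      "x2 \<le> z1 + (z2 + z3)" "z1 \<le> 2 * k'" "z2 \<le> 3 * b'" "z3 \<le> 3 * b'"
      "20 * k' + 100 * a' + 100 * b' \<le> m" "0 \<le> k'" "0 \<le> a'" "0 \<le> b'"
    for x x1 x2 y1 y3 y4 k' a' b' z1 z2 z3 m :: real
    using that by linarith
  show ?thesis
  proof (rule comb[OF abs_triangle_ineq4 _ _ _ v_estimate[OF assms(1)] _ _ _ _ A_ge(2)])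
    have "kR = k0 + k" by (simp add: k_def k0_def field_simps)
    then show "\<bar>u z - kR\<bar> \<le> \<bar>v z - k0\<bar> + \<bar>k\<bar> + \<bar>a * Re z\<bar> + \<bar>b * Im z\<bar>" unfolding v_def by linarith
    show "\<bar>a * Re z\<bar> \<le> \<bar>a\<bar> * 3" "\<bar>b * Im z\<bar> \<le> \<bar>b\<bar> * 2"
      unfolding abs_mult using abs_Re_le_cmod[of "z - of_real c"] abs_Im_le_cmod[of "z - of_real c"] assms(2) c_bounds
      by (intro mult_left_mono; simp)+
    show "\<bar>W z\<bar> \<le> \<bar>\<kappa>v * th c (1 * (z - of_real c))\<bar> + (\<bar>\<kappa>h * th d (\<i> * (z - of_real c))\<bar> + \<bar>\<kappa>h * th d (- \<i> * (z - of_real c))\<bar>)"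
      unfolding W_def right_diff_distrib by linarith
    show "\<bar>\<kappa>v * th c (1 * (z - of_real c))\<bar> \<le> 2 * \<bar>k\<bar>" using O(1) by (intro th_scaled_bound) auto
    show "\<bar>\<kappa>h * th d (\<i> * (z - of_real c))\<bar> \<le> 3 * \<bar>b\<bar>" using O(2) by (intro th_scaled_bound') auto
    show "\<bar>\<kappa>h * th d (- \<i> * (z - of_real c))\<bar> \<le> 3 * \<bar>b\<bar>" using O(3) by (intro th_scaled_bound') auto
  qed auto
qed

text \<open>Within distance 3/2 of the centre only four circles occur. On the circle of
  \<open>D\<^sub>R\<^sub>0\<close> all three potentials vanish. On each other one, one potential
  cancels the jump exactly and the remaining two are of order \<open>r\<^sup>2 - 1\<close>, hence of
  order \<open>ln r\<close>, where \<open>r\<close> is the distance to the centre.\<close>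

lemma w_limit_bound:
  assumes q: "cmod (q - of_real c) < 3/2"
    and n: "cmod (q - Complex c (of_int n * T)) = 1 \<and> l = kR + of_int n * b * T \<or> cmod (q - Complex (-c) (of_int n * T)) = 1 \<and> l = kL + of_int n * b * T"
  shows "outside4 q \<and> \<bar>l - kR - W q\<bar> \<le> A * ln (cmod (q - of_real c))"
proof -
  define \<zeta> where "\<zeta> = q - of_real c"
  define \<rho> where "\<rho> = (cmod \<zeta>)\<^sup>2 - 1"
  have Cc: "of_real x = Complex x 0" for x by (simp add: complex_of_real_def)
  have e1: "q + of_real c = q - Complex (-c) 0" by (simp add: complex_eq_iff)
  have sep: "2 \<le> cmod (Complex x1 y1 - Complex x2 y2)" if "2 \<le> \<bar>x1 - x2\<bar> \<or> 2 \<le> \<bar>y1 - y2\<bar>" for x1 x2 y1 y2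
    using that abs_Re_le_cmod[of "Complex x1 y1 - Complex x2 y2"] abs_Im_le_cmod[of "Complex x1 y1 - Complex x2 y2"] by auto
  have out: "outside4 q" if "cmod (q - Complex x y) = 1" "(x, y) \<in> {(c, 0), (-c, 0), (c, T), (c, -T)}" for x y
  proof -
    have "1 \<le> cmod (q - Complex x' y')" if "(x', y') \<in> {(c, 0), (-c, 0), (c, T), (c, -T)}" for x' y'
    proof (cases "(x', y') = (x, y)")
      case True then show ?thesis using \<open>cmod (q - Complex x y) = 1\<close> by simp
    next
      case False
      then have "2 \<le> \<bar>x - x'\<bar> \<or> 2 \<le> \<bar>y - y'\<bar>"
        using that \<open>(x, y) \<in> {(c, 0), (-c, 0), (c, T), (c, -T)}\<close> c_bounds T_bounds by auto
      then show ?thesis using circle_dist[OF \<open>cmod (q - Complex x y) = 1\<close> sep] by blast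
    qed
    from this[of c 0] this[of "-c" 0] this[of c T] this[of c "-T"] show ?thesis
      unfolding outside4_def e1 by (auto simp: Cc)
  qed
  have imq: "\<bar>Im q\<bar> < 3/2" using abs_Im_le_cmod[of "q - of_real c"] q by simp
  have fin: "\<bar>l - kR - W q\<bar> \<le> A * ln (cmod \<zeta>)" if "outside4 q" "\<bar>l - kR - W q\<bar> \<le> (2 * \<bar>k\<bar> + 4 * \<bar>b\<bar>) * \<rho>"
  proof -
    have "1 \<le> cmod \<zeta>" using that(1) by (simp add: outside4_def \<zeta>_def)
    then have "\<rho> \<le> 5 * ln (cmod \<zeta>)" "0 \<le> ln (cmod \<zeta>)" unfolding \<rho>_def using q by (auto intro!: ln_radius simp: \<zeta>_def)
    then have "(2 * \<bar>k\<bar> + 4 * \<bar>b\<bar>) * \<rho> \<le> (2 * \<bar>k\<bar> + 4 * \<bar>b\<bar>) * (5 * ln (cmod \<zeta>))" by (intro mult_left_mono) auto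
    also have "\<dots> = (10 * \<bar>k\<bar> + 20 * \<bar>b\<bar>) * ln (cmod \<zeta>)" by (simp add: algebra_simps)
    also have "\<dots> \<le> A * ln (cmod \<zeta>)" using A_ge(2) \<open>0 \<le> ln (cmod \<zeta>)\<close>
      by (intro mult_right_mono) auto
    finally show ?thesis using that(2) by linarith
  qed
  have We: "W q = \<kappa>v * th c (1 * \<zeta>) - (\<kappa>h * th d (\<i> * \<zeta>) - \<kappa>h * th d (- \<i> * \<zeta>))"
    by (simp add: W_def \<zeta>_def right_diff_distrib)
  have nrm: "cmod (1 * \<zeta>) = cmod \<zeta>" "cmod (\<i> * \<zeta>) = cmod \<zeta>" "cmod (- \<i> * \<zeta>) = cmod \<zeta>" by (simp_all add: norm_mult)
  have p1: "1 \<le> cmod (1 * \<zeta> + of_real (c + bp c))" if "1 \<le> \<bar>Im q\<bar>"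
    using abs_Im_le_cmod[of "1 * \<zeta> + of_real (c + bp c)"] that by (simp add: \<zeta>_def)
  have p2: "1 \<le> cmod (\<i> * \<zeta> + of_real (d + bp d))" if "Re q \<le> 0 \<or> Im q \<le> -1"
    using abs_Im_le_cmod[of "\<i> * \<zeta> + of_real (d + bp d)"] abs_Re_le_cmod[of "\<i> * \<zeta> + of_real (d + bp d)"]
      that c_bounds d_bounds bp_d_bounds by (auto simp: \<zeta>_def)
  have p3: "1 \<le> cmod (- \<i> * \<zeta> + of_real (d + bp d))" if "Re q \<le> 0 \<or> 1 \<le> Im q"
    using abs_Im_le_cmod[of "- \<i> * \<zeta> + of_real (d + bp d)"] abs_Re_le_cmod[of "- \<i> * \<zeta> + of_real (d + bp d)"]
      that c_bounds d_bounds bp_d_bounds by (auto simp: \<zeta>_def)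
  from n show ?thesis
  proof (elim disjE conjE)
    assume qn: "cmod (q - Complex c (of_int n * T)) = 1" and l: "l = kR + of_int n * b * T"
    have inq: "\<bar>Im q - of_int n * T\<bar> \<le> 1" using abs_Im_le_cmod[of "q - Complex c (of_int n * T)"] qn by simp
    have "n = 0 \<or> n = 1 \<or> n = -1"
    proof (rule ccontr)
      assume "\<not> ?thesis"
      then have "of_int n \<le> (-2::real) \<or> of_int n \<ge> (2::real)" by linarith
      then have "of_int n * T \<le> -2 * T \<or> of_int n * T \<ge> 2 * T" using T_bounds
        mult_right_mono[of "of_int n" "-2" T] mult_right_mono[of 2 "of_int n" T] by linarith
      then show False using inq imq T_bounds by linarith
    qed
    then show ?thesis
    proof (elim disjE)
      assume n0: "n = 0"
      have o: "outside4 q" using out[of c 0] qn n0 by simp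
      note O = outside4_th[OF o, folded \<zeta>_def]
      have c1: "cmod \<zeta> = 1" using qn n0 by (simp add: \<zeta>_def Cc)
      have "W q = 0" unfolding We using th_circle[OF c_bounds(1), of "1 * \<zeta>"] th_circle[OF d_bounds(1), of "\<i> * \<zeta>"]
          th_circle[OF d_bounds(1), of "- \<i> * \<zeta>"] O nrm c1 by simp
      then show ?thesis using o l n0 c1 by (simp add: \<zeta>_def)
    next
      assume n1: "n = 1"
      have o: "outside4 q" using out[of c T] qn n1 by simp
      note O = outside4_th[OF o, folded \<zeta>_def]
      have "th d (\<i> * \<zeta>) = - 2 * bL d" using th_other_circle[OF d_bounds(1), of "\<i> * \<zeta>"] O(2) th_args(3)[of q] qn n1 by (simp add: \<zeta>_def)
      then have "\<kappa>h * th d (\<i> * \<zeta>) = - (b * T)" by (simp flip: \<kappa>_bL)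
      then have e: "l - kR - W q = - (\<kappa>v * th c (1 * \<zeta>)) - \<kappa>h * th d (- \<i> * \<zeta>)" unfolding We l n1 by simp
      have iq: "1 \<le> Im q" using inq n1 T_bounds by simp
      have "\<bar>\<kappa>v * th c (1 * \<zeta>)\<bar> \<le> 2 * \<bar>k\<bar> * \<rho>" using th_scaled_small[of "1 * \<zeta>"] O p1 iq unfolding nrm \<rho>_def by auto
      moreover have "\<bar>\<kappa>h * th d (- \<i> * \<zeta>)\<bar> \<le> 2 * \<bar>b\<bar> * \<rho>" using th_scaled_small'[of "- \<i> * \<zeta>"] O p3 iq unfolding nrm \<rho>_def by auto
      moreover have "0 \<le> \<bar>b\<bar> * \<rho>" using O(1) by (simp add: \<rho>_def)
      ultimately have "\<bar>l - kR - W q\<bar> \<le> (2 * \<bar>k\<bar> + 4 * \<bar>b\<bar>) * \<rho>" unfolding e by (rule abs_combine)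
      then show ?thesis using fin[OF o] o by (simp add: \<zeta>_def)
    next
      assume n1: "n = -1"
      have o: "outside4 q" using out[of c "-T"] qn n1 by simp
      note O = outside4_th[OF o, folded \<zeta>_def]
      have "th d (- \<i> * \<zeta>) = - 2 * bL d" using th_other_circle[OF d_bounds(1), of "- \<i> * \<zeta>"] O(3) th_args(4)[of q] qn n1 by (simp add: \<zeta>_def)
      then have "\<kappa>h * th d (- \<i> * \<zeta>) = - (b * T)" by (simp flip: \<kappa>_bL)
      then have e: "l - kR - W q = - (\<kappa>v * th c (1 * \<zeta>)) + \<kappa>h * th d (\<i> * \<zeta>)" unfolding We l n1 by simp
      have iq: "Im q \<le> -1" using inq n1 T_bounds by simp
      have "\<bar>\<kappa>v * th c (1 * \<zeta>)\<bar> \<le> 2 * \<bar>k\<bar> * \<rho>" using th_scaled_small[of "1 * \<zeta>"] O p1 iq unfolding nrm \<rho>_def by auto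
      moreover have "\<bar>\<kappa>h * th d (\<i> * \<zeta>)\<bar> \<le> 2 * \<bar>b\<bar> * \<rho>" using th_scaled_small'[of "\<i> * \<zeta>"] O p2 iq unfolding nrm \<rho>_def by auto
      moreover have "0 \<le> \<bar>b\<bar> * \<rho>" using O(1) by (simp add: \<rho>_def)
      ultimately have "\<bar>l - kR - W q\<bar> \<le> (2 * \<bar>k\<bar> + 4 * \<bar>b\<bar>) * \<rho>" unfolding e by (rule abs_combine)
      then show ?thesis using fin[OF o] o by (simp add: \<zeta>_def)
    qed
  next
    assume qn: "cmod (q - Complex (-c) (of_int n * T)) = 1" and l: "l = kL + of_int n * b * T"
    \<comment> \<open>The other centres of the left column are at distance at least
      \<open>sqrt 8 > 5/2\<close> from \<open>c\<close>, so their circles do not come within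
      3/2.\<close>
    have "n = 0"
    proof (rule ccontr)
      assume "n \<noteq> 0"
      then have "\<bar>of_int n\<bar> \<ge> (1::real)" by linarith
      then have "2 \<le> \<bar>of_int n\<bar> * T" using T_bounds mult_mono[of 1 "\<bar>of_int n\<bar>" 2 T] by simp
      then have "2 \<le> \<bar>of_int n * T\<bar>" using T_bounds by (simp add: abs_mult)
      then have "2\<^sup>2 \<le> (of_int n * T)\<^sup>2" by (subst abs_le_square_iff[symmetric]) simp
      moreover have "2\<^sup>2 \<le> (2 * c)\<^sup>2" using c_bounds by (intro power_mono) auto
      moreover have "(cmod (Complex (2 * c) (- of_int n * T)))\<^sup>2 = (2 * c)\<^sup>2 + (of_int n * T)\<^sup>2" by (simp add: cmod_power2)
      moreover have "(cmod (Complex (2 * c) (- of_int n * T)))\<^sup>2 \<le> (5/2)\<^sup>2"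
      proof (rule power_mono)
        have "Complex (2 * c) (- of_int n * T) = (q - Complex (-c) (of_int n * T)) - (q - of_real c)" by (simp add: complex_eq_iff)
        then show "cmod (Complex (2 * c) (- of_int n * T)) \<le> 5/2"
          using norm_triangle_ineq4[of "q - Complex (-c) (of_int n * T)" "q - of_real c"] qn q by simp
      qed simp
      ultimately show False by (simp add: power2_eq_square)
    qed
    then have o: "outside4 q" using out[of "-c" 0] qn by simp
    note O = outside4_th[OF o, folded \<zeta>_def]
    have qc: "cmod (q + of_real c) = 1" unfolding e1 using qn \<open>n = 0\<close> by simp
    have "th c (1 * \<zeta>) = - 2 * bL c" using th_other_circle[OF c_bounds(1), of "1 * \<zeta>"] O(1) qc th_args(5)[of q]
      unfolding \<zeta>_def by metis
    then have "\<kappa>v * th c (1 * \<zeta>) = - 2 * k" by (simp flip: \<kappa>_bL(1))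
    then have e: "l - kR - W q = \<kappa>h * th d (\<i> * \<zeta>) - \<kappa>h * th d (- \<i> * \<zeta>)" unfolding We l \<open>n = 0\<close> by (simp add: k_def)
    have iq: "Re q \<le> 0" using abs_Re_le_cmod[of "q + of_real c"] qc c_bounds by auto
    have "\<bar>\<kappa>h * th d (\<i> * \<zeta>)\<bar> \<le> 2 * \<bar>b\<bar> * \<rho>" using th_scaled_small'[of "\<i> * \<zeta>"] O p2 iq unfolding nrm \<rho>_def by auto
    moreover have "\<bar>\<kappa>h * th d (- \<i> * \<zeta>)\<bar> \<le> 2 * \<bar>b\<bar> * \<rho>" using th_scaled_small'[of "- \<i> * \<zeta>"] O p3 iq unfolding nrm \<rho>_def by auto
    moreover have "0 \<le> \<bar>k\<bar> * \<rho>" using O(1) by (simp add: \<rho>_def)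
    ultimately have "\<bar>l - kR - W q\<bar> \<le> (2 * \<bar>k\<bar> + 4 * \<bar>b\<bar>) * \<rho>" unfolding e by (rule abs_combine')
    then show ?thesis using fin[OF o] o by (simp add: \<zeta>_def)
  qed
qed

end

context sol
begin

lemma limL_n:
  assumes "cmod (q - Complex (-c) (of_int n * T)) = 1"
  shows "(u \<longlongrightarrow> kL + of_int n * b * T) (at q within E)"
proof -
  interpret r: sol \<epsilon> \<delta> "-a" b kR kL "\<lambda>z. u (- cnj z)" "\<lambda>z. - cnj (f (- cnj z))" by (rule reflect)
  have "- cnj q - Complex c (of_int n * T) = - cnj (q - Complex (-c) (of_int n * T))" by (simp add: complex_eq_iff)
  then have "cmod (- cnj q - Complex c (of_int n * T)) = 1" using assms by (metis complex_mod_cnj norm_minus_cancel)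
  then have "((\<lambda>z. u (- cnj z)) \<longlongrightarrow> kL + of_int n * b * T) (at (- cnj q) within E)" by (rule r.limR_n)
  then have "((\<lambda>z. u (- cnj (- cnj z))) \<longlongrightarrow> kL + of_int n * b * T) (at q within E)"
    by (rule tendsto_at_within_compose_iso[where g = "\<lambda>z. - cnj z"])
      (auto simp: E_reflect complex_cnj_cancel_iff intro!: continuous_intros)
  then show ?thesis by simp
qed

text \<open>The barrier \<open>A * ln \<bar>z - c\<bar>\<close> vanishes on \<open>\<partial>D\<^sub>R\<^sub>0\<close> to first order, whatever the width of the gaps.\<close>

lemma w_barrier:
  assumes z0: "z0 \<in> E" "cmod (z0 - of_real c) < 3/2"
  shows "\<bar>u z0 - kR - W z0\<bar> \<le> A * ln (cmod (z0 - of_real c))"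
proof -
  define S where "S = E \<inter> ball (of_real c) (3/2)"
  have SE: "S \<subseteq> E" by (auto simp: S_def)
  have oS: "open S" unfolding S_def by (intro open_Int open_E open_ball)
  have Sb: "cmod (z - of_real c) < 3/2" "1 < cmod (z - of_real c)" if "z \<in> S" for z
  proof -
    show "cmod (z - of_real c) < 3/2" using that by (simp add: S_def dist_norm norm_minus_commute)
    have "1 < cmod (z - Complex c (of_int 0 * T))" using that SE E_iff by blast
    then show "1 < cmod (z - of_real c)" by (simp add: complex_of_real_def)
  qed
  have "\<sigma> * (u z0 - kR - W z0) - A * ln (cmod (z0 - of_real c)) \<le> 0" if \<sigma>: "\<sigma> = 1 \<or> \<sigma> = -1" for \<sigma> :: real
  proof (rule weak_max_principle[where S = S and K = "cball (of_real c) (3/2)" and V = "\<lambda>z. \<sigma> * (u z - kR - W z) - A * ln (cmod (z - of_real c))"])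
    have hl: "hgrad S (\<lambda>z. ln (cmod (z - of_real c))) (\<lambda>z. 1 / (z - of_real c))"
      by (rule hgrad_ln_cmod[OF oS]) (use Sb in \<open>force intro!: derivative_eq_intros\<close>)+
    show "hgrad S (\<lambda>z. \<sigma> * (u z - kR - W z) - A * ln (cmod (z - of_real c)))
        (\<lambda>z. of_real \<sigma> * (f z - 0 - dW z) - of_real A * (1 / (z - of_real c)))"
      by (intro hgrad_diff hgrad_scale hl hgrad_const oS hgrad_subset[OF hg oS SE] hgrad_subset[OF hgrad_W oS SE])
    show "z0 \<in> S" using z0 by (simp add: S_def dist_norm norm_minus_commute)
    show "\<exists>z'\<in>S \<inter> cball (of_real c) (3/2). \<sigma> * (u z' - kR - W z') - A * ln (cmod (z' - of_real c))
        = \<sigma> * (u z - kR - W z) - A * ln (cmod (z - of_real c)) \<and> Re z' = Re z" if "z \<in> S" for z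
      using that by (intro bexI[of _ z]) (auto simp: S_def)
    show "compact (cball (complex_of_real c) (3/2))" by simp
    fix q \<eta> assume q: "q \<in> cball (complex_of_real c) (3/2)" "q \<notin> S" and \<eta>: "\<eta> > (0::real)"
    show "eventually (\<lambda>z. \<sigma> * (u z - kR - W z) - A * ln (cmod (z - of_real c)) < 0 + \<eta>) (at q within S)"
    proof (cases "cmod (q - of_real c) = 3/2")
      case True
      have "isCont (\<lambda>z. A / 3 - A * ln (cmod (z - of_real c))) q" using True by (intro continuous_intros) auto
      \<comment> \<open>From \<open>ln (3/2) \<ge> 1 - 2/3\<close>; this is the 3 in the bound
        \<open>A / 3\<close> of \<open>w_crude\<close>.\<close>
      moreover have "1/3 \<le> ln (3/2::real)" using ln_le_minus_one[of "2/3::real"] by (simp add: ln_div)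
      then have "A * (1/3) \<le> A * ln (3/2)" using A_ge(1) by (intro mult_left_mono)
      then have "A / 3 - A * ln (cmod (q - of_real c)) \<le> 0" unfolding True by simp
      ultimately have "eventually (\<lambda>z. A / 3 - A * ln (cmod (z - of_real c)) < 0 + \<eta>) (at q within S)"
        using \<eta> by (rule isCont_eventually_less)
      moreover have "eventually (\<lambda>z. z \<in> S) (at q within S)" by (simp add: eventually_at_topological) blast
      ultimately show ?thesis
      proof eventually_elim
        case (elim z)
        have "\<bar>u z - kR - W z\<bar> \<le> A / 3" using w_crude[of z] Sb(1)[OF elim(2)] elim(2) SE by blast
        then have "u z - kR - W z \<le> A / 3" "- (u z - kR - W z) \<le> A / 3" by linarith+
        then have "\<sigma> * (u z - kR - W z) \<le> A / 3" using \<sigma> by (elim disjE) (simp_all only: mult_1 mult_minus1)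
        then show ?case using elim(1) by linarith
      qed
    next
      case False
      then have q32: "cmod (q - of_real c) < 3/2" using q(1) by (auto simp: dist_norm norm_minus_commute)
      then have qE: "q \<notin> E" using q(2) by (auto simp: S_def dist_norm norm_minus_commute)
      have step: "eventually (\<lambda>z. \<sigma> * (u z - kR - W z) - A * ln (cmod (z - of_real c)) < 0 + \<eta>) (at q within S)"
        if lim: "(u \<longlongrightarrow> l) (at q within E)" and L: "outside4 q \<and> \<bar>l - kR - W q\<bar> \<le> A * ln (cmod (q - of_real c))" for l
      proof (rule tendsto_eventually_less[OF _ _ \<eta>])
        have "q \<noteq> of_real c" using L by (auto simp: outside4_def)
        then have lncont: "isCont (\<lambda>z. ln (cmod (z - of_real c))) q" by (intro continuous_intros) auto
        have "(W \<longlongrightarrow> W q) (at q within S)"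
          using isCont_W[of q] L continuous_at_imp_continuous_at_within continuous_within by blast
        moreover have "((\<lambda>z. ln (cmod (z - of_real c))) \<longlongrightarrow> ln (cmod (q - of_real c))) (at q within S)"
          using lncont continuous_at_imp_continuous_at_within continuous_within by blast
        moreover have "(u \<longlongrightarrow> l) (at q within S)" by (rule tendsto_within_subset[OF lim SE])
        ultimately show "((\<lambda>z. \<sigma> * (u z - kR - W z) - A * ln (cmod (z - of_real c))) \<longlongrightarrow> \<sigma> * (l - kR - W q) - A * ln (cmod (q - of_real c))) (at q within S)"
          by (intro tendsto_diff tendsto_mult tendsto_const)
        show "\<sigma> * (l - kR - W q) - A * ln (cmod (q - of_real c)) \<le> 0" using L \<sigma> by auto
      qed
      show ?thesis
      proof (rule eventually_boundary_all[OF SE qE])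
        fix n :: int assume n: "cmod (q - Complex c (of_int n * T)) = 1"
        show ?thesis by (rule step[OF limR_n[OF n] w_limit_bound[OF q32]]) (use n in blast)
      next
        fix n :: int assume n: "cmod (q - Complex (-c) (of_int n * T)) = 1"
        show ?thesis by (rule step[OF limL_n[OF n] w_limit_bound[OF q32]]) (use n in blast)
      qed
    qed
  qed
  from this[of 1] this[of "-1"] show ?thesis by (auto simp: abs_le_iff)
qed

text \<open>As \<open>D\<^sub>R\<^sub>0\<close> is the nearest disk, the ball of radius
  \<open>\<rho> = (r - 1) / 4\<close> lies in \<open>E\<close>, and \<open>w_barrier\<close> bounds
  the remainder on it by \<open>5 * A * \<rho>\<close>. The distance to the disk then cancels in the
  gradient estimate. The limit 7/5 keeps the ball within radius 3/2.\<close>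

lemma w_gradient:
  assumes z: "z \<in> E" "0 \<le> Re z" "\<bar>Im z\<bar> \<le> T/2" "cmod (z - of_real c) < 7/5"
  shows "cmod (f z - dW z) \<le> 5 * exp 2 * A"
proof -
  define r where "r = cmod (z - of_real c)"
  have r: "1 < r" "r < 7/5" using z E_near_iff[of z] by (auto simp: r_def)
  define \<rho> where "\<rho> = (r - 1) / 4"
  have \<rho>: "\<rho> > 0" and \<rho>4: "4 * \<rho> = r - 1" using r by (simp_all add: \<rho>_def)
  have sub: "ball z \<rho> \<subseteq> E"
  proof
    fix w assume w: "w \<in> ball z \<rho>"
    have "1 < cmod (w - y)" if "r \<le> cmod (z - y)" for y
    proof -
      have "cmod (z - y) \<le> cmod (z - w) + cmod (w - y)" using norm_triangle_ineq[of "z - w" "w - y"] by simp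
      then show ?thesis using w that r by (simp add: dist_norm \<rho>_def)
    qed
    then show "w \<in> E" unfolding E_iff using nearest_centre[OF z(2,3)] by (simp add: r_def)
  qed
  have hw: "hgrad (ball z \<rho>) (\<lambda>w. u w - kR - W w) (\<lambda>w. f w - 0 - dW w)"
    by (intro hgrad_diff hgrad_const hgrad_subset[OF hg _ sub] hgrad_subset[OF hgrad_W _ sub]) auto
  have bnd: "\<bar>u w - kR - W w\<bar> \<le> A * (5 * \<rho>)" if w: "w \<in> ball z \<rho>" for w
  proof -
    have wE: "w \<in> E" using sub w by blast
    have "cmod (w - of_real c) \<le> cmod (w - z) + r" unfolding r_def using norm_triangle_ineq[of "w - z" "z - of_real c"] by simp
    then have wr: "cmod (w - of_real c) \<le> \<rho> + r" using w by (simp add: dist_norm norm_minus_commute)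
    then have "cmod (w - of_real c) < 3/2" using r \<rho>4 by linarith
    then have "\<bar>u w - kR - W w\<bar> \<le> A * ln (cmod (w - of_real c))" by (rule w_barrier[OF wE])
    also have "\<dots> \<le> A * (5 * \<rho>)"
    proof (intro mult_left_mono A_ge(1))
      have "1 < cmod (w - Complex c (of_int 0 * T))" using wE E_iff by blast
      then have "1 < cmod (w - of_real c)" by (simp only: complex_of_real_def of_int_0 mult_zero_left)
      then have "0 < cmod (w - of_real c)" by linarith
      then have "ln (cmod (w - of_real c)) \<le> cmod (w - of_real c) - 1" by (rule ln_le_minus_one)
      then show "ln (cmod (w - of_real c)) \<le> 5 * \<rho>" using wr \<rho>4 by linarith
    qed
    finally show ?thesis .
  qed
  show ?thesis
  proof (rule field_le_epsilon)
    fix e :: real assume e: "e > 0"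
    \<comment> \<open>The estimate requires \<open>K > 0\<close>, while \<open>A\<close> is 0 when
      \<open>a\<close> and \<open>b\<close> vanish; the extra term contributes exactly
      \<open>e\<close> to the result.\<close>
    define K where "K = A * (5 * \<rho>) + e * \<rho> / exp 2"
    have K: "K > 0" using A_ge(1) \<rho> e by (simp add: K_def add_nonneg_pos)
    have "cmod (f z - 0 - dW z) \<le> exp 2 * K / \<rho>"
    proof (rule hgrad_gradient_estimate[OF hw \<rho> K])
      fix w assume "w \<in> ball z \<rho>"
      then have "\<bar>u w - kR - W w\<bar> \<le> A * (5 * \<rho>)" by (rule bnd)
      moreover have "0 \<le> e * \<rho> / exp 2" using e \<rho> by simp
      ultimately show "\<bar>u w - kR - W w\<bar> \<le> K" unfolding K_def by linarith
    qed
    also have "exp 2 * K / \<rho> = 5 * exp 2 * A + e" using \<rho> by (simp add: K_def distrib_left add_divide_distrib)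
    finally show "cmod (f z - dW z) \<le> 5 * exp 2 * A + e" by simp
  qed
qed

text \<open>\<open>k\<close> is comparable to \<open>a * p\<close> and \<open>bL c\<close> to
  \<open>p\<close>, so the quotient is comparable to \<open>a\<close>; the two bounds of
  \<open>\<mu>0\<close> come from here.\<close>

lemma \<kappa>v_bound: "\<bar>\<kappa>v\<bar> \<le> 4 * C1 * \<bar>a\<bar>" "\<bar>a\<bar> \<le> 208 * \<bar>\<kappa>v\<bar>"
proof -
  have "\<bar>\<kappa>v\<bar> * p \<le> 201/200 * \<bar>k\<bar>" by (rule \<kappa>_bp)
  also have "\<dots> \<le> 201/200 * (3 * C1 * \<bar>a\<bar> * p)" using k_bounds(2) by (intro mult_left_mono) auto
  also have "\<dots> \<le> 4/3 * (3 * C1 * \<bar>a\<bar> * p)" using C1_pos p_bounds by (intro mult_right_mono) auto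
  finally have "\<bar>\<kappa>v\<bar> * p \<le> 4 * C1 * \<bar>a\<bar> * p" by simp
  then show "\<bar>\<kappa>v\<bar> \<le> 4 * C1 * \<bar>a\<bar>" using p_bounds by simp
  note C = bL_bounds[of c, OF c_bounds(1)]
  have "\<bar>a\<bar> * p \<le> 208 * \<bar>\<kappa>v * bL c\<bar>" using k_bounds(1) \<kappa>_bL by simp
  also have "\<dots> = 208 * \<bar>\<kappa>v\<bar> * bL c" using C(3) by (simp add: abs_mult)
  also have "\<dots> \<le> 208 * \<bar>\<kappa>v\<bar> * p" using C(2) by (intro mult_left_mono) (auto simp: bp_c)
  finally show "\<bar>a\<bar> \<le> 208 * \<bar>\<kappa>v\<bar>" using p_bounds by simp
qed

lemma \<kappa>h_dth_far:
  assumes "1/2 \<le> cmod (\<zeta> + of_real (d + bp d))" "1/2 \<le> cmod (\<zeta> + of_real (d - bp d))"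
  shows "cmod (of_real \<kappa>h * dth d \<zeta>) \<le> 9 * \<bar>b\<bar>"
proof -
  have "cmod (of_real \<kappa>h * dth d \<zeta>) \<le> \<bar>\<kappa>h\<bar> * (8 * bp d)"
    unfolding norm_mult using dth_far[of d \<zeta>] assms by (intro mult_mono) auto
  also have "\<dots> \<le> 9 * \<bar>b\<bar>" using \<kappa>_bp(2) by simp
  finally show ?thesis .
qed

lemma \<kappa>v_dth_far:
  assumes "1/2 \<le> cmod (\<zeta> + of_real (c + bp c))" "1/2 \<le> cmod (\<zeta> + of_real (c - bp c))"
  shows "cmod (of_real \<kappa>v * dth c \<zeta>) \<le> 9 * C1 * \<bar>a\<bar>"
proof -
  have "cmod (of_real \<kappa>v * dth c \<zeta>) \<le> \<bar>\<kappa>v\<bar> * (8 * p)"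
    unfolding norm_mult using dth_far[of c \<zeta>] assms by (intro mult_mono) (auto simp: bp_c)
  also have "\<dots> \<le> 9 * \<bar>k\<bar>" using \<kappa>_bp(1) by simp
  also have "\<dots> \<le> 9 * (C1 * \<bar>a\<bar>)" using k_le by simp
  finally show ?thesis by simp
qed

end

section \<open>Expansion of the potentials in the gaps\<close>

lemma one_minus_sqrt_bound:
  fixes y :: real
  assumes "\<bar>y\<bar> < sqrt 3 / 2"
  shows "y\<^sup>2 < 3/4" "1/2 \<le> sqrt (1 - y\<^sup>2)" "1 - sqrt (1 - y\<^sup>2) \<le> 2/3 * y\<^sup>2"
proof -
  have "\<bar>y\<bar>\<^sup>2 < (sqrt 3 / 2)\<^sup>2" using assms by (intro power_strict_mono) auto
  then show y: "y\<^sup>2 < 3/4" by (simp add: power_divide)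
  have "(1/2)\<^sup>2 \<le> 1 - y\<^sup>2" using y by (simp add: power_divide)
  then show h: "1/2 \<le> sqrt (1 - y\<^sup>2)" by (rule real_le_rsqrt)
  define S where "S = sqrt (1 - y\<^sup>2)"
  have S2: "S\<^sup>2 = 1 - y\<^sup>2" using y by (simp add: S_def)
  then have S1: "S \<le> 1" using power2_le_imp_le[of S 1] by simp
  have "(1 - S) * (3/2) \<le> (1 - S) * (1 + S)" using S1 h by (intro mult_left_mono) (auto simp: S_def)
  also have "\<dots> = y\<^sup>2" using S2 by (simp add: power2_eq_square algebra_simps)
  finally show "1 - sqrt (1 - y\<^sup>2) \<le> 2/3 * y\<^sup>2" by (simp add: S_def)
qed

text \<open>\<open>1/X\<close> is expanded to second order around \<open>1/D\<close>; the error is \<open>e\<^sup>2/(D\<^sup>2 X)\<close> with \<open>e = X - D = O(D\<^bsup>3/2\<^esup>)\<close>.\<close>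

lemma reciprocal_expansion:
  fixes s t \<delta> D :: real
  assumes \<delta>: "0 < \<delta>" and D: "D = s\<^sup>2 + \<delta>" "D \<le> 4/5" and t: "\<bar>t\<bar> \<le> 2/3 * D"
  defines "X \<equiv> Complex (s\<^sup>2 + (\<delta> + \<delta>\<^sup>2/4) - t\<^sup>2) (2 * s * t)"
  shows "D/2 \<le> cmod X" "cmod (1 / X - Complex (1 / D) (- (2 * s * t / D\<^sup>2))) \<le> 13"
proof -
  have D0: "D > 0" using \<delta> D by (simp add: add_nonneg_pos)
  have dD: "\<delta> \<le> D" "s\<^sup>2 \<le> D" using D \<delta> by auto
  have t2: "t\<^sup>2 \<le> 4/9 * D\<^sup>2"
  proof -
    have "\<bar>t\<bar>\<^sup>2 \<le> (2/3 * D)\<^sup>2" using t by (intro power_mono) auto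
    then show ?thesis by (simp add: power_mult_distrib power_divide)
  qed
  have DD: "D\<^sup>2 \<le> 4/5 * D" using D0 D(2) by (simp add: power2_eq_square mult_right_mono)
  have "D/2 \<le> Re X"
  proof -
    have "Re X = D + \<delta>\<^sup>2/4 - t\<^sup>2" by (simp add: X_def D(1))
    moreover have "0 \<le> \<delta>\<^sup>2" by simp
    ultimately show ?thesis using t2 DD D0 by linarith
  qed
  then show Xl: "D/2 \<le> cmod X" using complex_Re_le_cmod[of X] by linarith
  then have X0: "X \<noteq> 0" using D0 by auto
  define e where "e = X - of_real D"
  have ee: "e = Complex (\<delta>\<^sup>2/4 - t\<^sup>2) (2 * s * t)" by (simp add: e_def X_def D(1) complex_eq_iff)
  have d2: "\<delta>\<^sup>2 \<le> D\<^sup>2" using dD \<delta> by (intro power_mono) auto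
  have abs1: "\<bar>\<delta>\<^sup>2/4 - t\<^sup>2\<bar> \<le> D\<^sup>2"
  proof -
    have "0 \<le> t\<^sup>2" "0 \<le> \<delta>\<^sup>2" by auto
    then show ?thesis using d2 t2 by linarith
  qed
  have e2: "(cmod e)\<^sup>2 \<le> 6 * D ^ 3"
  proof -
    have "(cmod e)\<^sup>2 = (\<delta>\<^sup>2/4 - t\<^sup>2)\<^sup>2 + (2 * s * t)\<^sup>2" unfolding ee by (simp add: cmod_power2)
    moreover have "(\<delta>\<^sup>2/4 - t\<^sup>2)\<^sup>2 \<le> (D\<^sup>2)\<^sup>2" using abs1 by (subst abs_le_square_iff[symmetric]) simp
    moreover have "(D\<^sup>2)\<^sup>2 \<le> D ^ 3"
    proof -
      have "D ^ 3 * D \<le> D ^ 3 * 1" using D0 D(2) by (intro mult_left_mono) auto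
      then show ?thesis by (simp add: power2_eq_square power3_eq_cube algebra_simps)
    qed
    moreover have "(2 * s * t)\<^sup>2 \<le> 4 * D ^ 3"
    proof -
      have "(2 * s * t)\<^sup>2 = 4 * (s\<^sup>2 * t\<^sup>2)" by (simp add: power_mult_distrib)
      also have "s\<^sup>2 * t\<^sup>2 \<le> D * D\<^sup>2" using dD t2 D0 zero_le_power2[of D] zero_le_power2[of t] by (intro mult_mono) linarith+
      finally show ?thesis by (simp add: power2_eq_square power3_eq_cube)
    qed
    moreover have "0 \<le> D ^ 3" using D0 by simp
    ultimately show ?thesis by linarith
  qed
  have id: "1 / X - (1 / of_real D - e / of_real D ^ 2) = e\<^sup>2 / (of_real D ^ 2 * X)"
  proof -
    have "X = of_real D + e" by (simp add: e_def)
    then show ?thesis using X0 D0 by (simp add: field_simps power2_eq_square)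
  qed
  have n1: "cmod (1 / X - (1 / of_real D - e / of_real D ^ 2)) \<le> 12"
  proof -
    have "cmod (1 / X - (1 / of_real D - e / of_real D ^ 2)) = (cmod e)\<^sup>2 / (D\<^sup>2 * cmod X)"
      unfolding id using D0 by (simp add: norm_divide norm_mult norm_power)
    also have "\<dots> \<le> 6 * D ^ 3 / (D\<^sup>2 * (D/2))"
      using e2 Xl D0 by (intro frac_le mult_left_mono mult_pos_pos) auto
    also have "\<dots> = 12" using D0 by (simp add: power2_eq_square power3_eq_cube)
    finally show ?thesis .
  qed
  have n2: "cmod (1 / of_real D - e / of_real D ^ 2 - Complex (1 / D) (- (2 * s * t / D\<^sup>2))) \<le> 1"
  proof -
    have "1 / of_real D - e / of_real D ^ 2 - Complex (1 / D) (- (2 * s * t / D\<^sup>2)) = of_real (- ((\<delta>\<^sup>2/4 - t\<^sup>2) / D\<^sup>2))"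
      unfolding ee by (simp add: complex_eq_iff Re_divide_of_real Im_divide_of_real flip: of_real_power)
    then have "cmod (1 / of_real D - e / of_real D ^ 2 - Complex (1 / D) (- (2 * s * t / D\<^sup>2))) = \<bar>\<delta>\<^sup>2/4 - t\<^sup>2\<bar> / D\<^sup>2"
      by (simp only: norm_of_real abs_minus_cancel abs_divide abs_power2)
    then show ?thesis using abs1 D0 by simp
  qed
  have "1 / X - Complex (1 / D) (- (2 * s * t / D\<^sup>2)) = (1 / X - (1 / of_real D - e / of_real D ^ 2)) + (1 / of_real D - e / of_real D ^ 2 - Complex (1 / D) (- (2 * s * t / D\<^sup>2)))"
    by simp
  then have "cmod (1 / X - Complex (1 / D) (- (2 * s * t / D\<^sup>2))) \<le> 12 + 1"
    by (simp only: norm_triangle_mono[OF n1 n2])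
  then show "cmod (1 / X - Complex (1 / D) (- (2 * s * t / D\<^sup>2))) \<le> 13" by simp
qed

text \<open>The summands are the remainder from \<open>w_gradient\<close>, then the errors of the
  potentials proportional to \<open>a\<close> and to \<open>b\<close>, large enough for both kinds
  of gap.\<close>

definition C2 :: real where "C2 = 5 * exp 2 * (20 * C1 + 100) + 16 * C1 + 60"

lemma C2_pos: "C2 > 0"
  using C1_pos exp_gt_zero[of "2::real"] by (simp add: C2_def add_pos_pos)

context cols
begin

lemma p_sq_eps: "p\<^sup>2 = \<epsilon> + \<epsilon>\<^sup>2/4"
  unfolding p_sq c_def by (simp add: power2_eq_square field_simps)

text \<open>Provides the hypotheses of \<open>w_gradient\<close>; the last bound keeps the point at
  distance at least 1/2 from the poles of the potentials for the neighbours above and below.\<close>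

lemma Nv_point:
  assumes "0 \<le> Re z" "Re z < c - sqrt (1 - (Im z)\<^sup>2)" "\<bar>Im z\<bar> < sqrt 3 / 2"
  shows "z \<in> E" "\<bar>Im z\<bar> \<le> T/2" "cmod (z - of_real c) < 7/5" "1/2 \<le> c - Re z"
proof -
  note S = one_minus_sqrt_bound[OF assms(3)]
  have "(Im z)\<^sup>2 \<le> 1\<^sup>2" using S(1) by simp
  then have "\<bar>Im z\<bar> \<le> 1" by (metis abs_1 abs_le_square_iff)
  then show im: "\<bar>Im z\<bar> \<le> T/2" using T_bounds by linarith
  show "1/2 \<le> c - Re z" using S(2) assms(2) by linarith
  have "(sqrt (1 - (Im z)\<^sup>2))\<^sup>2 < (c - Re z)\<^sup>2" using assms(2) S(1) by (intro power_strict_mono) auto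
  then have "1\<^sup>2 < (cmod (z - of_real c))\<^sup>2" using S(1) by (simp add: cmod_power2 power2_commute)
  then have 1: "1 < cmod (z - of_real c)" by (rule power2_less_imp_less) simp
  have "\<bar>Re z - c\<bar> \<le> \<bar>Re z + c\<bar>" using assms(1) c_bounds by linarith
  then have "(Re z - c)\<^sup>2 \<le> (Re z + c)\<^sup>2" by (simp only: abs_le_square_iff)
  then have "cmod (z - of_real c) \<le> cmod (z + of_real c)" by (simp add: cmod_def)
  then show "z \<in> E" using 1 E_near_iff[OF im] by auto
  have "(c - Re z)\<^sup>2 \<le> (201/200)\<^sup>2" using assms(1,2) S(2) c_bounds by (intro power_mono) auto
  then have "(cmod (z - of_real c))\<^sup>2 < (7/5)\<^sup>2" using S(1) by (simp add: cmod_power2 power2_commute power2_eq_square[of "7/5"] power2_eq_square[of "201/200"])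
  then show "cmod (z - of_real c) < 7/5" by (rule power2_less_imp_less) simp
qed

lemma Nh_point:
  assumes s: "\<bar>Re z - c\<bar> < sqrt 3 / 2" and "\<bar>Im z\<bar> \<le> d" "sqrt (1 - (Re z - c)\<^sup>2) < \<bar>Im z\<bar>"
  shows "z \<in> E" "0 \<le> Re z" "\<bar>Im z\<bar> \<le> T/2" "cmod (z - of_real c) < 7/5" "1/2 \<le> \<bar>Im z\<bar>"
proof -
  note S = one_minus_sqrt_bound[OF s]
  show im: "\<bar>Im z\<bar> \<le> T/2" using assms(2) by (simp add: d_def)
  show "1/2 \<le> \<bar>Im z\<bar>" using S(2) assms(3) by linarith
  have "\<bar>Re z - c\<bar>\<^sup>2 \<le> 1\<^sup>2" using S(1) by simp
  then have "\<bar>Re z - c\<bar> \<le> 1" by (rule power2_le_imp_le) simp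
  then show re: "0 \<le> Re z" using c_bounds by linarith
  have "(sqrt (1 - (Re z - c)\<^sup>2))\<^sup>2 < \<bar>Im z\<bar>\<^sup>2" using assms(3) S(1,2) by (intro power_strict_mono) auto
  then have "1\<^sup>2 < (cmod (z - of_real c))\<^sup>2" using S(1) by (simp add: cmod_power2)
  then have 1: "1 < cmod (z - of_real c)" by (rule power2_less_imp_less) simp
  have "\<bar>Re z - c\<bar> \<le> \<bar>Re z + c\<bar>" using re c_bounds by linarith
  then have "(Re z - c)\<^sup>2 \<le> (Re z + c)\<^sup>2" by (simp only: abs_le_square_iff)
  then have "cmod (z - of_real c) \<le> cmod (z + of_real c)" by (simp add: cmod_def)
  then show "z \<in> E" using 1 E_near_iff[OF im] by auto
  have "\<bar>Im z\<bar>\<^sup>2 \<le> (201/200)\<^sup>2" using assms(2) d_bounds by (intro power_mono) auto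
  then have "(cmod (z - of_real c))\<^sup>2 < (7/5)\<^sup>2" using S(1) by (simp add: cmod_power2 power2_eq_square[of "7/5"] power2_eq_square[of "201/200"])
  then show "cmod (z - of_real c) < 7/5" by (rule power2_less_imp_less) simp
qed

end

context sol
begin

text \<open>The field is \<open>2 * p / (p\<^sup>2 - z\<^sup>2)\<close>. In the gap
  \<open>Re z\<close> is at most of order \<open>D = p\<^sup>2 + y\<^sup>2\<close>, so replacing
  \<open>z\<^sup>2\<close> by \<open>-y\<^sup>2\<close> costs an error of order
  \<open>p * (1 + \<bar>y\<bar> / D)\<close>, which is bounded because
  \<open>2 * p * \<bar>y\<bar> \<le> D\<close>. Then \<open>p\<^sup>2\<close> is replaced by
  \<open>\<epsilon>\<close>, from which it differs by \<open>\<epsilon>\<^sup>2/4\<close>.\<close>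

lemma \<kappa>v_term:
  assumes z: "0 \<le> Re z" "Re z < c - sqrt (1 - (Im z)\<^sup>2)" "\<bar>Im z\<bar> < sqrt 3 / 2"
  shows "cmod (of_real \<kappa>v * dth c (z - of_real c) - of_real (2 * \<kappa>v * p / (\<epsilon> + (Im z)\<^sup>2))) \<le> 16 * C1 * \<bar>a\<bar>"
proof -
  define x where "x = Re z"
  define y where "y = Im z"
  note S = one_minus_sqrt_bound[OF z(3), folded y_def]
  define D where "D = p\<^sup>2 + y\<^sup>2"
  have D0: "D > 0" using p_bounds by (simp add: D_def add_pos_nonneg)
  have D1: "D \<le> 4/5"
  proof -
    have "p\<^sup>2 \<le> (11/100)\<^sup>2" using p_bounds by (intro power_mono) auto
    then have "p\<^sup>2 \<le> 1/20" by (simp add: power2_eq_square)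
    then show ?thesis using S(1) by (simp add: D_def)
  qed
  have "\<epsilon> \<le> p\<^sup>2" by (simp add: p_sq_eps)
  have x0: "0 \<le> x" using z by (simp add: x_def)
  have "x \<le> c - sqrt (1 - y\<^sup>2)" using z by (simp add: x_def y_def)
  then have "x \<le> \<epsilon>/2 + 2/3 * y\<^sup>2" using S(3) by (simp add: c_def)
  then have xD: "x \<le> 2/3 * D" using \<open>\<epsilon> \<le> p\<^sup>2\<close> eps by (simp add: D_def)
  then have "x\<^sup>2 \<le> (2/3 * D)\<^sup>2" using x0 by (intro power_mono) auto
  then have x2: "x\<^sup>2 \<le> 4/9 * D\<^sup>2" by (simp add: power_mult_distrib power_divide)
  have DD: "D\<^sup>2 \<le> 4/5 * D" using D0 D1 by (simp add: power2_eq_square mult_right_mono)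
  define Q where "Q = of_real (p\<^sup>2) - z\<^sup>2"
  define r where "r = Complex (x\<^sup>2) (2 * x * y)"
  have Qr: "Q = of_real D - r" by (simp add: Q_def r_def D_def x_def y_def complex_eq_iff power2_eq_square)
  have "Re Q = D - x\<^sup>2" by (simp add: Qr r_def)
  then have "D/2 \<le> Re Q" using x2 DD D0 by simp
  then have Ql: "D/2 \<le> cmod Q" using complex_Re_le_cmod[of Q] by linarith
  then have Q0: "Q \<noteq> 0" using D0 by auto
  have rn: "cmod r \<le> 4/9 * D\<^sup>2 + 4/3 * D * \<bar>y\<bar>"
  proof -
    have "cmod r \<le> \<bar>Re r\<bar> + \<bar>Im r\<bar>" by (rule cmod_le)
    also have "\<dots> = x\<^sup>2 + 2 * x * \<bar>y\<bar>" using x0 by (simp add: r_def abs_mult)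
    also have "\<dots> \<le> 4/9 * D\<^sup>2 + 2 * (2/3 * D) * \<bar>y\<bar>" using x2 xD by (intro add_mono mult_right_mono) auto
    finally show ?thesis by simp
  qed
  have py: "p * \<bar>y\<bar> \<le> D/2"
    using sum_squares_bound[of p "\<bar>y\<bar>"] by (simp add: D_def)
  have dthc: "dth c (z - of_real c) = of_real (2 * p) / Q"
  proof -
    have "z \<noteq> of_real p" "z \<noteq> - of_real p" using Q0 by (auto simp: Q_def)
    then have "dth c (z - of_real c) = - of_real (2 * p) / (z\<^sup>2 - of_real (p\<^sup>2))"
      using dth_eq[OF c_bounds(1), of "z - of_real c"] by (simp add: bp_c)
    also have "z\<^sup>2 - of_real (p\<^sup>2) = - Q" by (simp add: Q_def)
    finally show ?thesis by simp
  qed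
  have p2: "\<bar>\<kappa>v\<bar> * (2 * p) \<ge> 0" using p_bounds by simp
  have A1: "cmod (of_real \<kappa>v * dth c (z - of_real c) - of_real (2 * \<kappa>v * p / D)) \<le> 3 * \<bar>\<kappa>v\<bar>"
  proof -
    have "of_real \<kappa>v * dth c (z - of_real c) - of_real (2 * \<kappa>v * p / D) = of_real (2 * \<kappa>v * p) * (1 / Q - 1 / of_real D)"
      by (simp add: dthc right_diff_distrib)
    also have "1 / Q - 1 / of_real D = r / (of_real D * Q)"
    proof -
      have "1 / Q - 1 / of_real D = (of_real D - Q) / (of_real D * Q)" using Q0 D0 by (simp add: diff_frac_eq mult.commute)
      then show ?thesis by (simp add: Qr)
    qed
    finally have "cmod (of_real \<kappa>v * dth c (z - of_real c) - of_real (2 * \<kappa>v * p / D)) = 2 * \<bar>\<kappa>v\<bar> * p * (cmod r / (D * cmod Q))"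
      using D0 p_bounds by (simp add: norm_mult norm_divide abs_mult)
    also have "\<dots> \<le> 2 * \<bar>\<kappa>v\<bar> * p * ((4/9 * D\<^sup>2 + 4/3 * D * \<bar>y\<bar>) / (D * (D/2)))"
      using rn Ql D0 p_bounds by (intro mult_left_mono frac_le mult_pos_pos) auto
    also have "\<dots> = 2 * \<bar>\<kappa>v\<bar> * (8/9 * p + 8/3 * (p * \<bar>y\<bar>) / D)" using D0 by (simp add: power2_eq_square field_simps)
    also have "\<dots> \<le> 2 * \<bar>\<kappa>v\<bar> * (3/2)"
    proof (intro mult_left_mono)
      have "8/3 * (p * \<bar>y\<bar>) / D \<le> 8/3 * (D/2) / D" using py D0 by (intro divide_right_mono mult_left_mono) auto
      also have "\<dots> = 4/3" using D0 by simp
      finally have "8/3 * (p * \<bar>y\<bar>) / D \<le> 4/3" .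
      then show "8/9 * p + 8/3 * (p * \<bar>y\<bar>) / D \<le> 3/2" using p_bounds by linarith
    qed auto
    finally show ?thesis by simp
  qed
  have A2: "cmod (of_real (2 * \<kappa>v * p / D) - of_real (2 * \<kappa>v * p / (\<epsilon> + y\<^sup>2))) \<le> \<bar>\<kappa>v\<bar>"
  proof -
    define G where "G = \<epsilon> + y\<^sup>2"
    have G: "\<epsilon> \<le> G" "0 < G" using eps by (auto simp: G_def add_pos_nonneg)
    have DG: "D = G + \<epsilon>\<^sup>2/4" by (simp add: D_def G_def p_sq_eps)
    have "2 * \<kappa>v * p / D - 2 * \<kappa>v * p / G = - (2 * \<kappa>v * p) * ((\<epsilon>\<^sup>2/4) / (D * G))"
      using D0 G unfolding DG by (simp add: field_simps)
    then have "\<bar>2 * \<kappa>v * p / D - 2 * \<kappa>v * p / G\<bar> = 2 * \<bar>\<kappa>v\<bar> * p * ((\<epsilon>\<^sup>2/4) / (D * G))"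
      using D0 G p_bounds by (simp add: abs_mult)
    also have "\<dots> \<le> 2 * \<bar>\<kappa>v\<bar> * p * ((\<epsilon>\<^sup>2/4) / (\<epsilon> * \<epsilon>))"
    proof (intro mult_left_mono divide_left_mono mult_pos_pos mult_mono)
      show "\<epsilon> \<le> D" using G DG by (simp add: add_increasing2)
    qed (use D0 G eps p_bounds in auto)
    also have "\<dots> = \<bar>\<kappa>v\<bar> * (p/2)" using eps by (simp add: power2_eq_square)
    also have "\<dots> \<le> \<bar>\<kappa>v\<bar> * 1" using p_bounds by (intro mult_left_mono) auto
    finally have "\<bar>2 * \<kappa>v * p / D - 2 * \<kappa>v * p / G\<bar> \<le> \<bar>\<kappa>v\<bar>" by simp
    then show ?thesis by (simp only: G_def flip: of_real_diff) (simp only: norm_of_real)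
  qed
  have "cmod (of_real \<kappa>v * dth c (z - of_real c) - of_real (2 * \<kappa>v * p / (\<epsilon> + y\<^sup>2))) \<le> 3 * \<bar>\<kappa>v\<bar> + \<bar>\<kappa>v\<bar>"
    by (rule order_trans[OF norm_triangle_mono[OF A1 A2, simplified add_diff_eq diff_add_cancel] order_refl])
  also have "\<dots> \<le> 16 * C1 * \<bar>a\<bar>" using \<kappa>v_bound(1) by simp
  finally show ?thesis by (simp add: y_def)
qed

lemma Nv_right:
  assumes z: "0 \<le> Re z" "Re z < c - sqrt (1 - (Im z)\<^sup>2)" "\<bar>Im z\<bar> < sqrt 3 / 2"
  shows "cmod (f z - of_real (2 * \<kappa>v * p / (\<epsilon> + (Im z)\<^sup>2))) \<le> C2 * (\<bar>a\<bar> + \<bar>b\<bar>)"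
proof -
  note N = Nv_point[OF z]
  have 1: "cmod (f z - dW z) \<le> 5 * exp 2 * A" by (rule w_gradient[OF N(1) z(1) N(2,3)])
  have far: "1/2 \<le> cmod (\<mu> * (z - of_real c) + of_real y)" if "\<mu> = \<i> \<or> \<mu> = - \<i>" for \<mu> y
    using that N(4) abs_Im_le_cmod[of "\<mu> * (z - of_real c) + of_real y"] by auto
  have 2: "cmod (of_real \<kappa>h * dth d (\<i> * (z - of_real c))) \<le> 9 * \<bar>b\<bar>"
    "cmod (of_real \<kappa>h * dth d (- \<i> * (z - of_real c))) \<le> 9 * \<bar>b\<bar>"
    by (intro \<kappa>h_dth_far far; simp)+
  have 3: "cmod (of_real \<kappa>v * dth c (z - of_real c) - of_real (2 * \<kappa>v * p / (\<epsilon> + (Im z)\<^sup>2))) \<le> 16 * C1 * \<bar>a\<bar>"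
    by (rule \<kappa>v_term[OF z])
  have e: "f z - of_real (2 * \<kappa>v * p / (\<epsilon> + (Im z)\<^sup>2)) =
    (f z - dW z) + ((of_real \<kappa>v * dth c (z - of_real c) - of_real (2 * \<kappa>v * p / (\<epsilon> + (Im z)\<^sup>2)))
      + (- \<i> * (of_real \<kappa>h * dth d (\<i> * (z - of_real c))) + - \<i> * (of_real \<kappa>h * dth d (- \<i> * (z - of_real c)))))"
    by (simp add: dW_def algebra_simps)
  have nh: "cmod (- \<i> * (of_real \<kappa>h * dth d (\<i> * (z - of_real c)))) \<le> 9 * \<bar>b\<bar>"
    "cmod (- \<i> * (of_real \<kappa>h * dth d (- \<i> * (z - of_real c)))) \<le> 9 * \<bar>b\<bar>"
    using 2 by (simp_all only: norm_mult norm_minus_cancel norm_ii mult_1)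
  have "cmod (f z - of_real (2 * \<kappa>v * p / (\<epsilon> + (Im z)\<^sup>2))) \<le> 5 * exp 2 * A + (16 * C1 * \<bar>a\<bar> + (9 * \<bar>b\<bar> + 9 * \<bar>b\<bar>))"
    unfolding e by (intro norm_triangle_mono 1 3 nh)
  also have "\<dots> \<le> C2 * (\<bar>a\<bar> + \<bar>b\<bar>)"
  proof -
    have "0 \<le> C1 * \<bar>b\<bar>" using C1_pos by simp
    then show ?thesis by (simp add: C2_def A_def algebra_simps)
  qed
  finally show ?thesis .
qed

text \<open>\<open>bp d * \<kappa>h\<close> is \<open>b\<close> times
  \<open>bp d * d / bL d\<close>, a ratio between 1 and \<open>d\<^sup>2\<close>. The factor
  \<open>\<delta>\<close> in the error matters because in the gap it is divided by a quantity for
  which only the lower bound \<open>\<delta>/2\<close> is available.\<close>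

lemma \<kappa>h_coeff: "\<bar>2 * bp d * \<kappa>h - 2 * b\<bar> \<le> 4 * \<delta> * \<bar>b\<bar>"
proof -
  note D = bL_bounds[of d, OF d_bounds(1)]
  define R where "R = bp d * d / bL d"
  have "1 \<le> R"
  proof -
    have "bL d * 1 \<le> bp d * d" using D d_bounds bp_d_bounds by (intro mult_mono) auto
    then show ?thesis using D by (simp add: R_def)
  qed
  moreover have "R \<le> d\<^sup>2"
  proof -
    have "bp d * d \<le> bL d * d * d" using D d_bounds by (intro mult_right_mono) auto
    then show ?thesis using D by (simp add: R_def field_simps power2_eq_square)
  qed
  moreover have "d\<^sup>2 - 1 \<le> 2 * \<delta>"
  proof -
    have "\<delta> * \<delta> \<le> \<delta> * 1" using del by (intro mult_left_mono) auto
    then show ?thesis using bp_sq[of d] d_bounds d_sq del by (simp add: power2_eq_square)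
  qed
  ultimately have "\<bar>R - 1\<bar> \<le> 2 * \<delta>" by linarith
  moreover have "2 * bp d * \<kappa>h - 2 * b = 2 * b * (R - 1)" by (simp add: \<kappa>h_def R_def d_def field_simps)
  ultimately have "\<bar>2 * bp d * \<kappa>h - 2 * b\<bar> \<le> \<bar>2 * b\<bar> * (2 * \<delta>)"
    by (simp only: abs_mult[of "2 * b"]) (intro mult_left_mono abs_ge_zero)
  then show ?thesis by (simp add: abs_mult mult_ac)
qed

text \<open>The main term of the claim in the horizontal gap, as x-derivative minus \<i> times
  y-derivative, in coordinates centred in the middle of the gap. The two factors
  \<open>sqrt \<delta>\<close> have cancelled.\<close>

definition Ftarget :: "real \<Rightarrow> real \<Rightarrow> complex" where
  "Ftarget x t = Complex (- (4 * b * x * t / (x\<^sup>2 + \<delta>)\<^sup>2)) (- (2 * b / (x\<^sup>2 + \<delta>)))"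

text \<open>Only the square of \<open>w\<close> is prescribed, so that the neighbours above and
  below, whose \<open>w\<close> differ in sign, are treated together. The coefficient error divided
  by \<open>\<delta>/2\<close> gives 8, and twice the 13 of \<open>reciprocal_expansion\<close>
  gives 26.\<close>

lemma \<kappa>h_term:
  assumes xs: "\<bar>x\<bar> < sqrt 3 / 2" and t: "\<bar>t\<bar> < d - sqrt (1 - x\<^sup>2)" and w: "w\<^sup>2 = (Complex (-t) x)\<^sup>2"
    and \<zeta>: "\<zeta> + of_real d = w"
  shows "cmod (- \<i> * (of_real \<kappa>h * dth d \<zeta>) - Ftarget x t) \<le> 34 * \<bar>b\<bar>"
proof -
  note S = one_minus_sqrt_bound[OF xs]
  have d_eq: "d = 1 + \<delta>/2" by (simp add: d_def T_def)
  define D where "D = x\<^sup>2 + \<delta>"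
  have D0: "D > 0" using del by (simp add: D_def add_nonneg_pos)
  have D1: "D \<le> 4/5" using S(1) del by (simp add: D_def)
  have "\<bar>t\<bar> \<le> \<delta>/2 + 2/3 * x\<^sup>2" using S(3) t d_eq by linarith
  then have tD: "\<bar>t\<bar> \<le> 2/3 * D" using del by (simp add: D_def)
  define X where "X = Complex (x\<^sup>2 + (\<delta> + \<delta>\<^sup>2/4) - t\<^sup>2) (2 * x * t)"
  note R = reciprocal_expansion[OF del(1) D_def D1 tD, folded X_def]
  have X0: "X \<noteq> 0" using R(1) D0 by auto
  have wX: "w\<^sup>2 - of_real ((bp d)\<^sup>2) = - X"
    unfolding w X_def d_sq by (simp add: complex_eq_iff power2_eq_square)
  have "dth d \<zeta> = - of_real (2 * bp d) / (w\<^sup>2 - of_real ((bp d)\<^sup>2))"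
    unfolding \<zeta>[symmetric]
  proof (rule dth_eq[OF d_bounds(1)])
    show "\<zeta> + of_real d \<noteq> of_real (bp d)" "\<zeta> + of_real d \<noteq> - of_real (bp d)"
      using wX X0 unfolding \<zeta> by auto
  qed
  then have dt: "dth d \<zeta> = of_real (2 * bp d) / X" unfolding wX by simp
  define G where "G = Complex (1 / D) (- (2 * x * t / D\<^sup>2))"
  have FG: "Ftarget x t = - \<i> * of_real (2 * b) * G"
    by (simp add: Ftarget_def G_def D_def complex_eq_iff)
  have e: "- \<i> * (of_real \<kappa>h * dth d \<zeta>) - Ftarget x t = - \<i> * of_real (2 * bp d * \<kappa>h - 2 * b) * (1 / X) + - \<i> * of_real (2 * b) * (1 / X - G)"
    unfolding dt FG by (simp add: algebra_simps)
  have "cmod (- \<i> * of_real (2 * bp d * \<kappa>h - 2 * b) * (1 / X)) \<le> 8 * \<bar>b\<bar>"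
  proof -
    have "cmod (- \<i> * of_real (2 * bp d * \<kappa>h - 2 * b) * (1 / X)) = \<bar>2 * bp d * \<kappa>h - 2 * b\<bar> / cmod X"
      by (simp only: norm_mult norm_divide norm_minus_cancel norm_ii norm_of_real norm_one mult_1 times_divide_eq_right mult_1_right)
    also have "\<dots> \<le> (4 * \<delta> * \<bar>b\<bar>) / (\<delta>/2)"
    proof (rule frac_le)
      have "\<delta> \<le> D" by (simp add: D_def)
      then show "\<delta>/2 \<le> cmod X" using R(1) by linarith
    qed (use \<kappa>h_coeff del in auto)
    also have "\<dots> = 8 * \<bar>b\<bar>" using del by simp
    finally show ?thesis .
  qed
  moreover have "cmod (- \<i> * of_real (2 * b) * (1 / X - G)) \<le> 26 * \<bar>b\<bar>"
  proof -
    have "cmod (- \<i> * of_real (2 * b) * (1 / X - G)) = 2 * \<bar>b\<bar> * cmod (1 / X - G)"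
      by (simp only: norm_mult norm_minus_cancel norm_ii norm_of_real abs_mult mult_1 abs_numeral)
    also have "\<dots> \<le> 2 * \<bar>b\<bar> * 13" using R(2) by (intro mult_left_mono) (auto simp: G_def)
    finally show ?thesis by simp
  qed
  ultimately have "cmod (- \<i> * (of_real \<kappa>h * dth d \<zeta>) - Ftarget x t) \<le> 8 * \<bar>b\<bar> + 26 * \<bar>b\<bar>"
    unfolding e by (rule norm_triangle_mono)
  then show ?thesis by simp
qed

text \<open>\<open>t\<close> is measured from the middle of the gap that contains \<open>z\<close>,
  above or below the disk. The potential of the neighbour across that gap is expanded; the other two
  are bounded because their poles are at distance at least 1/2.\<close>

lemma Nh_half:
  assumes s: "\<bar>Re z - c\<bar> < sqrt 3 / 2" and im: "\<bar>Im z\<bar> \<le> d" "sqrt (1 - (Re z - c)\<^sup>2) < \<bar>Im z\<bar>"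
    and t: "t = (if 0 \<le> Im z then Im z - d else Im z + d)"
  shows "cmod (f z - Ftarget (Re z - c) t) \<le> C2 * (\<bar>a\<bar> + \<bar>b\<bar>)"
proof -
  note N = Nh_point[OF assms(1-3)]
  define \<sigma> :: complex where "\<sigma> = (if 0 \<le> Im z then \<i> else - \<i>)"
  have 1: "cmod (f z - dW z) \<le> 5 * exp 2 * A" by (rule w_gradient[OF N(1-4)])
  have 2: "cmod (of_real \<kappa>v * dth c (z - of_real c)) \<le> 9 * C1 * \<bar>a\<bar>"
  proof (rule \<kappa>v_dth_far)
    show "1/2 \<le> cmod (z - of_real c + of_real (c + bp c))" "1/2 \<le> cmod (z - of_real c + of_real (c - bp c))"
      using N(5) abs_Im_le_cmod[of "z - of_real c + of_real (c + bp c)"] abs_Im_le_cmod[of "z - of_real c + of_real (c - bp c)"] by simp_all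
  qed
  have 3: "cmod (of_real \<kappa>h * dth d (- \<sigma> * (z - of_real c))) \<le> 9 * \<bar>b\<bar>"
  proof (rule \<kappa>h_dth_far)
    have h: "1/2 \<le> cmod (- \<sigma> * (z - of_real c) + of_real y)" if "0 \<le> y" for y
      using N(5) that complex_Re_le_cmod[of "- \<sigma> * (z - of_real c) + of_real y"] by (auto simp: \<sigma>_def split: if_splits)
    show "1/2 \<le> cmod (- \<sigma> * (z - of_real c) + of_real (d + bp d))" by (rule h) (use d_bounds bp_d_bounds in simp)
    show "1/2 \<le> cmod (- \<sigma> * (z - of_real c) + of_real (d - bp d))" by (rule h) (use d_bounds bp_d_bounds in simp)
  qed
  have 4: "cmod (- \<i> * (of_real \<kappa>h * dth d (\<sigma> * (z - of_real c))) - Ftarget (Re z - c) t) \<le> 34 * \<bar>b\<bar>"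
  proof (rule \<kappa>h_term[OF s _ _ refl])
    show "\<bar>t\<bar> < d - sqrt (1 - (Re z - c)\<^sup>2)" using im t by (auto split: if_splits)
    show "(\<sigma> * (z - of_real c) + of_real d)\<^sup>2 = (Complex (-t) (Re z - c))\<^sup>2"
    proof (cases "0 \<le> Im z")
      case True
      then have "\<sigma> * (z - of_real c) + of_real d = Complex (-t) (Re z - c)" using t by (simp add: \<sigma>_def complex_eq_iff)
      then show ?thesis by simp
    next
      case False
      then have "\<sigma> * (z - of_real c) + of_real d = - Complex (-t) (Re z - c)" using t by (simp add: \<sigma>_def complex_eq_iff)
      then show ?thesis by simp
    qed
  qed
  have e: "f z - Ftarget (Re z - c) t = (f z - dW z) + (of_real \<kappa>v * dth c (z - of_real c)
      + (- \<i> * (of_real \<kappa>h * dth d (- \<sigma> * (z - of_real c))) + (- \<i> * (of_real \<kappa>h * dth d (\<sigma> * (z - of_real c))) - Ftarget (Re z - c) t)))"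
    by (simp add: dW_def \<sigma>_def algebra_simps)
  have nh: "cmod (- \<i> * (of_real \<kappa>h * dth d (- \<sigma> * (z - of_real c)))) \<le> 9 * \<bar>b\<bar>"
    using 3 by (simp only: norm_mult norm_minus_cancel norm_ii mult_1)
  have "cmod (f z - Ftarget (Re z - c) t) \<le> 5 * exp 2 * A + (9 * C1 * \<bar>a\<bar> + (9 * \<bar>b\<bar> + 34 * \<bar>b\<bar>))"
    unfolding e by (intro norm_triangle_mono 1 2 nh 4)
  also have "\<dots> \<le> C2 * (\<bar>a\<bar> + \<bar>b\<bar>)"
  proof -
    have "0 \<le> C1 * \<bar>b\<bar>" "0 \<le> C1 * \<bar>a\<bar>" using C1_pos by simp_all
    then show ?thesis by (simp add: C2_def A_def algebra_simps)
  qed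
  finally show ?thesis .
qed

lemma Nh_estimate:
  assumes s: "\<bar>Re z - c\<bar> < sqrt 3 / 2" and t: "\<bar>Im z - d\<bar> < d - sqrt (1 - (Re z - c)\<^sup>2)"
  shows "cmod (f z - Ftarget (Re z - c) (Im z - d)) \<le> C2 * (\<bar>a\<bar> + \<bar>b\<bar>)"
proof (cases "Im z \<le> d")
  case True
  have "sqrt (1 - (Re z - c)\<^sup>2) < Im z" using t by linarith
  moreover have "0 < Im z" using calculation one_minus_sqrt_bound(2)[OF s] by linarith
  ultimately show ?thesis using True by (intro Nh_half[OF s]) auto
next
  case False
  \<comment> \<open>Beyond the middle of the gap the nearest disk is
    \<open>D\<^sub>R\<^sub>1\<close>. Shifting by one period puts the point into the gap below
    \<open>D\<^sub>R\<^sub>0\<close> and leaves its distance from the middle of the gap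
    unchanged.\<close>
  define w where "w = z - iT"
  have w: "Re w = Re z" "Im w = Im z - 2 * d" by (simp_all add: w_def d_def)
  have "sqrt (1 - (Re z - c)\<^sup>2) < - Im w" using t w by linarith
  moreover have neg: "Im w < 0" using calculation one_minus_sqrt_bound(2)[OF s] by linarith
  ultimately have w2: "\<bar>Im w\<bar> \<le> d" "sqrt (1 - (Re w - c)\<^sup>2) < \<bar>Im w\<bar>" using False w by auto
  have s': "\<bar>Re w - c\<bar> < sqrt 3 / 2" using s w by simp
  have "cmod (f w - Ftarget (Re w - c) (Im z - d)) \<le> C2 * (\<bar>a\<bar> + \<bar>b\<bar>)"
    by (rule Nh_half[OF s' w2]) (use neg w in auto)
  moreover have "f w = f z" using fper[OF Nh_point(1)[OF s' w2]] by (simp add: w_def)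
  ultimately show ?thesis using w by simp
qed

lemma Nv_estimate:
  assumes "\<bar>Re z\<bar> < c - sqrt (1 - (Im z)\<^sup>2)" "\<bar>Im z\<bar> < sqrt 3 / 2"
  shows "cmod (f z - of_real (2 * \<kappa>v * p / (\<epsilon> + (Im z)\<^sup>2))) \<le> C2 * (\<bar>a\<bar> + \<bar>b\<bar>)"
proof (cases "0 \<le> Re z")
  case True
  then show ?thesis using assms by (intro Nv_right) auto
next
  case False
  interpret r: sol \<epsilon> \<delta> "-a" b kR kL "\<lambda>z. u (- cnj z)" "\<lambda>z. - cnj (f (- cnj z))" by (rule reflect)
  have "r.k = - k" by (simp add: k_def r.k_def field_simps)
  then have rk: "r.\<kappa>v = - \<kappa>v" by (simp add: \<kappa>v_def r.\<kappa>v_def)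
  have "cmod (- cnj (f (- cnj (- cnj z))) - of_real (2 * r.\<kappa>v * p / (\<epsilon> + (Im (- cnj z))\<^sup>2))) \<le> C2 * (\<bar>- a\<bar> + \<bar>b\<bar>)"
    by (rule r.Nv_right) (use False assms in auto)
  moreover have "- cnj (f (- cnj (- cnj z))) - of_real (2 * r.\<kappa>v * p / (\<epsilon> + (Im (- cnj z))\<^sup>2)) = - cnj (f z - of_real (2 * \<kappa>v * p / (\<epsilon> + (Im z)\<^sup>2)))"
    by (simp add: rk)
  ultimately show ?thesis by (metis (no_types, lifting) abs_minus_cancel complex_mod_cnj norm_minus_cancel)
qed

end

section \<open>From real to complex notation\<close>

lemma pd_has_derivative:
  assumes "g differentiable (at q)"
  shows "(g has_derivative (\<lambda>h. pd1 g q * fst h + pd2 g q * snd h)) (at q)"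
proof -
  define D where "D = frechet_derivative g (at q)"
  have D: "(g has_derivative D) (at q)" using assms frechet_derivative_works D_def by blast
  then have lin: "linear D" by (rule has_derivative_linear)
  have "D h = pd1 g q * fst h + pd2 g q * snd h" for h
  proof -
    have "h = fst h *\<^sub>R (1, 0) + snd h *\<^sub>R (0, 1)" by (simp add: prod_eq_iff)
    then have "D h = D (fst h *\<^sub>R (1, 0) + snd h *\<^sub>R (0, 1))" by simp
    also have "\<dots> = fst h *\<^sub>R D (1, 0) + snd h *\<^sub>R D (0, 1)" by (simp only: linear_add[OF lin] linear_scale[OF lin])
    finally show ?thesis by (simp add: pd1_def pd2_def D_def)
  qed
  then have "D = (\<lambda>h. pd1 g q * fst h + pd2 g q * snd h)" by blast
  then show ?thesis using D by simp
qed

lemma pd1_real_derivative: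
  assumes "g differentiable (at (x, y))"
  shows "((\<lambda>x. g (x, y)) has_real_derivative pd1 g (x, y)) (at x)"
proof -
  have 1: "((\<lambda>x. (x, y)) has_derivative (\<lambda>h. (h, 0))) (at x)" by (auto intro!: derivative_eq_intros)
  have "((\<lambda>x. g (x, y)) has_derivative (\<lambda>h. pd1 g (x, y) * fst (h, 0::real) + pd2 g (x, y) * snd (h, 0::real))) (at x)"
    by (rule has_derivative_compose[OF 1 pd_has_derivative[OF assms]])
  then show ?thesis by (simp add: has_field_derivative_def)
qed

lemma pd2_real_derivative:
  assumes "g differentiable (at (x, y))"
  shows "((\<lambda>y. g (x, y)) has_real_derivative pd2 g (x, y)) (at y)"
proof -
  have 1: "((\<lambda>y. (x, y)) has_derivative (\<lambda>h. (0, h))) (at y)" by (auto intro!: derivative_eq_intros)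
  have "((\<lambda>y. g (x, y)) has_derivative (\<lambda>h. pd1 g (x, y) * fst (0::real, h) + pd2 g (x, y) * snd (0::real, h))) (at y)"
    by (rule has_derivative_compose[OF 1 pd_has_derivative[OF assms]])
  then show ?thesis by (simp add: has_field_derivative_def)
qed

text \<open>Both mixed partials are second difference quotients of \<open>u\<close> over the same small square,
  evaluated at intermediate points.\<close>

lemma mixed_partials_eq:
  assumes S: "open S" "q \<in> S"
    and u: "\<And>p. p \<in> S \<Longrightarrow> u differentiable (at p)" "\<And>p. p \<in> S \<Longrightarrow> pd1 u differentiable (at p)" "\<And>p. p \<in> S \<Longrightarrow> pd2 u differentiable (at p)"
    and cont: "continuous_on S (pd2 (pd1 u))" "continuous_on S (pd1 (pd2 u))"
  shows "pd2 (pd1 u) q = pd1 (pd2 u) q"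
proof (rule ccontr)
  assume ne: "pd2 (pd1 u) q \<noteq> pd1 (pd2 u) q"
  define \<eta> where "\<eta> = \<bar>pd2 (pd1 u) q - pd1 (pd2 u) q\<bar> / 2"
  have \<eta>: "\<eta> > 0" using ne by (simp add: \<eta>_def)
  obtain r1 where r1: "r1 > 0" "\<And>p. p \<in> S \<Longrightarrow> dist p q < r1 \<Longrightarrow> dist (pd2 (pd1 u) p) (pd2 (pd1 u) q) < \<eta>"
    using cont(1) S(2) \<eta> unfolding continuous_on_iff by metis
  obtain r2 where r2: "r2 > 0" "\<And>p. p \<in> S \<Longrightarrow> dist p q < r2 \<Longrightarrow> dist (pd1 (pd2 u) p) (pd1 (pd2 u) q) < \<eta>"
    using cont(2) S(2) \<eta> unfolding continuous_on_iff by metis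
  obtain r3 where r3: "r3 > 0" "ball q r3 \<subseteq> S" using S open_contains_ball by blast
  define h where "h = min (min r1 r2) r3 / 3"
  have h: "h > 0" "2 * h < r1" "2 * h < r2" "2 * h < r3" using r1(1) r2(1) r3(1) by (auto simp: h_def min_def)
  obtain x y where q: "q = (x, y)" by (cases q)
  have near: "dist (x', y') q \<le> 2 * h" if "x \<le> x'" "x' \<le> x + h" "y \<le> y'" "y' \<le> y + h" for x' y'
  proof -
    have "dist (x', y') q \<le> dist x' x + dist y' y"
      unfolding q dist_Pair_Pair by (rule sqrt_sum_squares_le_sum) auto
    then show ?thesis using that by (simp add: dist_real_def)
  qed
  have inS: "(x', y') \<in> S" if "x \<le> x'" "x' \<le> x + h" "y \<le> y'" "y' \<le> y + h" for x' y'
    using near[OF that] h r3(2) by (auto simp: dist_commute)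
  define \<Delta> where "\<Delta> = u (x + h, y + h) - u (x + h, y) - (u (x, y + h) - u (x, y))"
  obtain \<xi> where \<xi>: "x < \<xi>" "\<xi> < x + h" "\<Delta> = (x + h - x) * (pd1 u (\<xi>, y + h) - pd1 u (\<xi>, y))"
  proof -
    have "\<exists>\<xi>>x. \<xi> < x + h \<and> (u (x + h, y + h) - u (x + h, y)) - (u (x, y + h) - u (x, y)) = (x + h - x) * (pd1 u (\<xi>, y + h) - pd1 u (\<xi>, y))"
      by (rule MVT2) (use h inS u(1) in \<open>auto intro!: DERIV_diff pd1_real_derivative\<close>)
    then show thesis using that by (auto simp: \<Delta>_def)
  qed
  obtain \<zeta> where \<zeta>: "y < \<zeta>" "\<zeta> < y + h" "pd1 u (\<xi>, y + h) - pd1 u (\<xi>, y) = (y + h - y) * pd2 (pd1 u) (\<xi>, \<zeta>)"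
  proof -
    have "\<exists>\<zeta>>y. \<zeta> < y + h \<and> pd1 u (\<xi>, y + h) - pd1 u (\<xi>, y) = (y + h - y) * pd2 (pd1 u) (\<xi>, \<zeta>)"
      by (rule MVT2) (use h inS u(2) \<xi> in \<open>auto intro!: pd2_real_derivative\<close>)
    then show thesis using that by auto
  qed
  obtain \<zeta>' where \<zeta>': "y < \<zeta>'" "\<zeta>' < y + h" "\<Delta> = (y + h - y) * (pd2 u (x + h, \<zeta>') - pd2 u (x, \<zeta>'))"
  proof -
    have "\<exists>\<zeta>'>y. \<zeta>' < y + h \<and> (u (x + h, y + h) - u (x, y + h)) - (u (x + h, y) - u (x, y)) = (y + h - y) * (pd2 u (x + h, \<zeta>') - pd2 u (x, \<zeta>'))"
      by (rule MVT2) (use h inS u(1) in \<open>auto intro!: DERIV_diff pd2_real_derivative\<close>)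
    then show thesis using that by (auto simp: \<Delta>_def)
  qed
  obtain \<xi>' where \<xi>': "x < \<xi>'" "\<xi>' < x + h" "pd2 u (x + h, \<zeta>') - pd2 u (x, \<zeta>') = (x + h - x) * pd1 (pd2 u) (\<xi>', \<zeta>')"
  proof -
    have "\<exists>\<xi>'>x. \<xi>' < x + h \<and> pd2 u (x + h, \<zeta>') - pd2 u (x, \<zeta>') = (x + h - x) * pd1 (pd2 u) (\<xi>', \<zeta>')"
      by (rule MVT2) (use h inS u(3) \<zeta>' in \<open>auto intro!: pd1_real_derivative\<close>)
    then show thesis using that by auto
  qed
  have "pd2 (pd1 u) (\<xi>, \<zeta>) = pd1 (pd2 u) (\<xi>', \<zeta>')"
    using \<xi>(3) \<zeta>(3) \<zeta>'(3) \<xi>'(3) h(1) by simp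
  moreover have "\<bar>pd2 (pd1 u) (\<xi>, \<zeta>) - pd2 (pd1 u) q\<bar> < \<eta>"
    using r1(2)[OF inS[of \<xi> \<zeta>]] near[of \<xi> \<zeta>] \<xi> \<zeta> h by (auto simp: dist_real_def)
  moreover have "\<bar>pd1 (pd2 u) (\<xi>', \<zeta>') - pd1 (pd2 u) q\<bar> < \<eta>"
    using r2(2)[OF inS[of \<xi>' \<zeta>']] near[of \<xi>' \<zeta>'] \<xi>' \<zeta>' h by (auto simp: dist_real_def)
  moreover have "\<bar>pd2 (pd1 u) q - pd1 (pd2 u) q\<bar> = 2 * \<eta>" by (simp add: \<eta>_def)
  ultimately show False by linarith
qed

lemma complex_pair_derivative:
  assumes "g differentiable (at (Re z, Im z))"
  shows "((\<lambda>z. g (Re z, Im z)) has_derivative (\<lambda>h. pd1 g (Re z, Im z) * Re h + pd2 g (Re z, Im z) * Im h)) (at z)"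
proof -
  have 1: "((\<lambda>z. (Re z, Im z)) has_derivative (\<lambda>h. (Re h, Im h))) (at z)" by (auto intro!: derivative_eq_intros)
  have "((\<lambda>z. g (Re z, Im z)) has_derivative (\<lambda>h. pd1 g (Re z, Im z) * fst (Re h, Im h) + pd2 g (Re z, Im z) * snd (Re h, Im h))) (at z)"
    by (rule has_derivative_compose[OF 1 pd_has_derivative[OF assms]])
  then show ?thesis by simp
qed

definition cgrad :: "(real \<times> real \<Rightarrow> real) \<Rightarrow> complex \<Rightarrow> complex" where
  "cgrad u z = Complex (pd1 u (Re z, Im z)) (- pd2 u (Re z, Im z))"

text \<open>Of the Cauchy-Riemann equations for \<open>cgrad u\<close>, one is the Laplace equation
  and the other the symmetry of the mixed partials.\<close>

lemma harmonic_hgrad: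
  assumes H: "harmonic_on S u" and S': "S' = {z. (Re z, Im z) \<in> S}"
  shows "hgrad S' (\<lambda>z. u (Re z, Im z)) (cgrad u)"
proof -
  have oS: "open S" and d0: "\<And>p. p \<in> S \<Longrightarrow> u differentiable (at p)"
    and d1: "\<And>p. p \<in> S \<Longrightarrow> pd1 u differentiable (at p)" and d2: "\<And>p. p \<in> S \<Longrightarrow> pd2 u differentiable (at p)"
    and c: "continuous_on S (pd2 (pd1 u))" "continuous_on S (pd1 (pd2 u))"
    and lap: "\<And>p. p \<in> S \<Longrightarrow> pd1 (pd1 u) p + pd2 (pd2 u) p = 0"
    using H unfolding harmonic_on_def by auto
  have "continuous_on UNIV (\<lambda>z. (Re z, Im z))" by (intro continuous_intros)
  then have "open ((\<lambda>z. (Re z, Im z)) -` S)" using open_vimage oS by blast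
  then have oS': "open S'" by (simp add: S' vimage_def)
  show ?thesis unfolding hgrad_def
  proof (intro conjI ballI oS')
    fix z assume "z \<in> S'"
    then have z: "(Re z, Im z) \<in> S" by (simp add: S')
    show "((\<lambda>z. u (Re z, Im z)) has_derivative (\<lambda>h. Re (cgrad u z * h))) (at z)"
      using complex_pair_derivative[OF d0[OF z]] by (simp add: cgrad_def)
  next
    have "(cgrad u has_field_derivative Complex (pd1 (pd1 u) (Re z, Im z)) (- pd1 (pd2 u) (Re z, Im z))) (at z)" if "z \<in> S'" for z
    proof -
      have z: "(Re z, Im z) \<in> S" using that by (simp add: S')
      define D where "D = Complex (pd1 (pd1 u) (Re z, Im z)) (- pd1 (pd2 u) (Re z, Im z))"
      have "((\<lambda>z. of_real (pd1 u (Re z, Im z)) - \<i> * of_real (pd2 u (Re z, Im z))) has_derivative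
          (\<lambda>h. of_real (pd1 (pd1 u) (Re z, Im z) * Re h + pd2 (pd1 u) (Re z, Im z) * Im h)
             - \<i> * of_real (pd1 (pd2 u) (Re z, Im z) * Re h + pd2 (pd2 u) (Re z, Im z) * Im h))) (at z)"
        by (intro has_derivative_diff has_derivative_mult_right has_derivative_of_real complex_pair_derivative d1 d2 z)
      moreover have "(\<lambda>z. of_real (pd1 u (Re z, Im z)) - \<i> * of_real (pd2 u (Re z, Im z))) = cgrad u"
        by (simp add: cgrad_def fun_eq_iff complex_eq_iff)
      moreover have "(\<lambda>h. of_real (pd1 (pd1 u) (Re z, Im z) * Re h + pd2 (pd1 u) (Re z, Im z) * Im h)
             - \<i> * of_real (pd1 (pd2 u) (Re z, Im z) * Re h + pd2 (pd2 u) (Re z, Im z) * Im h)) = (*) D"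
      proof
        fix h
        have m: "pd2 (pd1 u) (Re z, Im z) = pd1 (pd2 u) (Re z, Im z)" by (rule mixed_partials_eq[OF oS z d0 d1 d2 c])
        have l: "pd2 (pd2 u) (Re z, Im z) = - pd1 (pd1 u) (Re z, Im z)" using lap[OF z] by linarith
        show "of_real (pd1 (pd1 u) (Re z, Im z) * Re h + pd2 (pd1 u) (Re z, Im z) * Im h)
             - \<i> * of_real (pd1 (pd2 u) (Re z, Im z) * Re h + pd2 (pd2 u) (Re z, Im z) * Im h) = D * h"
          unfolding m l by (simp add: D_def complex_eq_iff)
      qed
      ultimately show ?thesis by (simp add: has_field_derivative_def D_def)
    qed
    then show "cgrad u holomorphic_on S'"
      by (meson holomorphic_on_def field_differentiable_def has_field_derivative_at_within)
  qed
qed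

section \<open>From finite energy to vertical lines with small gradient\<close>

context cols
begin

text \<open>Away from the disks the energy of a rectangle is an iterated integral, and the total
  energy bounds it for all rectangles at once.\<close>

lemma strip_integral_bound:
  assumes cont: "continuous_on E G"
    and int: "(\<lambda>q. (cmod (G (Complex (fst q) (snd q))))\<^sup>2) integrable_on (Omega \<delta> - closure (ball (cL \<epsilon> \<delta> 0) 1 \<union> ball (cR \<epsilon> \<delta> 0) 1))"
  shows "\<exists>B. \<forall>l r. c + 1 < l \<or> r < - (c + 1) \<longrightarrow>
    (\<lambda>x. integral {-T/2..T/2} (\<lambda>y. (cmod (G (Complex x y)))\<^sup>2)) integrable_on {l..r} \<and>
    integral {l..r} (\<lambda>x. integral {-T/2..T/2} (\<lambda>y. (cmod (G (Complex x y)))\<^sup>2)) \<le> B"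
proof -
  define \<Omega> where "\<Omega> = Omega \<delta> - closure (ball (cL \<epsilon> \<delta> 0) 1 \<union> ball (cR \<epsilon> \<delta> 0) 1)"
  define g where "g q = (cmod (G (Complex (fst q) (snd q))))\<^sup>2" for q
  have int': "g integrable_on \<Omega>" using int by (simp add: g_def[abs_def] \<Omega>_def)
  show ?thesis
  proof (intro exI[of _ "integral \<Omega> g"] allI impI)
    fix l r assume lr: "c + 1 < l \<or> r < - (c + 1)"
    have cg: "continuous_on (cbox (l, -T/2) (r, T/2)) g"
    proof -
      have "continuous_on (cbox (l, -T/2) (r, T/2)) (\<lambda>q. G (Complex (fst q) (snd q)))"
        unfolding Complex_eq
        by (rule continuous_on_compose2[OF cont]) (use lr in \<open>auto intro!: continuous_intros E_iff_Re simp: cbox_Pair_eq\<close>)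
      then show ?thesis unfolding g_def by (intro continuous_intros)
    qed
    \<comment> \<open>\<open>Omega\<close> is open in the second coordinate, so only the open box
      fits into it; its integral is that of the closed box.\<close>
    have sub: "box (l, -T/2) (r, T/2) \<subseteq> \<Omega>"
    proof
      fix q assume "q \<in> box (l, -T/2) (r, T/2)"
      then have q: "l < fst q" "fst q < r" "-T/2 < snd q" "snd q < T/2" by (cases q; auto simp: box_def Basis_prod_def)+
      have ax: "\<bar>fst q\<bar> > c + 1" using q lr by linarith
      have "dist (x, y) q > 1" if "x = c \<or> x = - c" for x y
      proof -
        have "\<bar>x - fst q\<bar> > 1" using that ax c_bounds by (auto simp: abs_if split: if_splits)
        moreover have "dist (fst (x, y)) (fst q) \<le> dist (x, y) q" by (rule dist_fst_le)
        ultimately show ?thesis by (simp add: dist_real_def)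
      qed
      then have "q \<notin> cball (cL \<epsilon> \<delta> 0) 1 \<union> cball (cR \<epsilon> \<delta> 0) 1"
        by (auto simp: cL_def cR_def c_def not_le)
      then show "q \<in> \<Omega>" using q by (auto simp: \<Omega>_def Omega_def T_def mem_Times_iff)
    qed
    have i1: "g integrable_on cbox (l, -T/2) (r, T/2)" by (rule integrable_continuous[OF cg])
    have "integral {l..r} (\<lambda>x. integral {-T/2..T/2} (\<lambda>y. g (x, y))) = integral (cbox (l, -T/2) (r, T/2)) g"
      using integral_prod_continuous[OF cg] by simp
    also have "\<dots> = integral (box (l, -T/2) (r, T/2)) g" by (rule integral_open_interval[symmetric])
    also have "\<dots> \<le> integral \<Omega> g"
      using i1 by (intro integral_subset_le sub int') (auto simp: integrable_on_open_interval g_def)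
    finally have "integral {l..r} (\<lambda>x. integral {-T/2..T/2} (\<lambda>y. g (x, y))) \<le> integral \<Omega> g" .
    moreover have "(\<lambda>x. integral {-T/2..T/2} (\<lambda>y. g (x, y))) integrable_on {l..r}"
      using integral_integrable_2dim[OF cg] by simp
    ultimately show "(\<lambda>x. integral {-T/2..T/2} (\<lambda>y. (cmod (G (Complex x y)))\<^sup>2)) integrable_on {l..r} \<and>
      integral {l..r} (\<lambda>x. integral {-T/2..T/2} (\<lambda>y. (cmod (G (Complex x y)))\<^sup>2)) \<le> integral \<Omega> g"
      by (simp add: g_def)
  qed
qed

text \<open>If the integral of \<open>cmod G\<close> were at least \<open>\<eta>\<close> on all far
  lines, each of them would carry energy at least \<open>\<eta>\<^sup>2 / T\<close>, and a long
  enough rectangle would exceed the total.\<close>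

lemma good_line:
  assumes cont: "continuous_on E G"
    and int: "(\<lambda>q. (cmod (G (Complex (fst q) (snd q))))\<^sup>2) integrable_on (Omega \<delta> - closure (ball (cL \<epsilon> \<delta> 0) 1 \<union> ball (cR \<epsilon> \<delta> 0) 1))"
    and \<eta>: "0 < \<eta>" and \<sigma>: "\<sigma> = 1 \<or> \<sigma> = (-1::real)"
  shows "\<exists>x>X. integral {-T/2..T/2} (\<lambda>y. cmod (G (Complex (\<sigma> * x) y))) < \<eta>"
proof (rule ccontr)
  assume "\<not> ?thesis"
  then have big: "\<eta> \<le> integral {-T/2..T/2} (\<lambda>y. cmod (G (Complex (\<sigma> * x) y)))" if "x > X" for x
    using that not_less by blast
  obtain B where B: "\<And>l r. c + 1 < l \<or> r < - (c + 1) \<Longrightarrow>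
    (\<lambda>x. integral {-T/2..T/2} (\<lambda>y. (cmod (G (Complex x y)))\<^sup>2)) integrable_on {l..r} \<and>
    integral {l..r} (\<lambda>x. integral {-T/2..T/2} (\<lambda>y. (cmod (G (Complex x y)))\<^sup>2)) \<le> B"
    using strip_integral_bound[OF cont int] by blast
  \<comment> \<open>The pointwise bound
    \<open>t\<^sup>2 \<ge> 2 * \<tau> * t - \<tau>\<^sup>2\<close>, integrated with this mean value
    \<open>\<tau>\<close>, stands for the Cauchy-Schwarz inequality.\<close>
  define \<tau> where "\<tau> = \<eta> / T"
  define m where "m = \<eta>\<^sup>2 / T"
  have m: "m > 0" using \<eta> T_bounds by (simp add: m_def)
  have low: "m \<le> integral {-T/2..T/2} (\<lambda>y. (cmod (G (Complex x y)))\<^sup>2)"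
    if x: "\<bar>x\<bar> > c + 1" "\<eta> \<le> integral {-T/2..T/2} (\<lambda>y. cmod (G (Complex x y)))" for x
  proof -
    have c1: "continuous_on {-T/2..T/2} (\<lambda>y. G (Complex x y))"
      unfolding Complex_eq
      by (rule continuous_on_compose2[OF cont]) (use x in \<open>auto intro!: continuous_intros E_iff_Re\<close>)
    have i1: "((\<lambda>y. cmod (G (Complex x y))) has_integral integral {-T/2..T/2} (\<lambda>y. cmod (G (Complex x y)))) {-T/2..T/2}"
      using c1 by (intro integrable_integral integrable_continuous_real continuous_intros)
    have "((\<lambda>y. \<tau>\<^sup>2) has_integral (T * \<tau>\<^sup>2)) {-T/2..T/2}"
      using has_integral_const_real[of "\<tau>\<^sup>2" "-T/2" "T/2"] T_bounds by simp
    from has_integral_diff[OF has_integral_mult_right[OF i1, of "2 * \<tau>"] this]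
    have i2: "((\<lambda>y. 2 * \<tau> * cmod (G (Complex x y)) - \<tau>\<^sup>2) has_integral (2 * \<tau> * integral {-T/2..T/2} (\<lambda>y. cmod (G (Complex x y))) - T * \<tau>\<^sup>2)) {-T/2..T/2}" .
    have i3: "(\<lambda>y. (cmod (G (Complex x y)))\<^sup>2) integrable_on {-T/2..T/2}"
      using c1 by (intro integrable_continuous_real continuous_intros)
    have pt: "2 * \<tau> * t - \<tau>\<^sup>2 \<le> t\<^sup>2" for t :: real
      using zero_le_power2[of "t - \<tau>"] by (simp add: power2_diff algebra_simps)
    have le: "2 * \<tau> * integral {-T/2..T/2} (\<lambda>y. cmod (G (Complex x y))) - T * \<tau>\<^sup>2 \<le> integral {-T/2..T/2} (\<lambda>y. (cmod (G (Complex x y)))\<^sup>2)"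
      by (rule has_integral_le[OF i2 integrable_integral[OF i3]]) (rule pt)
    have "2 * \<tau> * \<eta> \<le> 2 * \<tau> * integral {-T/2..T/2} (\<lambda>y. cmod (G (Complex x y)))"
      using x(2) \<eta> T_bounds by (intro mult_left_mono) (auto simp: \<tau>_def)
    moreover have "2 * \<tau> * \<eta> - T * \<tau>\<^sup>2 = m" using T_bounds by (simp add: \<tau>_def m_def power2_eq_square field_simps)
    ultimately show ?thesis using le by linarith
  qed
  define X1 where "X1 = max X (c + 1) + 1"
  have X1: "X1 > X" "X1 > c + 1" by (auto simp: X1_def)
  obtain N :: nat where N: "B < of_nat N * m" using reals_Archimedean3[OF m] by blast
  define l where "l = (if \<sigma> = 1 then X1 else - (X1 + N))"
  define r where "r = (if \<sigma> = 1 then X1 + N else - X1)"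
  have lr: "c + 1 < l \<or> r < - (c + 1)" "l \<le> r" "r - l = N" using X1 \<sigma> by (auto simp: l_def r_def)
  have "m \<le> integral {-T/2..T/2} (\<lambda>y. (cmod (G (Complex x y)))\<^sup>2)" if "x \<in> {l..r}" for x
  proof (rule low)
    have "X1 \<le> \<sigma> * x" using that \<sigma> by (auto simp: l_def r_def)
    then have sx: "X < \<sigma> * x" "c + 1 < \<sigma> * x" using X1 by auto
    then show "\<bar>x\<bar> > c + 1" using \<sigma> by auto
    have e: "\<sigma> * (\<sigma> * x) = x" using \<sigma> by auto
    then show "\<eta> \<le> integral {-T/2..T/2} (\<lambda>y. cmod (G (Complex x y)))" using big[OF sx(1)] unfolding e by simp
  qed
  then have "integral {l..r} (\<lambda>x. m) \<le> integral {l..r} (\<lambda>x. integral {-T/2..T/2} (\<lambda>y. (cmod (G (Complex x y)))\<^sup>2))"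
    using B[OF lr(1)] by (intro integral_le) auto
  also have "\<dots> \<le> B" using B[OF lr(1)] by blast
  finally show False using N lr by simp
qed

end

lemma is_solution_sol:
  assumes eps: "0 < \<epsilon>" "\<epsilon> < 1/100" and del: "0 < \<delta>" "\<delta> < 1/100"
    and sol: "is_solution \<epsilon> \<delta> (\<lambda>q. a * fst q + b * snd q) u"
  shows "\<exists>kL kR. sol \<epsilon> \<delta> a b kL kR (\<lambda>z. u (Re z, Im z)) (cgrad u)"
proof -
  interpret cols \<epsilon> \<delta> using eps del by unfold_locales
  define H where "H q = a * fst q + b * snd q" for q :: "real \<times> real"
  have dH: "(H has_derivative H) (at q)" for q
    unfolding H_def by (auto intro!: derivative_eq_intros)
  then have fH: "frechet_derivative H (at q) = H" for q by (metis frechet_derivative_at)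
  have pH: "pd1 H q = a" "pd2 H q = b" for q by (simp_all add: pd1_def pd2_def fH H_def)
  have harm: "harmonic_on (ext_dom \<epsilon> \<delta>) u"
    and cL: "const_on_bdry (ext_dom \<epsilon> \<delta>) (cL \<epsilon> \<delta> 0) u" and cR: "const_on_bdry (ext_dom \<epsilon> \<delta>) (cR \<epsilon> \<delta> 0) u"
    and zR: "zero_flux (ext_dom \<epsilon> \<delta>) (cR \<epsilon> \<delta> 0) u"
    and en: "(\<lambda>q. (pd1 u q - pd1 H q)\<^sup>2 + (pd2 u q - pd2 H q)\<^sup>2) integrable_on
        (Omega \<delta> - closure (ball (cL \<epsilon> \<delta> 0) 1 \<union> ball (cR \<epsilon> \<delta> 0) 1))"
    and gp: "\<And>x y. (x, y) \<in> ext_dom \<epsilon> \<delta> \<Longrightarrow> grad u (x, y) = grad u (x, y + 2 + \<delta>)"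
    using sol unfolding is_solution_def H_def by auto
  have hg: "hgrad E (\<lambda>z. u (Re z, Im z)) (cgrad u)" by (rule harmonic_hgrad[OF harm E_def])
  have cont: "continuous_on E (cgrad u)" using hgradD(2)[OF hg] holomorphic_on_imp_continuous_on by blast
  have isoc: "((\<lambda>z. w (Re z, Im z)) \<longlongrightarrow> l) (at q within E)" if "(w \<longlongrightarrow> l) (at (Re q, Im q) within ext_dom \<epsilon> \<delta>)"
    for w :: "real \<times> real \<Rightarrow> 'x::topological_space" and l q
    by (rule tendsto_at_within_compose_iso[where g = "\<lambda>z. (Re z, Im z)", OF that])
      (auto simp: E_def complex_eq_iff intro!: continuous_intros)
  have sphR: "(Re q, Im q) \<in> sphere (cR \<epsilon> \<delta> 0) 1" if "cmod (q - of_real c) = 1" for q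
    using that by (simp add: cR_def c_def dist_Pair_Pair cmod_def dist_real_def power2_commute)
  have sphL: "(Re q, Im q) \<in> sphere (cL \<epsilon> \<delta> 0) 1" if "cmod (q + of_real c) = 1" for q
    using that by (simp add: cL_def c_def dist_Pair_Pair cmod_def dist_real_def) (simp add: power2_eq_square algebra_simps)
  obtain kL where kL: "\<And>q. q \<in> sphere (cL \<epsilon> \<delta> 0) 1 \<Longrightarrow> (u \<longlongrightarrow> kL) (at q within ext_dom \<epsilon> \<delta>)"
    using cL unfolding const_on_bdry_def by blast
  obtain kR where kR: "\<And>q. q \<in> sphere (cR \<epsilon> \<delta> 0) 1 \<Longrightarrow> (u \<longlongrightarrow> kR) (at q within ext_dom \<epsilon> \<delta>)"
    using cR unfolding const_on_bdry_def by blast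
  have fper: "cgrad u (z + iT) = cgrad u z" if "z \<in> E" for z
  proof -
    have "grad u (Re z, Im z) = grad u (Re z, Im z + 2 + \<delta>)" using that gp by (simp add: E_def)
    then show ?thesis by (simp add: cgrad_def grad_def T_def algebra_simps)
  qed
  have contD: "continuous_on E (\<lambda>z. cgrad u z - Complex a (-b))" using cont by (intro continuous_intros)
  have en': "(\<lambda>q. (cmod (cgrad u (Complex (fst q) (snd q)) - Complex a (-b)))\<^sup>2) integrable_on
        (Omega \<delta> - closure (ball (cL \<epsilon> \<delta> 0) 1 \<union> ball (cR \<epsilon> \<delta> 0) 1))"
    using en by (simp add: pH cgrad_def cmod_power2 power2_commute[of b])
  note lines = good_line[OF contD en']
  have lineR: "\<exists>x>X. integral {-T/2..T/2} (\<lambda>y. cmod (cgrad u (Complex x y) - Complex a (-b))) < \<eta>" if "0 < \<eta>" for \<eta> X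
    using lines[OF that, of 1] by simp
  have lineL: "\<exists>x>X. integral {-T/2..T/2} (\<lambda>y. cmod (cgrad u (Complex (-x) y) - Complex a (-b))) < \<eta>" if "0 < \<eta>" for \<eta> X
    using lines[OF that, of "-1"] by simp
  \<comment> \<open>By \<open>periodic_decay\<close> the gradient of \<open>u - H\<close> has mean
    zero on this line, so only the constant gradient of \<open>H\<close> contributes.\<close>
  have right: "((\<lambda>y. cgrad u (Complex (c + 2) y)) has_integral (T *\<^sub>R Complex a (-b))) {-T/2..T/2}"
  proof -
    have sub: "{z. c + 1 < Re z} \<subseteq> E" using E_iff_Re by auto
    have hol: "(\<lambda>z. cgrad u z - Complex a (-b)) holomorphic_on {z. c + 1 < Re z}"
      by (intro holomorphic_intros holomorphic_on_subset[OF hgradD(2)[OF hg] sub])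
    have per: "cgrad u (z + iT) - Complex a (-b) = cgrad u z - Complex a (-b)" if "c + 1 < Re z" for z
      using fper[of z] sub that by auto
    have "T > 0" using T_bounds by simp
    from periodic_decay[OF hol this per lineR]
    have 0: "((\<lambda>y. cgrad u (Complex (c + 2) y) - Complex a (-b)) has_integral 0) {-T/2..T/2}"
      by (metis add_strict_left_mono one_less_numeral_iff semiring_norm(76))
    have "((\<lambda>y. Complex a (-b)) has_integral (T *\<^sub>R Complex a (-b))) {-T/2..T/2}"
      using has_integral_const_real[of "Complex a (-b)" "-T/2" "T/2"] T_bounds by simp
    from has_integral_add[OF 0 this] show ?thesis by simp
  qed
  obtain G where G: "\<And>q. q \<in> sphere (cR \<epsilon> \<delta> 0) 1 \<Longrightarrow> (grad u \<longlongrightarrow> G q) (at q within ext_dom \<epsilon> \<delta>)"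
    and fl: "((\<lambda>t. G (cR \<epsilon> \<delta> 0 + (cos t, sin t)) \<bullet> (- (cos t, sin t))) has_integral 0) {0..2 * pi}"
    using zR unfolding zero_flux_def by blast
  define Gc where "Gc q = Complex (fst (G (Re q, Im q))) (- snd (G (Re q, Im q)))" for q
  have limG: "(cgrad u \<longlongrightarrow> Gc q) (at q within E)" if "cmod (q - of_real c) = 1" for q
  proof -
    have "((\<lambda>z. grad u (Re z, Im z)) \<longlongrightarrow> G (Re q, Im q)) (at q within E)" by (rule isoc[OF G[OF sphR[OF that]]])
    then have "((\<lambda>z. Complex (fst (grad u (Re z, Im z))) (- snd (grad u (Re z, Im z)))) \<longlongrightarrow> Gc q) (at q within E)"
      unfolding Gc_def by (intro tendsto_Complex tendsto_intros)
    then show ?thesis by (simp add: cgrad_def[abs_def] grad_def)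
  qed
  have flG: "((\<lambda>t. Re (Gc (of_real c + cis t) * cis t)) has_integral 0) {0..2*pi}"
  proof -
    \<comment> \<open>The normal in \<open>zero_flux\<close> points into the disk, hence the minus
      sign.\<close>
    have "Re (Gc (of_real c + cis t) * cis t) = - (G (cR \<epsilon> \<delta> 0 + (cos t, sin t)) \<bullet> (- (cos t, sin t)))" for t
      by (simp add: Gc_def cR_def c_def inner_prod_def)
    then show ?thesis using has_integral_neg[OF fl] by simp
  qed
  have flux0: "((\<lambda>y. Re (cgrad u (Complex 0 y))) has_integral a * T) {-T/2..T/2}"
    using flux_through_axis[OF hgradD(2)[OF hg] fper right limG flG] by (simp add: mult.commute)
  have "sol \<epsilon> \<delta> a b kL kR (\<lambda>z. u (Re z, Im z)) (cgrad u)"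
  proof
    show "((\<lambda>z. u (Re z, Im z)) \<longlongrightarrow> kR) (at q within E)" if "cmod (q - of_real c) = 1" for q
      by (rule isoc[OF kR[OF sphR[OF that]]])
    show "((\<lambda>z. u (Re z, Im z)) \<longlongrightarrow> kL) (at q within E)" if "cmod (q + of_real c) = 1" for q
      by (rule isoc[OF kL[OF sphL[OF that]]])
  qed (use hg fper lineR lineL flux0 in auto)
  then show ?thesis by blast
qed

lemma norm_pair_cmod: "norm (x, y) = cmod (Complex x (- y))"
  by (simp add: norm_Pair cmod_def)

theorem theorem1p3:
  shows "\<exists>C>0. \<exists>\<epsilon>0>0. \<exists>\<delta>0>0. \<forall>\<epsilon> \<delta> a b u.
    0 < \<epsilon> \<and> \<epsilon> < \<epsilon>0 \<and> 0 < \<delta> \<and> \<delta> < \<delta>0 \<and>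
    is_solution \<epsilon> \<delta> (\<lambda>p. a * fst p + b * snd p) u \<longrightarrow>
    (\<exists>\<mu>0 M1 M2. 1 / C < \<mu>0 \<and> \<mu>0 < C \<and>
       (\<forall>p\<in>Nh \<epsilon> \<delta>. norm (grad u p -
          (2 * b) *\<^sub>R ((1 / (\<delta> + (fst p - 1 - \<epsilon>/2)\<^sup>2)) *\<^sub>R (0, 1)
                     + ((1 / sqrt \<delta>) * Sfun \<epsilon> \<delta> p) *\<^sub>R (1, 0))) \<le> M1) \<and>
       (\<forall>p\<in>Nv \<epsilon>. norm (grad u p -
          (a * \<mu>0 * sqrt \<epsilon> / (\<epsilon> + (snd p)\<^sup>2)) *\<^sub>R (1, 0)) \<le> M2) \<and>
       M1 + M2 \<le> C * (\<bar>a\<bar> + \<bar>b\<bar>))"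
proof (rule exI[of _ "2 * C2 + 200"], intro conjI, goal_cases)
  case 1
  show ?case using C2_pos by simp
next
  case 2
  show ?case
  proof (rule exI[of _ "1/100"], intro conjI, simp, rule exI[of _ "1/100"], intro conjI allI impI, simp, elim conjE)
    fix \<epsilon> \<delta> a b :: real and u :: "real \<times> real \<Rightarrow> real"
    assume eps: "0 < \<epsilon>" "\<epsilon> < 1/100" and del: "0 < \<delta>" "\<delta> < 1/100"
      and issol: "is_solution \<epsilon> \<delta> (\<lambda>p. a * fst p + b * snd p) u"
    obtain kL kR where "sol \<epsilon> \<delta> a b kL kR (\<lambda>z. u (Re z, Im z)) (cgrad u)"
      using is_solution_sol[OF eps del issol] by blast
    then interpret S: sol \<epsilon> \<delta> a b kL kR "\<lambda>z. u (Re z, Im z)" "cgrad u" .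
    define C where "C = 2 * C2 + 200"
    define N where "N = \<bar>a\<bar> + \<bar>b\<bar>"
    \<comment> \<open>Solves \<open>a * \<mu>0 * sqrt \<epsilon> = 2 * \<kappa>v * p\<close>. For
      \<open>a = 0\<close> also \<open>\<kappa>v = 0\<close>, and 1 is a value within the required
      range.\<close>
    define \<mu>0 where "\<mu>0 = (if a = 0 then 1 else 2 * S.\<kappa>v * S.p / (a * sqrt \<epsilon>))"
    have se: "sqrt \<epsilon> > 0" using eps by simp
    have \<mu>: "1 / C < \<mu>0 \<and> \<mu>0 < C"
    proof (cases "a = 0")
      case True
      then show ?thesis using C2_pos by (simp add: \<mu>0_def C_def)
    next
      case False
      \<comment> \<open>\<open>\<mu>0 = 2 * R * Q\<close>, where \<open>R\<close> is between
        \<open>1/208\<close> and \<open>4 * C1\<close> by \<open>\<kappa>v_bound\<close>, and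
        \<open>Q\<close> is between 1 and 2 because
        \<open>p\<^sup>2 = \<epsilon> + \<epsilon>\<^sup>2/4\<close>.\<close>
      define R where "R = \<bar>S.\<kappa>v\<bar> / \<bar>a\<bar>"
      define Q where "Q = S.p / sqrt \<epsilon>"
      have "0 \<le> a * S.\<kappa>v"
      proof -
        have "0 \<le> a * S.k / bL S.c" using S.k_bounds(3) bL_bounds(3)[OF S.c_bounds(1)] by simp
        then show ?thesis by (simp add: S.\<kappa>v_def)
      qed
      then have "S.\<kappa>v / a = R"
        using False unfolding R_def by (cases "a > 0") (auto simp: zero_le_mult_iff abs_if split: if_splits)
      moreover have "\<mu>0 = 2 * (S.\<kappa>v / a) * Q" using False by (simp add: \<mu>0_def Q_def)
      ultimately have mu: "\<mu>0 = 2 * R * Q" by simp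
      have R1: "1/208 \<le> R" using S.\<kappa>v_bound(2) False by (simp add: R_def field_simps)
      have R2: "R \<le> 4 * C1" using S.\<kappa>v_bound(1) False by (simp add: R_def field_simps)
      have "(sqrt \<epsilon>)\<^sup>2 \<le> S.p\<^sup>2" using eps by (simp add: S.p_sq_eps)
      then have Q1: "1 \<le> Q" using se S.p_bounds power2_le_imp_le[of "sqrt \<epsilon>" S.p] by (simp add: Q_def)
      have "\<epsilon> * \<epsilon> \<le> \<epsilon> * 1" using eps by (intro mult_left_mono) auto
      then have "S.p\<^sup>2 \<le> (2 * sqrt \<epsilon>)\<^sup>2" using eps by (simp add: S.p_sq_eps power_mult_distrib) (simp add: power2_eq_square)
      then have "S.p \<le> 2 * sqrt \<epsilon>" using se by (elim power2_le_imp_le) simp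
      then have Q2: "Q \<le> 2" using se by (simp add: Q_def field_simps)
      have "2 * (1/208) * 1 \<le> 2 * R * Q" using R1 Q1 by (intro mult_mono) auto
      moreover have "2 * R * Q \<le> 2 * (4 * C1) * 2" using R1 R2 Q1 Q2 by (intro mult_mono) auto
      moreover have "16 * C1 < C" using C1_pos exp_gt_zero[of "2::real"] by (simp add: C_def C2_def add_pos_pos)
      moreover have "1 / C < 1/104" using C2_pos by (simp add: C_def field_simps)
      ultimately show ?thesis unfolding mu by linarith
    qed
    have h: "norm (grad u q - (2 * b) *\<^sub>R ((1 / (\<delta> + (fst q - 1 - \<epsilon>/2)\<^sup>2)) *\<^sub>R (0, 1)
                     + ((1 / sqrt \<delta>) * Sfun \<epsilon> \<delta> q) *\<^sub>R (1, 0))) \<le> C2 * N" if "q \<in> Nh \<epsilon> \<delta>" for q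
    proof -
      obtain x y where q: "q = (x, y)" by (cases q)
      define z where "z = Complex x y"
      have d: "S.d = 1 + \<delta>/2" "S.c = 1 + \<epsilon>/2" by (auto simp: S.d_def S.T_def S.c_def)
      have "cmod (cgrad u z - S.Ftarget (Re z - S.c) (Im z - S.d)) \<le> C2 * N"
        unfolding N_def by (rule S.Nh_estimate) (use that in \<open>auto simp: z_def Nh_def q d diff_diff_add\<close>)
      moreover have "grad u q - (2 * b) *\<^sub>R ((1 / (\<delta> + (fst q - 1 - \<epsilon>/2)\<^sup>2)) *\<^sub>R (0, 1) + ((1 / sqrt \<delta>) * Sfun \<epsilon> \<delta> q) *\<^sub>R (1, 0))
        = (Re (cgrad u z - S.Ftarget (Re z - S.c) (Im z - S.d)), - Im (cgrad u z - S.Ftarget (Re z - S.c) (Im z - S.d)))"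
        using del by (simp add: q z_def grad_def cgrad_def S.Ftarget_def Sfun_def d diff_diff_add add.commute)
      ultimately show ?thesis by (simp only: norm_pair_cmod minus_minus complex_surj)
    qed
    have v: "norm (grad u q - (a * \<mu>0 * sqrt \<epsilon> / (\<epsilon> + (snd q)\<^sup>2)) *\<^sub>R (1, 0)) \<le> C2 * N" if "q \<in> Nv \<epsilon>" for q
    proof -
      obtain x y where q: "q = (x, y)" by (cases q)
      define z where "z = Complex x y"
      have am: "a * \<mu>0 * sqrt \<epsilon> = 2 * S.\<kappa>v * S.p"
        using S.\<kappa>v_bound(1) se by (cases "a = 0") (auto simp: \<mu>0_def)
      have "cmod (cgrad u z - of_real (2 * S.\<kappa>v * S.p / (\<epsilon> + (Im z)\<^sup>2))) \<le> C2 * N"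
        unfolding N_def by (rule S.Nv_estimate) (use that in \<open>auto simp: z_def Nv_def q S.c_def\<close>)
      moreover have "grad u q - (a * \<mu>0 * sqrt \<epsilon> / (\<epsilon> + (snd q)\<^sup>2)) *\<^sub>R (1, 0)
        = (Re (cgrad u z - of_real (2 * S.\<kappa>v * S.p / (\<epsilon> + (Im z)\<^sup>2))), - Im (cgrad u z - of_real (2 * S.\<kappa>v * S.p / (\<epsilon> + (Im z)\<^sup>2))))"
        by (simp add: q z_def grad_def cgrad_def am)
      ultimately show ?thesis by (simp only: norm_pair_cmod minus_minus complex_surj)
    qed
    have "C2 * N + C2 * N \<le> C * (\<bar>a\<bar> + \<bar>b\<bar>)" by (simp add: C_def N_def algebra_simps)
    then show "\<exists>\<mu>0 M1 M2. 1 / (2 * C2 + 200) < \<mu>0 \<and> \<mu>0 < 2 * C2 + 200 \<and>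
       (\<forall>p\<in>Nh \<epsilon> \<delta>. norm (grad u p -
          (2 * b) *\<^sub>R ((1 / (\<delta> + (fst p - 1 - \<epsilon>/2)\<^sup>2)) *\<^sub>R (0, 1)
                     + ((1 / sqrt \<delta>) * Sfun \<epsilon> \<delta> p) *\<^sub>R (1, 0))) \<le> M1) \<and>
       (\<forall>p\<in>Nv \<epsilon>. norm (grad u p -
          (a * \<mu>0 * sqrt \<epsilon> / (\<epsilon> + (snd p)\<^sup>2)) *\<^sub>R (1, 0)) \<le> M2) \<and>
       M1 + M2 \<le> (2 * C2 + 200) * (\<bar>a\<bar> + \<bar>b\<bar>)"
      using \<mu> h v unfolding C_def by blast
  qed
qed

end
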